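(* Every infinite compact group contains an infinite closed metric subgroup.
   Context: The weight $w(X)$ of a topological space $X$ is the smallest cardinality of a basis of its topology. A compact group $G$ is called metric if and only if $w(G)\le\aleph_0$ (equivalently, it is metrizable). Compact groups are understood to be Hausdorff. *)

theory Defs
  imports "HOL-Analysis.Analysis" "HOL-Library.Countable_Set_Type" "HOL-Algebra.Group"
begin

unbundle cardinal_syntax

locale topological_group = group G
  for G :: "('a, 'b) monoid_scheme" (structure) and T :: "'a topology" +
  assumes topspace_eq_carrier: "topspace T = carrier G"
    and continuous_mult: "continuous_map (prod_topology T T) T (\<lambda>(x, y). x \<otimes> y)"
    and continuous_inv: "continuous_map T T (\<lambda>x. inv x)"

locale compact_group = topological_group +
  assumes compact: "compact_space T"
    and Hausdorff: "Hausdorff_space T"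

definition topology_basis :: "'a topology \<Rightarrow> 'a set set \<Rightarrow> bool" where
  "topology_basis X \<B> \<longleftrightarrow> openin X = arbitrary union_of (\<lambda>U. U \<in> \<B>)"

(* Cardinals are represented by cardinal orders, so the weight is given by the cardinal of
   some basis whose cardinality is least; it is determined up to the equivalence =o. *)
definition weight :: "'a topology \<Rightarrow> 'a set rel" where
  "weight X = |SOME \<B>. topology_basis X \<B> \<and> (\<forall>\<C>. topology_basis X \<C> \<longrightarrow> |\<B>| \<le>o |\<C>| )|"

definition metric_compact_group :: "('a, 'b) monoid_scheme \<Rightarrow> 'a topology \<Rightarrow> bool" where
  "metric_compact_group G T \<longleftrightarrow> compact_group G T \<and> weight T \<le>o natLeq"

lemma topology_basis_alt:
  "topology_basis X \<B> \<longleftrightarrow>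
    (\<forall>V\<in>\<B>. openin X V) \<and> (\<forall>U x. openin X U \<and> x \<in> U \<longrightarrow> (\<exists>V\<in>\<B>. x \<in> V \<and> V \<subseteq> U))"
  using openin_topology_base_unique[of X "\<lambda>U. U \<in> \<B>"]
  unfolding topology_basis_def by metis

lemma least_basis_exists:
  "\<exists>\<B>. topology_basis X \<B> \<and> (\<forall>\<C>. topology_basis X \<C> \<longrightarrow> |\<B>| \<le>o |\<C>| )"
proof -
  let ?R = "card_of ` {\<B>. topology_basis X \<B>}"
  have "topology_basis X {U. openin X U}"
    unfolding topology_basis_alt by blast
  then have "?R \<noteq> {}" by blast
  moreover have "\<forall>r\<in>?R. Well_order r"
    using card_of_Well_order by blast
  ultimately have "\<exists>r\<in>?R. \<forall>r'\<in>?R. r \<le>o r'"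
    by (rule exists_minim_Well_order)
  then show ?thesis
    unfolding bex_simps ball_simps mem_Collect_eq by blast
qed

lemma weight_basis:
  obtains \<B> where "topology_basis X \<B>" "weight X = |\<B>|"
  by (rule that[OF conjunct1[OF someI_ex[OF least_basis_exists]] weight_def])

lemma weight_least:
  assumes "topology_basis X \<C>"
  shows "weight X \<le>o |\<C>|"
  unfolding weight_def
  by (rule mp[OF spec[OF conjunct2[OF someI_ex[OF least_basis_exists]]] assms])

lemma weight_le_natLeq_iff: "weight X \<le>o natLeq \<longleftrightarrow> second_countable X"
proof
  assume le: "weight X \<le>o natLeq"
  obtain \<B> where basis: "topology_basis X \<B>" and weight: "weight X = |\<B>|"
    by (rule weight_basis)
  have "countable \<B>"
    using le unfolding weight countable_card_le_natLeq .
  then show "second_countable X"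
    using basis unfolding second_countable_def topology_basis_alt by blast
next
  assume "second_countable X"
  then obtain \<B> where count: "countable \<B>" and basis: "topology_basis X \<B>"
    unfolding second_countable_def topology_basis_alt by blast
  have "|\<B>| \<le>o natLeq"
    using count unfolding countable_card_le_natLeq .
  with weight_least[OF basis] show "weight X \<le>o natLeq"
    by (rule ordLeq_transitive)
qed

end

(* It suffices to find an infinite closed second countable subgroup. The Haar mean is
   constructed by averaging translates, and a hermitian convolution operator whose kernel is
   concentrated near 1 has finite-dimensional translation-invariant eigenspaces on which a given
   closed normal subgroup acts nontrivially (a weak form of the Peter-Weyl theorem).

   If every element has finite order, then on such a space the trace of a translation is a sum of
   roots of unity; with Baire's theorem this forces the kernel of the representation to be open, so
   open normal subgroups separate points. Zorn's lemma, applied to closed subgroups together with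
   sequences of cosets, gives a sequence of distinct elements converging to 1; the closed subgroup
   generated by it is second countable, because its open normal subgroups are determined by finite
   multiplication tables.

   If g has infinite order, the closure of the powers of g is an infinite compact abelian group,
   whose characters separate points and form an infinite group. Let C be a subgroup of characters
   that is maximal with trivial intersection with a countable infinite subgroup B. It has countable
   index, so countably many characters separate the points of its common kernel, which is therefore
   second countable. The characters in B restrict to distinct characters of this kernel, so it is
   infinite. *)
theory Submission
  imports Defs "HOL-Library.Diagonal_Subsequence" "HOL-Algebra.Generated_Groups"
    "Jordan_Normal_Form.Spectral_Radius"
begin

section \<open>Compact groups\<close>

text \<open>Metrizable quotients of a compact group are easy to produce; the obstacle is to pass
  from a quotient to a subgroup, and the two cases overcome it differently. For an abelian group
  duality exchanges quotients and subgroups, so the goal becomes an infinite countable quotient of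
  the character group; the maximal choice of the subgroup of characters makes the quotient an
  essential extension of a countable abelian group, and such extensions are countable. A torsion
  group need not be abelian. There a sequence converging to the identity is easy to find modulo a
  countable intersection of open normal subgroups, and the cosets are then shrunk until they are
  points. The mean stands in for Haar measure: only continuous functions are averaged, and as these
  are not complete for the inner product, eigenvectors are obtained by uniform convergence. The
  invariant spaces are built relative to a conjugation-invariant set, so that both cases can apply
  them to the intersection of all kernels already available and reach a contradiction.\<close>

lemma equicontinuous_slices:
  fixes k :: "'x \<Rightarrow> 'y \<Rightarrow> 'c::real_normed_vector"
  assumes k: "continuous_map (prod_topology X Y) euclidean (\<lambda>(x, y). k x y)"
    and Y: "compact_space Y" and x0: "x0 \<in> topspace X" and e: "e > 0"
  obtains U where "openin X U" "x0 \<in> U"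
    "\<And>x y. x \<in> U \<Longrightarrow> y \<in> topspace Y \<Longrightarrow> norm (k x y - k x0 y) < e"
proof -
  have slice: "continuous_map (prod_topology X Y) euclidean (\<lambda>p. k x0 (snd p))"
  proof -
    have "continuous_map (prod_topology X Y) (prod_topology X Y) (\<lambda>p. (x0, snd p))"
      using x0 by (auto simp: continuous_map_pairwise o_def continuous_map_snd)
    from continuous_map_compose[OF this k] show ?thesis by (simp add: o_def)
  qed
  have k': "continuous_map (prod_topology X Y) euclidean (\<lambda>p. k (fst p) (snd p))"
    using k by (simp add: case_prod_unfold)
  have "continuous_map (prod_topology X Y) euclideanreal
      (\<lambda>p. norm (k (fst p) (snd p) - k x0 (snd p)))"
    by (intro continuous_map_norm continuous_map_diff k' slice)
  then have "openin (prod_topology X Y)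
      {p \<in> topspace (prod_topology X Y). norm (k (fst p) (snd p) - k x0 (snd p)) \<in> {..<e}}"
    by (rule openin_continuous_map_preimage) simp
  moreover have "{x0} \<times> topspace Y \<subseteq>
      {p \<in> topspace (prod_topology X Y). norm (k (fst p) (snd p) - k x0 (snd p)) \<in> {..<e}}"
    using x0 e by auto
  ultimately have "\<exists>U V. openin X U \<and> openin Y V \<and> x0 \<in> U \<and> topspace Y \<subseteq> V \<and>
      U \<times> V \<subseteq> {p \<in> topspace (prod_topology X Y). norm (k (fst p) (snd p) - k x0 (snd p)) \<in> {..<e}}"
    by (rule tube_lemma_right[OF _ Y[unfolded compact_space_def] x0])
  then obtain U V where UV: "openin X U" "x0 \<in> U" "topspace Y \<subseteq> V"
      "U \<times> V \<subseteq> {p \<in> topspace (prod_topology X Y). norm (k (fst p) (snd p) - k x0 (snd p)) \<in> {..<e}}"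
    by (elim exE conjE)
  show thesis
  proof (rule that[OF UV(1,2)])
    fix x y assume "x \<in> U" "y \<in> topspace Y"
    then have "(x, y) \<in> U \<times> V" using UV(3) by blast
    then show "norm (k x y - k x0 y) < e" using UV(4) by force
  qed
qed

context topological_group
begin

lemma continuous_map_mult:
  assumes "continuous_map X T f" "continuous_map X T g"
  shows "continuous_map X T (\<lambda>x. f x \<otimes> g x)"
proof -
  have "continuous_map X (prod_topology T T) (\<lambda>x. (f x, g x))"
    using assms by (simp add: continuous_map_pairwise o_def)
  from continuous_map_compose[OF this continuous_mult] show ?thesis by (simp add: o_def)
qed

lemma continuous_map_inverse:
  assumes "continuous_map X T f"
  shows "continuous_map X T (\<lambda>x. inv (f x))"
  using continuous_map_compose[OF assms continuous_inv] by (simp add: o_def)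

lemma continuous_map_translate:
  assumes "continuous_map T X f" "a \<in> carrier G" "b \<in> carrier G"
  shows "continuous_map T X (\<lambda>x. f (a \<otimes> x))" "continuous_map T X (\<lambda>x. f (x \<otimes> b))"
proof -
  have "continuous_map T T (\<lambda>x. a \<otimes> x)" "continuous_map T T (\<lambda>x. x \<otimes> b)"
    using assms by (auto intro!: continuous_map_mult simp: topspace_eq_carrier)
  from this[THEN continuous_map_compose[OF _ assms(1)]]
  show "continuous_map T X (\<lambda>x. f (a \<otimes> x))" "continuous_map T X (\<lambda>x. f (x \<otimes> b))"
    by (simp_all add: o_def)
qed

lemma openin_left_translate:
  assumes "openin T U" "a \<in> carrier G"
  shows "openin T {x \<in> carrier G. a \<otimes> x \<in> U}"
  using openin_continuous_map_preimage[OF continuous_map_translate(1)[OF continuous_map_id[unfolded id_def]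
    assms(2,2)] assms(1)]
  by (simp add: topspace_eq_carrier)

lemma openin_right_translate:
  assumes "openin T U" "a \<in> carrier G"
  shows "openin T {x \<in> carrier G. x \<otimes> a \<in> U}"
  using openin_continuous_map_preimage[OF continuous_map_translate(2)[OF continuous_map_id[unfolded id_def]
    assms(2,2)] assms(1)]
  by (simp add: topspace_eq_carrier)

end

context compact_group
begin

text \<open>The translate by \<open>u \<otimes> inv x\<close> carries \<open>x\<close> to
  \<open>u\<close>, so the translates of \<open>U\<close> cover a compact group. Their finite number
  is the quantitative form of compactness behind the oscillation estimate, the strict positivity of
  the mean and the finite transversals of open subgroups.\<close>

lemma finite_translates_cover:
  assumes "openin T U" "u \<in> U"
  obtains S where "finite S" "S \<noteq> {}" "S \<subseteq> carrier G" "\<And>x. x \<in> carrier G \<Longrightarrow> \<exists>a\<in>S. a \<otimes> x \<in> U"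
proof -
  have uG: "u \<in> carrier G" using openin_subset[OF assms(1)] assms(2) by (auto simp: topspace_eq_carrier)
  let ?F = "(\<lambda>a. {x \<in> carrier G. a \<otimes> x \<in> U}) ` carrier G"
  have "\<exists>\<F>. finite \<F> \<and> \<F> \<subseteq> ?F \<and> carrier G \<subseteq> \<Union>\<F>"
  proof (rule compactinD)
    show "compactin T (carrier G)"
      using compact unfolding compact_space_def topspace_eq_carrier .
    show "carrier G \<subseteq> \<Union>?F"
    proof
      fix x assume x: "x \<in> carrier G"
      then have "(u \<otimes> inv x) \<otimes> x \<in> U" using uG assms by (simp add: m_assoc)
      then have "x \<in> {z \<in> carrier G. (u \<otimes> inv x) \<otimes> z \<in> U}" using x by simp
      moreover have "u \<otimes> inv x \<in> carrier G" using x uG by simp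
      ultimately show "x \<in> \<Union>?F" by (intro UN_I[of "u \<otimes> inv x"])
    qed
  next
    fix V assume "V \<in> ?F"
    then show "openin T V" by (elim imageE) (simp add: openin_left_translate[OF assms(1)])
  qed
  then obtain \<F> where F: "finite \<F>" "\<F> \<subseteq> ?F" "carrier G \<subseteq> \<Union>\<F>"
    by (elim exE conjE)
  from finite_subset_image[OF F(1,2)] obtain S where S: "finite S" "S \<subseteq> carrier G"
    "\<F> = (\<lambda>a. {x \<in> carrier G. a \<otimes> x \<in> U}) ` S"
    by (elim exE conjE)
  note S = S(1,2) F(3)[unfolded S(3)]
  show thesis
  proof (rule that[OF S(1) _ S(2)])
    show "S \<noteq> {}" using S(3) uG by auto
    show "\<exists>a\<in>S. a \<otimes> x \<in> U" if "x \<in> carrier G" for x using subsetD[OF S(3) that] by simp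
  qed
qed

text \<open>The displacement \<open>v\<close> stands on the right because right translations commute
  with left averages: one \<open>V\<close> chosen for \<open>f\<close> then serves every left
  average of \<open>f\<close>.\<close>

lemma uniformly_continuous_right:
  fixes f :: "'a \<Rightarrow> 'c::real_normed_vector"
  assumes f: "continuous_map T euclidean f" and e: "e > 0"
  obtains V where "openin T V" "\<one> \<in> V"
    "\<And>v x. v \<in> V \<Longrightarrow> x \<in> carrier G \<Longrightarrow> norm (f (x \<otimes> v) - f x) < e"
proof -
  have "continuous_map (prod_topology T T) T (\<lambda>p. snd p \<otimes> fst p)"
    by (intro continuous_map_mult continuous_map_fst continuous_map_snd)
  from continuous_map_compose[OF this f]
  have "continuous_map (prod_topology T T) euclidean (\<lambda>(v, x). f (x \<otimes> v))"
    by (simp add: o_def case_prod_unfold)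
  from equicontinuous_slices[OF this compact _ e, of \<one>]
  obtain V where "openin T V" "\<one> \<in> V"
    "\<And>v x. v \<in> V \<Longrightarrow> x \<in> carrier G \<Longrightarrow> norm (f (x \<otimes> v) - f (x \<otimes> \<one>)) < e"
    by (auto simp: topspace_eq_carrier)
  then show thesis by (intro that[of V]) auto
qed

lemma bounded_continuous:
  fixes f :: "'a \<Rightarrow> 'c::real_normed_vector"
  assumes "continuous_map T euclidean f"
  obtains B where "B > 0" "\<And>x. x \<in> carrier G \<Longrightarrow> norm (f x) \<le> B"
proof -
  have "compactin euclidean (f ` carrier G)"
    using image_compactin[OF _ assms] compact unfolding compact_space_def topspace_eq_carrier by blast
  then have "bounded (f ` carrier G)"
    by (simp add: compact_imp_bounded)
  then obtain B where "B > 0" "\<forall>y\<in>f ` carrier G. norm y \<le> B"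
    unfolding bounded_pos by blast
  then show thesis
    using that[of B] by simp
qed

section \<open>The Haar mean\<close>

text \<open>Averages over lists of left translates; the list counts multiplicities.\<close>

definition left_average :: "'a list \<Rightarrow> ('a \<Rightarrow> 'c::real_normed_vector) \<Rightarrow> 'a \<Rightarrow> 'c" where
  "left_average as f x = (\<Sum>a\<leftarrow>as. f (a \<otimes> x)) /\<^sub>R real (length as)"

definition group_list :: "'a list \<Rightarrow> bool" where
  "group_list as \<longleftrightarrow> as \<noteq> [] \<and> set as \<subseteq> carrier G"

lemma left_average_continuous:
  fixes f :: "'a \<Rightarrow> 'c::real_normed_vector"
  assumes "continuous_map T euclidean f" "group_list as"
  shows "continuous_map T euclidean (left_average as f)"
proof -
  have "continuous_map T euclidean (\<lambda>x. \<Sum>a\<leftarrow>as. f (a \<otimes> x))" if "set as \<subseteq> carrier G"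
    using that by (induction as)
      (auto intro!: continuous_map_add continuous_map_translate(1)[OF assms(1)])
  then have sum: "continuous_map T euclidean (\<lambda>x. \<Sum>a\<leftarrow>as. f (a \<otimes> x))"
    using assms(2) unfolding group_list_def by blast
  have "continuous_map euclidean euclidean (\<lambda>y::'c. (1 / real (length as)) *\<^sub>R y)"
    by (simp, intro continuous_intros)
  from continuous_map_compose[OF sum this]
  have "continuous_map T euclidean (\<lambda>x. (1 / real (length as)) *\<^sub>R (\<Sum>a\<leftarrow>as. f (a \<otimes> x)))"
    by (simp add: o_def)
  then show ?thesis
    unfolding left_average_def by (simp add: inverse_eq_divide)
qed

text \<open>Convolution of two finitely supported measures. The factors are ordered
  \<open>b \<otimes> a\<close> because the inner average is evaluated at
  \<open>a \<otimes> x\<close>.\<close>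

definition compose_list :: "'a list \<Rightarrow> 'a list \<Rightarrow> 'a list" where
  "compose_list as bs = concat (map (\<lambda>a. map (\<lambda>b. b \<otimes> a) bs) as)"

lemma group_list_compose:
  "group_list as \<Longrightarrow> group_list bs \<Longrightarrow> group_list (compose_list as bs)"
  unfolding group_list_def compose_list_def by (cases as) auto

lemma left_average_compose:
  assumes as: "group_list as" and bs: "group_list bs" and x: "x \<in> carrier G"
  shows "left_average as (left_average bs f) x = left_average (compose_list as bs) f x"
proof -
  have len: "length (compose_list as bs) = length as * length bs"
    unfolding compose_list_def by (induction as) auto
  have b: "(\<Sum>b\<leftarrow>bs. f (b \<otimes> (a \<otimes> x))) = (\<Sum>b\<leftarrow>map (\<lambda>b. b \<otimes> a) bs. f (b \<otimes> x))"
    if a: "a \<in> carrier G" for a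
  proof -
    have "map (\<lambda>b. f (b \<otimes> (a \<otimes> x))) bs = map (\<lambda>b. f (b \<otimes> x)) (map (\<lambda>b. b \<otimes> a) bs)"
      using bs a x unfolding group_list_def by (auto simp: m_assoc)
    then show ?thesis by presburger
  qed
  have "(\<Sum>a\<leftarrow>as. \<Sum>b\<leftarrow>bs. f (b \<otimes> (a \<otimes> x))) = (\<Sum>c\<leftarrow>compose_list as bs. f (c \<otimes> x))"
    if "set as \<subseteq> carrier G"
    using that unfolding compose_list_def by (induction as) (auto simp: b)
  then have eq: "(\<Sum>a\<leftarrow>as. \<Sum>b\<leftarrow>bs. f (b \<otimes> (a \<otimes> x))) = (\<Sum>c\<leftarrow>compose_list as bs. f (c \<otimes> x))"
    using as unfolding group_list_def by simp
  have "(\<Sum>a\<leftarrow>as. (\<Sum>b\<leftarrow>bs. f (b \<otimes> (a \<otimes> x))) /\<^sub>R real (length bs))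
      = (\<Sum>a\<leftarrow>as. \<Sum>b\<leftarrow>bs. f (b \<otimes> (a \<otimes> x))) /\<^sub>R real (length bs)"
    by (induction as) (auto simp: scaleR_add_right)
  then show ?thesis
    unfolding left_average_def eq[symmetric] len by (simp add: mult.commute)
qed

lemma norm_left_average_diff_le:
  assumes as: "group_list as" and x: "x \<in> carrier G"
    and d: "\<And>y. y \<in> carrier G \<Longrightarrow> norm (f y - c) \<le> e"
  shows "norm (left_average as f x - c) \<le> e"
proof -
  have "norm ((\<Sum>a\<leftarrow>as. f (a \<otimes> x)) - real (length as) *\<^sub>R c) \<le> real (length as) * e"
    if "set as \<subseteq> carrier G"
    using that
  proof (induction as)
    case (Cons a as)
    have "norm ((\<Sum>a\<leftarrow>a # as. f (a \<otimes> x)) - real (length (a # as)) *\<^sub>R c)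
       = norm ((f (a \<otimes> x) - c) + ((\<Sum>a\<leftarrow>as. f (a \<otimes> x)) - real (length as) *\<^sub>R c))"
      by (simp add: algebra_simps)
    also have "\<dots> \<le> e + real (length as) * e"
      using Cons x by (intro norm_triangle_mono d) auto
    finally show ?case by (simp add: algebra_simps)
  qed simp
  then have le: "norm ((\<Sum>a\<leftarrow>as. f (a \<otimes> x)) - real (length as) *\<^sub>R c) \<le> real (length as) * e"
    using as unfolding group_list_def by simp
  have l: "real (length as) > 0" using as unfolding group_list_def by simp
  have "left_average as f x - c = ((\<Sum>a\<leftarrow>as. f (a \<otimes> x)) - real (length as) *\<^sub>R c) /\<^sub>R real (length as)"
    unfolding left_average_def using l by (simp add: scaleR_diff_right)
  then have "norm (left_average as f x - c)
      = norm ((\<Sum>a\<leftarrow>as. f (a \<otimes> x)) - real (length as) *\<^sub>R c) / real (length as)"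
    using l by (simp add: divide_inverse_commute)
  then show ?thesis using le l by (simp add: divide_le_eq mult.commute)
qed

lemma left_average_linear:
  "left_average as (\<lambda>x. f x + g x) x = left_average as f x + left_average as g x"
  "left_average as (\<lambda>x. f x - g x) x = left_average as f x - left_average as g x"
  unfolding left_average_def
  by (simp_all add: sum_list_addf sum_list_subtractf scaleR_add_right scaleR_diff_right)

lemma left_average_cong:
  assumes "group_list as" "x \<in> carrier G" "\<And>y. y \<in> carrier G \<Longrightarrow> f y = g y"
  shows "left_average as f x = left_average as g x"
proof -
  have "map (\<lambda>a. f (a \<otimes> x)) as = map (\<lambda>a. g (a \<otimes> x)) as"
    using assms unfolding group_list_def by auto
  then show ?thesis unfolding left_average_def by (simp only:)
qed

lemma left_average_right_translate:
  assumes "group_list as" "x \<in> carrier G" "v \<in> carrier G"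
  shows "left_average as f (x \<otimes> v) = left_average as (\<lambda>y. f (y \<otimes> v)) x"
proof -
  have "map (\<lambda>a. f (a \<otimes> (x \<otimes> v))) as = map (\<lambda>a. f (a \<otimes> x \<otimes> v)) as"
    using assms unfolding group_list_def by (auto simp: m_assoc)
  then show ?thesis unfolding left_average_def by (simp only:)
qed

lemma left_average_norm_diff_right:
  assumes as: "group_list as" and x: "x \<in> carrier G" and v: "v \<in> carrier G"
    and d: "\<And>y. y \<in> carrier G \<Longrightarrow> norm (f (y \<otimes> v) - f y) \<le> e"
  shows "norm (left_average as f (x \<otimes> v) - left_average as f x) \<le> e"
proof -
  have "norm (left_average as (\<lambda>y. f (y \<otimes> v) - f y) x - 0) \<le> e"
    by (rule norm_left_average_diff_le[OF as x]) (simp add: d)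
  then show ?thesis
    by (simp add: left_average_right_translate[OF as x v] left_average_linear)
qed

lemma left_average_le:
  fixes f :: "'a \<Rightarrow> real"
  assumes as: "group_list as" and x: "x \<in> carrier G"
    and le: "\<And>y. y \<in> carrier G \<Longrightarrow> f y \<le> b"
  shows "left_average as f x \<le> b"
proof -
  have "(\<Sum>a\<leftarrow>as. f (a \<otimes> x)) \<le> (\<Sum>a\<leftarrow>as. b)"
    using as x unfolding group_list_def by (intro sum_list_mono le) auto
  moreover have "real (length as) > 0" using as unfolding group_list_def by simp
  ultimately show ?thesis
    unfolding left_average_def by (simp add: sum_list_triv divide_le_eq mult.commute inverse_eq_divide)
qed

lemma left_average_ge:
  fixes f :: "'a \<Rightarrow> real"
  assumes as: "group_list as" and x: "x \<in> carrier G"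
    and le: "\<And>y. y \<in> carrier G \<Longrightarrow> b \<le> f y"
  shows "b \<le> left_average as f x"
proof -
  have "left_average as (\<lambda>y. - f y) x \<le> - b"
    by (rule left_average_le[OF as x]) (simp add: le)
  moreover have "(\<Sum>a\<leftarrow>as. - f (a \<otimes> x)) = - (\<Sum>a\<leftarrow>as. f (a \<otimes> x))"
    by (induction as) auto
  then have "left_average as (\<lambda>y. - f y) x = - left_average as f x"
    unfolding left_average_def by simp
  ultimately show ?thesis by simp
qed

lemma continuous_attains_extrema:
  fixes f :: "'a \<Rightarrow> real"
  assumes "continuous_map T euclidean f"
  obtains x0 x1 where "x0 \<in> carrier G" "x1 \<in> carrier G"
    "\<And>x. x \<in> carrier G \<Longrightarrow> f x0 \<le> f x" "\<And>x. x \<in> carrier G \<Longrightarrow> f x \<le> f x1"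
proof -
  have c: "compact (f ` carrier G)"
    using image_compactin[OF _ assms] compact unfolding compact_space_def topspace_eq_carrier
    by (metis compactin_euclidean_iff)
  have ne: "f ` carrier G \<noteq> {}" using one_closed by blast
  from compact_attains_inf[OF c ne] compact_attains_sup[OF c ne] show thesis
    using that by (auto simp: image_iff)
qed

text \<open>Let \<open>p\<close> be the infimum of the oscillation bounds reached by averages of
  \<open>f\<close>. If it were positive, take an average \<phi> whose oscillation is almost
  \<open>p\<close> and average again over translates that carry every point close to a minimum of
  \<phi> at least once. One of the \<open>k\<close> terms is then small, so the maximum drops by an
  amount of order \<open>p / k\<close>, and the oscillation falls below \<open>p\<close>.\<close>

lemma ex_left_average_oscillation_less:
  fixes f :: "'a \<Rightarrow> real"
  assumes f: "continuous_map T euclidean f" and e: "e > 0"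
  obtains as where "group_list as"
    "\<And>x y. x \<in> carrier G \<Longrightarrow> y \<in> carrier G \<Longrightarrow> left_average as f x - left_average as f y \<le> e"
proof (rule ccontr)
  define D where "D = {d. \<exists>as. group_list as \<and>
    (\<forall>x\<in>carrier G. \<forall>y\<in>carrier G. left_average as f x - left_average as f y \<le> d)}"
  define p where "p = Inf D"
  assume "\<not> thesis"
  with that have no: "\<not> (\<forall>x\<in>carrier G. \<forall>y\<in>carrier G. left_average as f x - left_average as f y \<le> e)"
    if "group_list as" for as
    using that by blast
  have De: "e \<le> d" if "d \<in> D" for d
    using that no unfolding D_def by force
  have bdd: "bdd_below D" using De by (rule bdd_belowI)
  obtain B where B: "\<And>x. x \<in> carrier G \<Longrightarrow> norm (f x) \<le> B"
    using bounded_continuous[OF f] by blast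
  have ne: "D \<noteq> {}"
  proof -
    have "left_average [\<one>] f x - left_average [\<one>] f y \<le> 2 * B" if "x \<in> carrier G" "y \<in> carrier G" for x y
      using that B[of x] B[of y] unfolding left_average_def by auto
    then have "2 * B \<in> D" unfolding D_def group_list_def by (auto intro!: exI[of _ "[\<one>]"])
    then show ?thesis by blast
  qed
  have p: "p \<ge> e" unfolding p_def using cInf_greatest[OF ne De] by blast
  with e have p0: "p > 0" by simp
  \<comment> \<open>\<open>V\<close>, \<open>S\<close> and \<open>k\<close> depend only on
    \<open>f\<close> and \<open>p\<close>. They are fixed before the average \<phi> is chosen, so
    that the excess of its oscillation over \<open>p\<close> can be taken small compared with
    \<open>p / k\<close>.\<close>
  obtain V where V: "openin T V" "\<one> \<in> V"
    "\<And>v x. v \<in> V \<Longrightarrow> x \<in> carrier G \<Longrightarrow> norm (f (x \<otimes> v) - f x) < p / 4"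
    using uniformly_continuous_right[OF f, of "p/4"] p0 by auto
  obtain S where S: "finite S" "S \<noteq> {}" "S \<subseteq> carrier G" "\<And>x. x \<in> carrier G \<Longrightarrow> \<exists>a\<in>S. a \<otimes> x \<in> V"
    using finite_translates_cover[OF V(1,2)] by blast
  define k where "k = real (card S)"
  have k: "k \<ge> 1" unfolding k_def using S by (simp add: Suc_leI card_gt_0_iff)
  have "p < p + p / 4 / k" using p0 k by simp
  then obtain d where "d \<in> D" "d < p + p / 4 / k"
    unfolding p_def using cInf_lessD[OF ne] by (metis p_def)
  then obtain as where as: "group_list as"
    and das: "\<And>x y. x \<in> carrier G \<Longrightarrow> y \<in> carrier G \<Longrightarrow> left_average as f x - left_average as f y \<le> d"
    unfolding D_def by blast
  define \<phi> where "\<phi> = left_average as f"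
  have cphi: "continuous_map T euclidean \<phi>" unfolding \<phi>_def by (rule left_average_continuous[OF f as])
  obtain x0 x1 where x0: "x0 \<in> carrier G" "\<And>x. x \<in> carrier G \<Longrightarrow> \<phi> x0 \<le> \<phi> x"
    and x1: "x1 \<in> carrier G" "\<And>x. x \<in> carrier G \<Longrightarrow> \<phi> x \<le> \<phi> x1"
    using continuous_attains_extrema[OF cphi] by metis
  have "\<phi> x1 - \<phi> x0 \<in> D"
    unfolding D_def using as x0 x1 unfolding \<phi>_def by (auto intro!: exI[of _ as] diff_mono)
  then have p_le: "p \<le> \<phi> x1 - \<phi> x0" unfolding p_def by (rule cInf_lower[OF _ bdd])
  have le_d: "\<phi> x1 - \<phi> x0 \<le> d" using das x0 x1 unfolding \<phi>_def by blast
  obtain ss where ss: "set ss = S" "distinct ss" using S(1) finite_distinct_list by blast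
  \<comment> \<open>For each \<open>x\<close> some \<open>a\<close> in \<open>S\<close> has
    \<open>a \<otimes> x\<close> in \<open>V\<close>, which places
    \<open>x0 \<otimes> a \<otimes> x\<close> near the minimum point \<open>x0\<close>.\<close>
  define cs where "cs = map (\<lambda>a. x0 \<otimes> a) ss"
  have cs: "group_list cs" using ss S x0 unfolding cs_def group_list_def by auto
  have lcs: "real (length cs) = k" using distinct_card[OF ss(2)] ss(1) unfolding cs_def k_def by simp
  have upper: "left_average cs \<phi> x \<le> ((k - 1) * \<phi> x1 + (\<phi> x0 + p / 4)) / k" if x: "x \<in> carrier G" for x
  proof -
    obtain a where a: "a \<in> S" "a \<otimes> x \<in> V" using S(4) x by blast
    have aG: "a \<in> carrier G" using a S by blast
    have "norm (\<phi> (x0 \<otimes> (a \<otimes> x)) - \<phi> x0) \<le> p / 4"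
      unfolding \<phi>_def using V(3)[OF a(2)] aG x
      by (intro left_average_norm_diff_right[OF as x0(1)] less_imp_le) auto
    then have near: "\<phi> (x0 \<otimes> (a \<otimes> x)) \<le> \<phi> x0 + p / 4" unfolding real_norm_def by linarith
    have "(\<Sum>c\<leftarrow>cs. \<phi> (c \<otimes> x)) = (\<Sum>b\<leftarrow>ss. \<phi> (x0 \<otimes> b \<otimes> x))"
      unfolding cs_def by (simp add: o_def)
    also have "\<dots> = (\<Sum>b\<in>S. \<phi> (x0 \<otimes> b \<otimes> x))"
      using sum_list_distinct_conv_sum_set[OF ss(2)] ss(1) by simp
    also have "\<dots> = \<phi> (x0 \<otimes> a \<otimes> x) + (\<Sum>b\<in>S - {a}. \<phi> (x0 \<otimes> b \<otimes> x))"
      using a S by (simp add: sum.remove)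
    also have "\<dots> \<le> (\<phi> x0 + p / 4) + (\<Sum>b\<in>S - {a}. \<phi> x1)"
      using near x0 aG x S by (intro add_mono sum_mono x1) (auto simp: m_assoc)
    also have "(\<Sum>b\<in>S - {a}. \<phi> x1) = (k - 1) * \<phi> x1"
      using a S unfolding k_def by (simp add: card_Diff_singleton card_gt_0_iff of_nat_diff Suc_leI)
    finally have "(\<Sum>c\<leftarrow>cs. \<phi> (c \<otimes> x)) / k \<le> ((k - 1) * \<phi> x1 + (\<phi> x0 + p / 4)) / k"
      using k by (intro divide_right_mono) auto
    then show ?thesis
      unfolding left_average_def lcs by (simp add: inverse_eq_divide)
  qed
  have lower: "\<phi> x0 \<le> left_average cs \<phi> x" if "x \<in> carrier G" for x
    by (rule left_average_ge[OF cs that x0(2)])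
  define q where "q = ((k - 1) * \<phi> x1 + (\<phi> x0 + p / 4)) / k - \<phi> x0"
  have "left_average (compose_list cs as) f x - left_average (compose_list cs as) f y \<le> q"
    if "x \<in> carrier G" "y \<in> carrier G" for x y
    using upper[OF that(1)] lower[OF that(2)] that
    unfolding q_def \<phi>_def by (simp add: left_average_compose[OF cs as])
  then have "q \<in> D" unfolding D_def using group_list_compose[OF cs as] by blast
  then have "p \<le> q" unfolding p_def by (rule cInf_lower[OF _ bdd])
  \<comment> \<open>The new oscillation is lower than the old one by at least
    \<open>3 * (p / 4 / k)\<close>, while the old one exceeded \<open>p\<close> by less than
    \<open>p / 4 / k\<close>.\<close>
  moreover have "q = (\<phi> x1 - \<phi> x0) - ((\<phi> x1 - \<phi> x0) - p / 4) / k"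
    unfolding q_def using k by (simp add: field_simps)
  moreover have "((\<phi> x1 - \<phi> x0) - p / 4) / k \<ge> (3 * p / 4) / k"
    using p_le k by (intro divide_right_mono) auto
  moreover have "(3 * p / 4) / k = 3 * (p / 4 / k)" by simp
  moreover have "p / 4 / k > 0" using p0 k by simp
  ultimately show False using le_d \<open>d < p + p / 4 / k\<close> by linarith
qed

text \<open>A constant in the uniform closure of the convex hull of the left translates of
  \<open>f\<close>: the characterization of the Haar integral that involves no measure.\<close>

definition is_mean :: "('a \<Rightarrow> 'c::real_normed_vector) \<Rightarrow> 'c \<Rightarrow> bool" where
  "is_mean f c \<longleftrightarrow> (\<forall>e>0. \<exists>as. group_list as \<and> (\<forall>x\<in>carrier G. norm (left_average as f x - c) \<le> e))"

text \<open>Left averages of \<open>f\<close> commute with left averages of \<open>x \<mapsto> f (inv x)\<close>, which are right averages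
  of \<open>f\<close>; this is what makes the mean unique.\<close>

lemma left_average_swap:
  assumes as: "group_list as" and bs: "group_list bs"
  shows "left_average bs (\<lambda>y. left_average as f (inv y)) \<one> =
    left_average as (\<lambda>y. left_average bs (\<lambda>z. f (inv z)) (inv y)) \<one>"
proof -
  have eq: "f (a \<otimes> inv b) = f (inv (b \<otimes> inv a))" if "a \<in> carrier G" "b \<in> carrier G" for a b
    using that by (simp add: inv_mult_group)
  have scale: "(\<Sum>b\<leftarrow>xs. (g b :: 'c::real_normed_vector) /\<^sub>R r) = (\<Sum>b\<leftarrow>xs. g b) /\<^sub>R r" for xs :: "'a list"
    and g r
    by (induction xs) (auto simp: scaleR_add_right)
  have swap: "(\<Sum>b\<leftarrow>bs. \<Sum>a\<leftarrow>as. f (a \<otimes> inv (b \<otimes> \<one>))) = (\<Sum>a\<leftarrow>as. \<Sum>b\<leftarrow>bs. f (inv (b \<otimes> inv (a \<otimes> \<one>))))"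
    if "set as \<subseteq> carrier G" "set bs \<subseteq> carrier G"
    using that
  proof (induction as)
    case (Cons a as)
    have "map (\<lambda>b. f (a \<otimes> inv (b \<otimes> \<one>))) bs = map (\<lambda>b. f (inv (b \<otimes> inv (a \<otimes> \<one>)))) bs"
      using Cons eq by auto
    then have "(\<Sum>b\<leftarrow>bs. f (a \<otimes> inv (b \<otimes> \<one>))) = (\<Sum>b\<leftarrow>bs. f (inv (b \<otimes> inv (a \<otimes> \<one>))))"
      by presburger
    then show ?case using Cons by (simp add: sum_list_addf)
  qed simp
  have "set as \<subseteq> carrier G" "set bs \<subseteq> carrier G" using as bs unfolding group_list_def by auto
  from swap[OF this] show ?thesis
    unfolding left_average_def scale by (simp add: mult.commute)
qed

text \<open>Both numbers are compared with one double average: averaging \<open>f\<close> on the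
  left brings it near \<open>c\<close>, averaging on the right brings it near \<open>c'\<close>, and
  the order is immaterial. This compares a left mean with a right mean; two left means agree as soon
  as some right mean is known to exist.\<close>

lemma is_mean_unique_inverse:
  assumes f: "is_mean f c" and f': "is_mean (\<lambda>x. f (inv x)) c'"
  shows "c = c'"
proof (rule ccontr)
  assume "c \<noteq> c'"
  define e where "e = norm (c - c') / 3"
  have e: "e > 0" using \<open>c \<noteq> c'\<close> unfolding e_def by simp
  obtain as where as: "group_list as" "\<And>x. x \<in> carrier G \<Longrightarrow> norm (left_average as f x - c) \<le> e"
    using f e unfolding is_mean_def by blast
  obtain bs where bs: "group_list bs"
    "\<And>x. x \<in> carrier G \<Longrightarrow> norm (left_average bs (\<lambda>x. f (inv x)) x - c') \<le> e"
    using f' e unfolding is_mean_def by blast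
  let ?D = "left_average bs (\<lambda>y. left_average as f (inv y)) \<one>"
  have "norm (?D - c) \<le> e"
    by (rule norm_left_average_diff_le[OF bs(1) one_closed as(2)]) simp
  moreover have "norm (?D - c') \<le> e"
    unfolding left_average_swap[OF as(1) bs(1)]
    by (rule norm_left_average_diff_le[OF as(1) one_closed bs(2)]) simp
  ultimately have "norm (c - c') \<le> e + e"
    using norm_triangle_le_diff[of "?D - c'" "?D - c" "e + e"] by (simp add: algebra_simps)
  then show False using e unfolding e_def by simp
qed

text \<open>The mean is the infimum of all upper bounds of averages. An average of small oscillation
  exceeds no such bound by much: any two averages are comparable through their double averages with
  one list \<open>bs\<close>, all of which lie within \<open>e\<close> of a single value.\<close>

lemma ex_is_mean_real:
  fixes f :: "'a \<Rightarrow> real"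
  assumes f: "continuous_map T euclidean f"
  shows "\<exists>c. is_mean f c"
proof -
  define U where "U = {u. \<exists>as. group_list as \<and> (\<forall>x\<in>carrier G. left_average as f x \<le> u)}"
  have finv: "continuous_map T euclidean (\<lambda>x. f (inv x))"
    using continuous_map_compose[OF continuous_inv f] by (simp add: o_def)
  have key: "\<exists>as. group_list as \<and> (\<forall>x\<in>carrier G. \<forall>u\<in>U. left_average as f x \<le> u + 3 * e)
      \<and> (\<forall>x\<in>carrier G. left_average as f x + e \<in> U)" if e: "e > 0" for e
  proof -
    obtain as where as: "group_list as"
      "\<And>x y. x \<in> carrier G \<Longrightarrow> y \<in> carrier G \<Longrightarrow> left_average as f x - left_average as f y \<le> e"
      using ex_left_average_oscillation_less[OF f e] by blast
    obtain bs where bs: "group_list bs"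
      "\<And>x y. x \<in> carrier G \<Longrightarrow> y \<in> carrier G \<Longrightarrow>
        left_average bs (\<lambda>x. f (inv x)) x - left_average bs (\<lambda>x. f (inv x)) y \<le> e"
      using ex_left_average_oscillation_less[OF finv e] by blast
    let ?r = "left_average bs (\<lambda>x. f (inv x))"
    let ?D = "\<lambda>cs. left_average bs (\<lambda>y. left_average cs f (inv y)) \<one>"
    have D: "\<bar>?D cs - ?r \<one>\<bar> \<le> e" if cs: "group_list cs" for cs
    proof -
      have "\<bar>?r y - ?r \<one>\<bar> \<le> e" if "y \<in> carrier G" for y
        using bs(2)[OF that one_closed] bs(2)[OF one_closed that] by linarith
      then show ?thesis
        unfolding left_average_swap[OF cs bs(1)] real_norm_def[symmetric]
        by (intro norm_left_average_diff_le[OF cs one_closed]) simp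
    qed
    \<comment> \<open>One \<open>e\<close> pays for replacing \<open>left_average as f x\<close> by
      the double average \<open>?D as\<close>, and one each for comparing \<open>?D as\<close> and
      \<open>?D cs\<close> with \<open>?r \<one>\<close>.\<close>
    have "left_average as f x \<le> u + 3 * e" if x: "x \<in> carrier G" and u: "u \<in> U" for x u
    proof -
      obtain cs where cs: "group_list cs" "\<And>x. x \<in> carrier G \<Longrightarrow> left_average cs f x \<le> u"
        using u unfolding U_def by blast
      have "?D cs \<le> u" by (rule left_average_le[OF bs(1) one_closed]) (simp add: cs)
      moreover have "left_average as f x - e \<le> ?D as"
      proof (rule left_average_ge[OF bs(1) one_closed])
        fix y assume "y \<in> carrier G"
        then show "left_average as f x - e \<le> left_average as f (inv y)"
          using as(2)[OF x, of "inv y"] by simp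
      qed
      ultimately show ?thesis using D[OF cs(1)] D[OF as(1)] by linarith
    qed
    moreover have "left_average as f x + e \<in> U" if "x \<in> carrier G" for x
      unfolding U_def using as that by (force simp: algebra_simps)
    ultimately show ?thesis using as(1) by blast
  qed
  have ne: "U \<noteq> {}" using key[of 1] one_closed by fastforce
  have bdd: "bdd_below U"
  proof -
    obtain as where as: "\<forall>x\<in>carrier G. \<forall>u\<in>U. left_average as f x \<le> u + 3 * 1"
      using key[of 1] by auto
    then have "left_average as f \<one> - 3 \<le> u" if "u \<in> U" for u using that one_closed by fastforce
    then show ?thesis by (rule bdd_belowI)
  qed
  have "is_mean f (Inf U)"
    unfolding is_mean_def
  proof (intro allI impI)
    fix e :: real assume e: "e > 0"
    obtain as where as: "group_list as" "\<And>x u. x \<in> carrier G \<Longrightarrow> u \<in> U \<Longrightarrow> left_average as f x \<le> u + 3 * (e / 3)"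
      "\<And>x. x \<in> carrier G \<Longrightarrow> left_average as f x + e / 3 \<in> U"
      using key[of "e/3"] e by auto
    have "norm (left_average as f x - Inf U) \<le> e" if x: "x \<in> carrier G" for x
    proof -
      have "left_average as f x - e \<le> Inf U"
        by (rule cInf_greatest[OF ne]) (use as(2)[OF x] in force)
      moreover have "Inf U \<le> left_average as f x + e / 3"
        by (rule cInf_lower[OF as(3)[OF x] bdd])
      ultimately show ?thesis using e by auto
    qed
    then show "\<exists>as. group_list as \<and> (\<forall>x\<in>carrier G. norm (left_average as f x - Inf U) \<le> e)"
      using as(1) by blast
  qed
  then show ?thesis by blast
qed

lemma is_mean_left_average:
  assumes as: "group_list as" and m: "is_mean (left_average as f) c"
  shows "is_mean f c"
  unfolding is_mean_def
proof (intro allI impI)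
  fix e :: real assume "e > 0"
  then obtain bs where bs: "group_list bs"
    "\<forall>x\<in>carrier G. norm (left_average bs (left_average as f) x - c) \<le> e"
    using m unfolding is_mean_def by blast
  then show "\<exists>as. group_list as \<and> (\<forall>x\<in>carrier G. norm (left_average as f x - c) \<le> e)"
    using left_average_compose[OF bs(1) as] group_list_compose[OF bs(1) as] by metis
qed

lemma left_average_Re_Im:
  "Re (left_average as f x) = left_average as (\<lambda>x. Re (f x)) x"
  "Im (left_average as f x) = left_average as (\<lambda>x. Im (f x)) x"
proof -
  have "Re (\<Sum>a\<leftarrow>as. f (a \<otimes> x)) = (\<Sum>a\<leftarrow>as. Re (f (a \<otimes> x)))"
       "Im (\<Sum>a\<leftarrow>as. f (a \<otimes> x)) = (\<Sum>a\<leftarrow>as. Im (f (a \<otimes> x)))"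
    by (induction as) auto
  then show "Re (left_average as f x) = left_average as (\<lambda>x. Re (f x)) x"
    "Im (left_average as f x) = left_average as (\<lambda>x. Im (f x)) x"
    unfolding left_average_def by auto
qed

text \<open>A single list has to serve the real and the imaginary part. The imaginary part is
  therefore averaged after the list for the real part has been applied; uniqueness, through the
  right mean \<open>b'\<close>, shows that its mean is still \<open>b\<close>, and the second
  averaging does not spoil the first estimate.\<close>

lemma ex_is_mean:
  fixes f :: "'a \<Rightarrow> complex"
  assumes f: "continuous_map T euclidean f"
  shows "\<exists>c. is_mean f c"
proof -
  have "continuous_map euclidean euclidean Re" "continuous_map euclidean euclidean Im"
    by (simp_all add: continuous_on_Re continuous_on_Im continuous_on_id)
  from this[THEN continuous_map_compose[OF f]]
  have cR: "continuous_map T euclidean (\<lambda>x. Re (f x))" and cI: "continuous_map T euclidean (\<lambda>x. Im (f x))"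
    by (simp_all add: o_def)
  obtain a where a: "is_mean (\<lambda>x. Re (f x)) a" using ex_is_mean_real[OF cR] by blast
  obtain b where b: "is_mean (\<lambda>x. Im (f x)) b" using ex_is_mean_real[OF cI] by blast
  obtain b' where b': "is_mean (\<lambda>x. Im (f (inv x))) b'"
    using ex_is_mean_real[OF continuous_map_compose[OF continuous_inv cI]] by (auto simp: o_def)
  have "is_mean f (Complex a b)"
    unfolding is_mean_def
  proof (intro allI impI)
    fix e :: real assume e: "e > 0"
    obtain as where as: "group_list as"
      "\<And>x. x \<in> carrier G \<Longrightarrow> norm (left_average as (\<lambda>x. Re (f x)) x - a) \<le> e / 2"
      using a e unfolding is_mean_def by (metis half_gt_zero)
    have cIa: "continuous_map T euclidean (left_average as (\<lambda>x. Im (f x)))"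
      by (rule left_average_continuous[OF cI as(1)])
    obtain c where c: "is_mean (left_average as (\<lambda>x. Im (f x))) c" using ex_is_mean_real[OF cIa] by blast
    have "is_mean (\<lambda>x. Im (f x)) c" by (rule is_mean_left_average[OF as(1) c])
    from is_mean_unique_inverse[OF this b'] is_mean_unique_inverse[OF b b'] have "c = b" by simp
    with c obtain bs where bs: "group_list bs"
      "\<And>x. x \<in> carrier G \<Longrightarrow> norm (left_average bs (left_average as (\<lambda>x. Im (f x))) x - b) \<le> e / 2"
      using e unfolding is_mean_def by (metis half_gt_zero)
    have "norm (left_average (compose_list bs as) f x - Complex a b) \<le> e" if x: "x \<in> carrier G" for x
    proof -
      have "norm (left_average bs (left_average as (\<lambda>x. Re (f x))) x - a) \<le> e / 2"
        by (rule norm_left_average_diff_le[OF bs(1) x as(2)])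
      then have "\<bar>Re (left_average (compose_list bs as) f x - Complex a b)\<bar> \<le> e / 2"
        by (simp add: left_average_Re_Im left_average_compose[OF bs(1) as(1) x])
      moreover have "\<bar>Im (left_average (compose_list bs as) f x - Complex a b)\<bar> \<le> e / 2"
        using bs(2)[OF x] by (simp add: left_average_Re_Im left_average_compose[OF bs(1) as(1) x])
      ultimately show ?thesis
        using cmod_le[of "left_average (compose_list bs as) f x - Complex a b"] by linarith
    qed
    then show "\<exists>as. group_list as \<and> (\<forall>x\<in>carrier G. norm (left_average as f x - Complex a b) \<le> e)"
      using group_list_compose[OF bs(1) as(1)] by blast
  qed
  then show ?thesis by blast
qed

end

lemma continuous_map_euclidean_tendsto:
  "continuous_map X euclidean f \<longleftrightarrow> (\<forall>x\<in>topspace X. (f \<longlongrightarrow> f x) (atin X x))"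
  by (simp add: continuous_map_atin)

lemma continuous_map_mult_algebra:
  fixes f g :: "'x \<Rightarrow> 'c::real_normed_algebra"
  assumes "continuous_map X euclidean f" "continuous_map X euclidean g"
  shows "continuous_map X euclidean (\<lambda>x. f x * g x)"
  using assms unfolding continuous_map_euclidean_tendsto by (auto intro: tendsto_mult)

lemma continuous_map_euclidean_compose:
  assumes "continuous_map X euclidean f" "continuous_on UNIV g"
  shows "continuous_map X euclidean (\<lambda>x. g (f x))"
  using continuous_map_compose[of X euclidean f euclidean g] assms by (simp add: o_def)

lemma continuous_map_cnj:
  "continuous_map X euclidean f \<Longrightarrow> continuous_map X euclidean (\<lambda>x. cnj (f x))"
  by (erule continuous_map_euclidean_compose) (intro continuous_intros)

lemma continuous_map_of_real:
  "continuous_map X euclidean f \<Longrightarrow> continuous_map X euclidean (\<lambda>x. complex_of_real (f x))"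
  by (erule continuous_map_euclidean_compose) (intro continuous_intros)

lemma continuous_map_cmult:
  fixes f :: "'x \<Rightarrow> complex"
  shows "continuous_map X euclidean f \<Longrightarrow> continuous_map X euclidean (\<lambda>x. c * f x)"
  by (intro continuous_map_mult_algebra) auto

section \<open>The mean as a positive invariant linear functional\<close>

context compact_group
begin

abbreviation cont :: "('a \<Rightarrow> complex) \<Rightarrow> bool" where
  "cont f \<equiv> continuous_map T euclidean f"

definition mean :: "('a \<Rightarrow> complex) \<Rightarrow> complex" where
  "mean f = (THE c. is_mean f c)"

lemma cont_inv: "cont f \<Longrightarrow> cont (\<lambda>x. f (inv x))"
  using continuous_map_compose[OF continuous_inv, of euclidean f] by (simp add: o_def)

lemma mean_unique:
  assumes "cont f" "is_mean f c"
  shows "mean f = c"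
proof -
  obtain c' where "is_mean (\<lambda>x. f (inv x)) c'" using ex_is_mean[OF cont_inv[OF assms(1)]] by blast
  then have "c = d" if "is_mean f d" for d
    using is_mean_unique_inverse assms(2) that by metis
  then show ?thesis unfolding mean_def using assms(2) by (metis the_equality)
qed

lemma is_mean_mean: "cont f \<Longrightarrow> is_mean f (mean f)"
  using ex_is_mean mean_unique by metis

lemma mean_left_average:
  assumes "cont f" "group_list as"
  shows "mean (left_average as f) = mean f"
  using mean_unique[OF assms(1) is_mean_left_average[OF assms(2) is_mean_mean[OF left_average_continuous[OF
    assms]]]]
  by simp

text \<open>The list is built one function after another: a further left average of a function
  already within \<open>e\<close> of a constant stays within \<open>e\<close> of it.\<close>

lemma simultaneous_left_average:
  assumes "finite I" "\<And>i. i \<in> I \<Longrightarrow> cont (F i)" and e: "e > 0"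
  shows "\<exists>as. group_list as \<and> (\<forall>i\<in>I. \<forall>x\<in>carrier G. norm (left_average as (F i) x - mean (F i)) \<le> e)"
  using assms(1,2)
proof (induction I)
  case empty
  then show ?case by (auto simp: group_list_def intro!: exI[of _ "[\<one>]"])
next
  case (insert j I)
  then obtain as where as: "group_list as"
    "\<And>i x. i \<in> I \<Longrightarrow> x \<in> carrier G \<Longrightarrow> norm (left_average as (F i) x - mean (F i)) \<le> e" by auto
  have j: "cont (F j)" using insert by simp
  have "is_mean (left_average as (F j)) (mean (F j))"
    using is_mean_mean[OF left_average_continuous[OF j as(1)]] mean_left_average[OF j as(1)] by simp
  then obtain bs where bs: "group_list bs"
    "\<And>x. x \<in> carrier G \<Longrightarrow> norm (left_average bs (left_average as (F j)) x - mean (F j)) \<le> e"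
    using e unfolding is_mean_def by blast
  have "norm (left_average (compose_list bs as) (F i) x - mean (F i)) \<le> e"
    if i: "i \<in> insert j I" and x: "x \<in> carrier G" for i x
  proof (cases "i = j")
    case True
    then show ?thesis using bs(2)[OF x] by (simp add: left_average_compose[OF bs(1) as(1) x])
  next
    case False
    then have "norm (left_average bs (left_average as (F i)) x - mean (F i)) \<le> e"
      using i by (intro norm_left_average_diff_le[OF bs(1) x as(2)]) auto
    then show ?thesis by (simp add: left_average_compose[OF bs(1) as(1) x])
  qed
  then show ?case using group_list_compose[OF bs(1) as(1)] by blast
qed

lemma mean_cong:
  assumes "cont f" "\<And>x. x \<in> carrier G \<Longrightarrow> f x = g x"
  shows "mean g = mean f"
proof -
  have g: "cont g" using continuous_map_eq[OF assms(1)] assms(2) by (simp add: topspace_eq_carrier)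
  have "is_mean f c \<longleftrightarrow> is_mean g c" for c
    unfolding is_mean_def using left_average_cong assms(2) by (metis (no_types, lifting))
  then show ?thesis using mean_unique[OF g] is_mean_mean[OF assms(1)] by blast
qed

lemma mean_translate:
  assumes "cont f" "a \<in> carrier G"
  shows "mean (\<lambda>x. f (a \<otimes> x)) = mean f"
proof -
  have "left_average [a] f = (\<lambda>x. f (a \<otimes> x))" unfolding left_average_def by auto
  then show ?thesis using mean_left_average[OF assms(1), of "[a]"] assms(2) by (simp add: group_list_def)
qed

lemma mean_close:
  assumes f: "cont f" and B: "\<And>x. x \<in> carrier G \<Longrightarrow> norm (f x - c) \<le> B"
  shows "norm (mean f - c) \<le> B"
proof (rule field_le_epsilon)
  fix e :: real assume "e > 0"
  then obtain as where as: "group_list as" "\<And>x. x \<in> carrier G \<Longrightarrow> norm (left_average as f x - mean f) \<le> e"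
    using is_mean_mean[OF f] unfolding is_mean_def by blast
  have "norm (left_average as f \<one> - c) \<le> B"
    by (rule norm_left_average_diff_le[OF as(1) one_closed B])
  with as(2)[OF one_closed] show "norm (mean f - c) \<le> B + e"
    using norm_triangle_le_diff[of "left_average as f \<one> - c" "left_average as f \<one> - mean f" "B + e"] by simp
qed

lemma mean_const: "mean (\<lambda>x. c) = c"
  using mean_close[of "\<lambda>x. c" c 0] by simp

lemma mean_add:
  assumes f: "cont f" and g: "cont g"
  shows "mean (\<lambda>x. f x + g x) = mean f + mean g"
proof (rule mean_unique)
  show "cont (\<lambda>x. f x + g x)" using f g by (rule continuous_map_add)
  show "is_mean (\<lambda>x. f x + g x) (mean f + mean g)"
    unfolding is_mean_def
  proof (intro allI impI)
    fix e :: real assume "e > 0"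
    then have e2: "e / 2 > 0" by simp
    have fg: "cont (if i then f else g)" for i using f g by simp
    have "\<exists>as. group_list as \<and> (\<forall>i\<in>{True, False}. \<forall>x\<in>carrier G.
         norm (left_average as (if i then f else g) x - mean (if i then f else g)) \<le> e / 2)"
      by (rule simultaneous_left_average[OF _ fg e2]) simp
    then obtain as where as: "group_list as" "\<forall>i\<in>{True, False}. \<forall>x\<in>carrier G.
         norm (left_average as (if i then f else g) x - mean (if i then f else g)) \<le> e / 2"
      by (elim exE conjE)
    have "norm (left_average as (\<lambda>x. f x + g x) x - (mean f + mean g)) \<le> e" if x: "x \<in> carrier G" for x
    proof -
      have "norm ((left_average as f x - mean f) + (left_average as g x - mean g)) \<le> e / 2 + e / 2"
        using as(2) x by (intro norm_triangle_mono) auto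
      then show ?thesis by (simp add: left_average_linear algebra_simps)
    qed
    then show "\<exists>as. group_list as
      \<and> (\<forall>x\<in>carrier G. norm (left_average as (\<lambda>x. f x + g x) x - (mean f + mean g)) \<le> e)"
      using as(1) by blast
  qed
qed

text \<open>Treats scalar multiplication and conjugation together: a Lipschitz map of values that
  commutes with averages carries good approximations of the mean to good approximations.\<close>

lemma mean_transform:
  assumes f: "cont f" and h: "cont (\<lambda>x. h (f x))"
    and avg: "\<And>as x. left_average as (\<lambda>x. h (f x)) x = h (left_average as f x)"
    and lip: "\<And>z w. norm (h z - h w) \<le> C * norm (z - w)" and C: "C > 0"
  shows "mean (\<lambda>x. h (f x)) = h (mean f)"
proof (rule mean_unique[OF h])
  show "is_mean (\<lambda>x. h (f x)) (h (mean f))"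
    unfolding is_mean_def
  proof (intro allI impI)
    fix e :: real assume "e > 0"
    then have "e / C > 0" using C by simp
    then obtain as where as: "group_list as" "\<And>x. x \<in> carrier G \<Longrightarrow> norm (left_average as f x - mean f) \<le> e / C"
      using is_mean_mean[OF f] unfolding is_mean_def by blast
    have "norm (left_average as (\<lambda>x. h (f x)) x - h (mean f)) \<le> e" if "x \<in> carrier G" for x
    proof -
      have "norm (left_average as (\<lambda>x. h (f x)) x - h (mean f)) \<le> C * norm (left_average as f x - mean f)"
        unfolding avg by (rule lip)
      also have "\<dots> \<le> C * (e / C)" using as(2)[OF that] C by (intro mult_left_mono) auto
      finally show ?thesis using C by simp
    qed
    then show "\<exists>as. group_list as \<and> (\<forall>x\<in>carrier G. norm (left_average as (\<lambda>x. h (f x)) x - h (mean f)) \<le> e)"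
      using as(1) by blast
  qed
qed

lemma mean_cmult:
  assumes f: "cont f"
  shows "mean (\<lambda>x. c * f x) = c * mean f"
proof (rule mean_transform[OF f continuous_map_cmult[OF f]])
  show "left_average as (\<lambda>x. c * f x) x = c * left_average as f x" for as x
    unfolding left_average_def by (simp add: sum_list_const_mult)
  show "norm (c * z - c * w) \<le> (norm c + 1) * norm (z - w)" for z w
  proof -
    have "norm (c * z - c * w) = norm c * norm (z - w)"
      unfolding right_diff_distrib[symmetric] by (rule norm_mult)
    then show ?thesis by (simp add: algebra_simps)
  qed
  show "norm c + 1 > 0" by (simp add: add_nonneg_pos)
qed

lemma mean_cnj:
  assumes f: "cont f"
  shows "mean (\<lambda>x. cnj (f x)) = cnj (mean f)"
proof (rule mean_transform[OF f continuous_map_cnj[OF f], of 1])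
  fix as x
  have "cnj (\<Sum>a\<leftarrow>as. f (a \<otimes> x)) = (\<Sum>a\<leftarrow>as. cnj (f (a \<otimes> x)))"
    by (induction as) auto
  then show "left_average as (\<lambda>x. cnj (f x)) x = cnj (left_average as f x)"
    unfolding left_average_def by simp
next
  show "norm (cnj z - cnj w) \<le> 1 * norm (z - w)" for z w
    by (metis complex_cnj_diff complex_mod_cnj mult_1 order_refl)
qed auto

lemma mean_diff:
  assumes f: "cont f" and g: "cont g"
  shows "mean (\<lambda>x. f x - g x) = mean f - mean g"
  using mean_add[OF f continuous_map_cmult[OF g, of "-1"]] mean_cmult[OF g, of "-1"] by simp

lemma mean_sum:
  assumes "finite I" "\<And>i. i \<in> I \<Longrightarrow> cont (F i)"
  shows "mean (\<lambda>x. \<Sum>i\<in>I. F i x) = (\<Sum>i\<in>I. mean (F i))"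
  using assms by (induction I) (auto simp: mean_const mean_add continuous_map_sum)

lemma Re_mean_ge:
  assumes f: "cont f" and b: "\<And>x. x \<in> carrier G \<Longrightarrow> b \<le> Re (f x)"
  shows "b \<le> Re (mean f)"
proof (rule field_le_epsilon)
  fix e :: real assume "e > 0"
  then obtain as where as: "group_list as" "\<And>x. x \<in> carrier G \<Longrightarrow> norm (left_average as f x - mean f) \<le> e"
    using is_mean_mean[OF f] unfolding is_mean_def by blast
  have "b \<le> Re (left_average as f \<one>)"
    unfolding left_average_Re_Im by (rule left_average_ge[OF as(1) one_closed b])
  moreover have "\<bar>Re (left_average as f \<one> - mean f)\<bar> \<le> e"
    using as(2)[OF one_closed] abs_Re_le_cmod order_trans by blast
  ultimately show "b \<le> Re (mean f) + e" by simp
qed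

lemma Re_mean_mono:
  assumes f: "cont f" and g: "cont g" and le: "\<And>x. x \<in> carrier G \<Longrightarrow> Re (f x) \<le> Re (g x)"
  shows "Re (mean f) \<le> Re (mean g)"
  using Re_mean_ge[OF continuous_map_diff[OF g f], of 0] le by (simp add: mean_diff[OF g f])

text \<open>The set where the real part exceeds \<open>d\<close> is open, so finitely many of its
  translates cover the group. The sum of the corresponding translates of \<open>f\<close> has real
  part at least \<open>d\<close> everywhere, and its mean is a multiple of the mean of
  \<open>f\<close>. This strictness is what makes \<open>ip\<close> definite on continuous
  functions.\<close>

lemma mean_pos:
  assumes f: "cont f" and nn: "\<And>x. x \<in> carrier G \<Longrightarrow> 0 \<le> Re (f x)"
    and x0: "x0 \<in> carrier G" "0 < Re (f x0)"
  shows "0 < Re (mean f)"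
proof -
  define d where "d = Re (f x0) / 2"
  have d: "d > 0" using x0 unfolding d_def by simp
  have cR: "continuous_map T euclideanreal (\<lambda>x. Re (f x))"
    by (rule continuous_map_euclidean_compose[OF f]) (intro continuous_intros)
  define U where "U = {x \<in> topspace T. Re (f x) \<in> {d<..}}"
  have "openin T U" unfolding U_def by (rule openin_continuous_map_preimage[OF cR]) auto
  moreover have "x0 \<in> U" unfolding U_def d_def using x0 by (simp add: topspace_eq_carrier)
  ultimately obtain S where S: "finite S" "S \<noteq> {}" "S \<subseteq> carrier G"
    "\<And>x. x \<in> carrier G \<Longrightarrow> \<exists>a\<in>S. a \<otimes> x \<in> U"
    using finite_translates_cover[of U x0] by metis
  have ct: "cont (\<lambda>x. f (a \<otimes> x))" if "a \<in> S" for a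
    using that S by (intro continuous_map_translate(1)[OF f]) auto
  have "mean (\<lambda>x. \<Sum>a\<in>S. f (a \<otimes> x)) = (\<Sum>a\<in>S. mean (\<lambda>x. f (a \<otimes> x)))"
    by (rule mean_sum[OF S(1) ct])
  also have "\<dots> = (\<Sum>a\<in>S. mean f)"
    using S(3) by (intro sum.cong refl mean_translate[OF f]) auto
  finally have eq: "Re (mean (\<lambda>x. \<Sum>a\<in>S. f (a \<otimes> x))) = real (card S) * Re (mean f)" by simp
  have "d \<le> Re (mean (\<lambda>x. \<Sum>a\<in>S. f (a \<otimes> x)))"
  proof (rule Re_mean_ge)
    show "cont (\<lambda>x. \<Sum>a\<in>S. f (a \<otimes> x))" by (intro continuous_map_sum S ct)
    fix x assume x: "x \<in> carrier G"
    then obtain a where a: "a \<in> S" "a \<otimes> x \<in> U" using S(4) by blast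
    have "d \<le> Re (f (a \<otimes> x))" using a unfolding U_def by simp
    also have "\<dots> \<le> (\<Sum>a\<in>S. Re (f (a \<otimes> x)))"
      using a S x by (intro member_le_sum nn) auto
    finally show "d \<le> Re (\<Sum>a\<in>S. f (a \<otimes> x))" by simp
  qed
  then have "0 < real (card S) * Re (mean f)" using d eq by linarith
  then show ?thesis by (simp add: zero_less_mult_iff)
qed

text \<open>Compactness reduces Fubini to finitely many slices: every slice \<open>k x\<close> is
  uniformly close to some \<open>k s\<close>, and one list averages all these \<open>k s\<close> to
  near their means. The same list therefore averages every slice, and applying the mean over
  \<open>x\<close> transfers the estimate to the slices in the other variable.\<close>

lemma mean_swap:
  assumes k: "continuous_map (prod_topology T T) euclidean (\<lambda>(x, y). k x y)"
  shows "cont (\<lambda>x. mean (k x))" "mean (\<lambda>x. mean (k x)) = mean (\<lambda>y. mean (\<lambda>x. k x y))"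
proof -
  have slice1: "cont (k x)" if "x \<in> carrier G" for x
  proof -
    have "continuous_map T (prod_topology T T) (\<lambda>y. (x, y))"
      using that by (auto simp: continuous_map_pairwise o_def topspace_eq_carrier)
    from continuous_map_compose[OF this k] show ?thesis by (simp add: o_def)
  qed
  have slice2: "cont (\<lambda>x. k x y)" if "y \<in> carrier G" for y
  proof -
    have "continuous_map T (prod_topology T T) (\<lambda>x. (x, y))"
      using that by (auto simp: continuous_map_pairwise o_def topspace_eq_carrier)
    from continuous_map_compose[OF this k] show ?thesis by (simp add: o_def)
  qed
  have near: "norm (mean (k x) - mean (k x0)) \<le> e"
    if "x \<in> carrier G" "x0 \<in> carrier G" "\<And>y. y \<in> carrier G \<Longrightarrow> norm (k x y - k x0 y) < e" for x x0 e
    using mean_close[OF continuous_map_diff[OF slice1[OF that(1)] slice1[OF that(2)]], of 0 e] that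
    by (simp add: mean_diff slice1 less_imp_le)
  have contm: "continuous_map T euclidean (\<lambda>x. mean (\<lambda>y. k' x y))"
    if slice: "\<And>x. x \<in> carrier G \<Longrightarrow> cont (k' x)"
      and k': "continuous_map (prod_topology T T) euclidean (\<lambda>(x, y). k' x y)" for k'
    unfolding continuous_map_euclidean_tendsto
  proof (intro ballI tendstoI)
    fix x0 and e :: real assume x0: "x0 \<in> topspace T" and e: "e > 0"
    obtain U where U: "openin T U" "x0 \<in> U"
      "\<And>x y. x \<in> U \<Longrightarrow> y \<in> topspace T \<Longrightarrow> norm (k' x y - k' x0 y) < e / 2"
      using equicontinuous_slices[OF k' compact x0, of "e / 2"] e by auto
    have "dist (mean (k' x)) (mean (k' x0)) < e" if "x \<in> U" for x
    proof -
      have x: "x \<in> carrier G" using that U(1) openin_subset topspace_eq_carrier by blast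
      have x0': "x0 \<in> carrier G" using x0 topspace_eq_carrier by simp
      have "norm (mean (k' x) - mean (k' x0)) \<le> e / 2"
        using mean_close[OF continuous_map_diff[OF slice[OF x] slice[OF x0']], of 0 "e/2"] U(3)[OF that]
        by (simp add: mean_diff slice x x0' less_imp_le topspace_eq_carrier)
      then show ?thesis using e by (simp add: dist_norm)
    qed
    then show "\<forall>\<^sub>F x in atin T x0. dist (mean (k' x)) (mean (k' x0)) < e"
      using U(1,2) unfolding eventually_atin by blast
  qed
  show c1: "cont (\<lambda>x. mean (k x))" by (rule contm[OF slice1 k])
  have kswap: "continuous_map (prod_topology T T) euclidean (\<lambda>(x, y). k y x)"
  proof -
    have "continuous_map (prod_topology T T) (prod_topology T T) (\<lambda>p. (snd p, fst p))"
      by (simp add: continuous_map_pairwise o_def continuous_map_fst continuous_map_snd)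
    from continuous_map_compose[OF this k] show ?thesis by (simp add: o_def case_prod_unfold)
  qed
  have c2: "cont (\<lambda>y. mean (\<lambda>x. k x y))" by (rule contm[OF slice2 kswap])
  show "mean (\<lambda>x. mean (k x)) = mean (\<lambda>y. mean (\<lambda>x. k x y))"
  proof (rule ccontr)
    assume "mean (\<lambda>x. mean (k x)) \<noteq> mean (\<lambda>y. mean (\<lambda>x. k x y))"
    then have "norm (mean (\<lambda>y. mean (\<lambda>x. k x y)) - mean (\<lambda>x. mean (k x))) > 0" (is "?n > 0") by simp
    \<comment> \<open>A quarter of the gap, because the estimate \<open>close\<close> loses
      \<open>3 * e\<close>.\<close>
    define e where "e = ?n / 4"
    have e: "e > 0" using \<open>?n > 0\<close> unfolding e_def by simp
    have "\<forall>x0\<in>topspace T. \<exists>U. openin T U \<and> x0 \<in> U \<and> (\<forall>x\<in>U. \<forall>y\<in>topspace T. norm (k x y - k x0 y) < e)"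
      using equicontinuous_slices[OF k compact _ e] by metis
    then obtain U where U: "\<And>x0. x0 \<in> topspace T \<Longrightarrow> openin T (U x0)" "\<And>x0. x0 \<in> topspace T \<Longrightarrow> x0 \<in> U x0"
      "\<And>x0 x y. x0 \<in> topspace T \<Longrightarrow> x \<in> U x0 \<Longrightarrow> y \<in> topspace T \<Longrightarrow> norm (k x y - k x0 y) < e"
      by metis
    have "\<exists>\<F>. finite \<F> \<and> \<F> \<subseteq> U ` topspace T \<and> topspace T \<subseteq> \<Union>\<F>"
      using compact[unfolded compact_space_def] by (rule compactinD) (use U in auto)
    then obtain \<F> where F: "finite \<F>" "\<F> \<subseteq> U ` topspace T" "topspace T \<subseteq> \<Union>\<F>" by (elim exE conjE)
    from finite_subset_image[OF F(1,2)] obtain S where S: "S \<subseteq> topspace T" "finite S" "\<F> = U ` S"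
      by (elim exE conjE)
    have kS: "cont (k s)" if "s \<in> S" for s
      using that S(1) by (intro slice1) (auto simp: topspace_eq_carrier)
    have "\<exists>as. group_list as \<and> (\<forall>s\<in>S. \<forall>y\<in>carrier G. norm (left_average as (k s) y - mean (k s)) \<le> e)"
      by (rule simultaneous_left_average[OF S(2) kS e])
    then obtain as where as: "group_list as"
      and as': "\<forall>s\<in>S. \<forall>y\<in>carrier G. norm (left_average as (k s) y - mean (k s)) \<le> e"
      by (elim exE conjE)
    note as = as as'[rule_format]
    have close: "norm (left_average as (k x) y - mean (k x)) \<le> 3 * e"
      if x: "x \<in> carrier G" and y: "y \<in> carrier G" for x y
    proof -
      obtain s where s: "s \<in> S" "x \<in> U s" using F(3) S(3) x topspace_eq_carrier by auto
      have sG: "s \<in> carrier G" using s S topspace_eq_carrier by auto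
      have lt: "norm (k x z - k s z) < e" if "z \<in> carrier G" for z
        using U(3)[of s x z] s sG that topspace_eq_carrier by simp
      have 1: "norm (left_average as (\<lambda>z. k x z - k s z) y - 0) \<le> e"
        using lt by (intro norm_left_average_diff_le[OF as(1) y]) (simp add: less_imp_le)
      have 2: "norm (mean (k x) - mean (k s)) \<le> e" by (rule near[OF x sG lt])
      have "left_average as (k x) y - mean (k x) = left_average as (\<lambda>z. k x z - k s z) y +
         ((left_average as (k s) y - mean (k s)) - (mean (k x) - mean (k s)))"
        by (simp add: left_average_linear)
      also have "norm \<dots> \<le> e + (e + e)"
        using 1 2 as(2)[OF s(1) y] by (intro norm_triangle_mono norm_triangle_le_diff) auto
      finally show ?thesis by simp
    qed
    have "norm (left_average as (\<lambda>z. mean (\<lambda>x. k x z)) y - mean (\<lambda>x. mean (k x))) \<le> 3 * e"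
      if y: "y \<in> carrier G" for y
    proof -
      have ay: "a \<otimes> y \<in> carrier G" if "a \<in> set as" for a using that as(1) y unfolding group_list_def by auto
      have cl: "cont (\<lambda>x. left_average as (k x) y)"
      proof -
        have "cont (\<lambda>x. \<Sum>a\<leftarrow>as'. k x (a \<otimes> y))" if "set as' \<subseteq> set as" for as'
          using that ay slice2 by (induction as') (auto intro!: continuous_map_add)
        from continuous_map_cmult[OF this[of as]]
        have "cont (\<lambda>x. of_real (inverse (real (length as))) * (\<Sum>a\<leftarrow>as. k x (a \<otimes> y)))" by blast
        then show ?thesis unfolding left_average_def by (simp add: scaleR_conv_of_real)
      qed
      have "mean (\<lambda>x. left_average as (k x) y) = left_average as (\<lambda>z. mean (\<lambda>x. k x z)) y"
      proof -
        have s: "cont (\<lambda>x. \<Sum>a\<leftarrow>as'. k x (a \<otimes> y)) \<and>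
          mean (\<lambda>x. \<Sum>a\<leftarrow>as'. k x (a \<otimes> y)) = (\<Sum>a\<leftarrow>as'. mean (\<lambda>x. k x (a \<otimes> y)))" if "set as' \<subseteq> set as" for as'
          using that
          by (induction as') (auto simp: mean_const mean_add ay slice2 intro!: continuous_map_add)
        show ?thesis
          unfolding left_average_def scaleR_conv_of_real
          using s[of as] by (simp add: mean_cmult)
      qed
      moreover have "norm (mean (\<lambda>x. left_average as (k x) y - mean (k x)) - 0) \<le> 3 * e"
        by (rule mean_close[OF continuous_map_diff[OF cl c1]]) (simp add: close y)
      ultimately show ?thesis by (simp add: mean_diff[OF cl c1])
    qed
    then have "norm (mean (left_average as (\<lambda>z. mean (\<lambda>x. k x z))) - mean (\<lambda>x. mean (k x))) \<le> 3 * e"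
      by (rule mean_close[OF left_average_continuous[OF c2 as(1)]])
    then have "?n \<le> 3 * e" unfolding mean_left_average[OF c2 as(1)] .
    then show False using e unfolding e_def by simp
  qed
qed

end

section \<open>Convolution operators and their eigenspaces\<close>

lemma finite_pointwise_convergent_subseq:
  fixes h :: "nat \<Rightarrow> 's \<Rightarrow> complex"
  assumes "finite S" "\<And>x k. x \<in> S \<Longrightarrow> norm (h k x) \<le> B"
  shows "\<exists>r. strict_mono (r :: nat \<Rightarrow> nat) \<and> (\<forall>x\<in>S. convergent (\<lambda>k. h (r k) x))"
  using assms
proof (induction S)
  case empty
  then show ?case by (auto intro: exI[of _ id] simp: strict_mono_def)
next
  case (insert a S)
  then obtain r where r: "strict_mono r" "\<forall>x\<in>S. convergent (\<lambda>k. h (r k) x)" by auto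
  have "bounded (range (\<lambda>k. h (r k) a))"
    using insert.prems by (auto simp: bounded_iff)
  then obtain l r' where r': "strict_mono r'" "((\<lambda>k. h (r k) a) \<circ> r') \<longlonglongrightarrow> l"
    using bounded_imp_convergent_subsequence by blast
  have "convergent (\<lambda>k. h ((r \<circ> r') k) x)" if "x \<in> insert a S" for x
  proof (cases "x = a")
    case True
    then show ?thesis using r'(2) by (auto simp: convergent_def o_def)
  next
    case False
    then have "convergent (\<lambda>k. h (r k) x)" using r(2) that by auto
    from convergent_subseq_convergent[OF this r'(1)] show ?thesis by (simp add: o_def)
  qed
  then show ?case using strict_mono_o[OF r(1) r'(1)] by blast
qed

context compact_group
begin

text \<open>Arzela-Ascoli. The group may fail to be separable, so the diagonal runs over the scales
  \<open>inverse (real (Suc n))\<close> and not over a dense sequence: at each scale equicontinuity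
  and compactness give a finite net, and a subsequence converging on the net is almost constant at
  that scale.\<close>

lemma equicontinuous_uniform_subseq:
  fixes g :: "nat \<Rightarrow> 'a \<Rightarrow> complex"
  assumes bd: "\<And>k x. x \<in> carrier G \<Longrightarrow> norm (g k x) \<le> B"
    and eq: "\<And>x0 e. x0 \<in> carrier G \<Longrightarrow> e > 0 \<Longrightarrow>
      \<exists>U. openin T U \<and> x0 \<in> U \<and> (\<forall>x\<in>U. \<forall>k. norm (g k x - g k x0) \<le> e)"
  obtains r :: "nat \<Rightarrow> nat" and w where "strict_mono r" "cont w"
    "\<And>e. e > 0 \<Longrightarrow> \<exists>N. \<forall>k\<ge>N. \<forall>x\<in>carrier G. norm (g (r k) x - w x) < e"
proof -
  \<comment> \<open>Stated for all pairs of terms, so that the property survives passing to a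
    subsequence, as the diagonal construction requires.\<close>
  define P where "P n s \<longleftrightarrow>
    (\<forall>i j. \<forall>x\<in>carrier G. norm (g (s i) x - g (s j) x) < inverse (real (Suc n)))" for n and s :: "nat \<Rightarrow> nat"
  interpret subseqs P
  proof
    fix n and s :: "nat \<Rightarrow> nat" assume s: "strict_mono s"
    define e where "e = inverse (real (Suc n)) / 5"
    have e: "e > 0" unfolding e_def by simp
    obtain U where U: "\<And>x0. x0 \<in> carrier G \<Longrightarrow> openin T (U x0)" "\<And>x0. x0 \<in> carrier G \<Longrightarrow> x0 \<in> U x0"
      "\<And>x0 x k. x0 \<in> carrier G \<Longrightarrow> x \<in> U x0 \<Longrightarrow> norm (g k x - g k x0) \<le> e"
      using eq[OF _ e] by metis
    have "\<exists>\<F>. finite \<F> \<and> \<F> \<subseteq> U ` carrier G \<and> carrier G \<subseteq> \<Union>\<F>"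
      using compact[unfolded compact_space_def topspace_eq_carrier] by (rule compactinD) (use U in auto)
    then obtain \<F> where F: "finite \<F>" "\<F> \<subseteq> U ` carrier G" "carrier G \<subseteq> \<Union>\<F>" by (elim exE conjE)
    from finite_subset_image[OF F(1,2)] obtain S where S: "S \<subseteq> carrier G" "finite S" "\<F> = U ` S"
      by (elim exE conjE)
    have "norm (g (s k) x) \<le> B" if "x \<in> S" for k x using bd S that by blast
    from finite_pointwise_convergent_subseq[OF S(2), of "\<lambda>k. g (s k)", OF this]
    obtain r where r: "strict_mono r" "\<forall>x\<in>S. convergent (\<lambda>k. g (s (r k)) x)" by blast
    have "\<forall>x\<in>S. \<exists>N. \<forall>i\<ge>N. \<forall>j\<ge>N. dist (g (s (r i)) x) (g (s (r j)) x) < e"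
      using r(2) e unfolding Cauchy_convergent_iff[symmetric] Cauchy_def by blast
    then obtain N where N: "\<And>x i j. x \<in> S \<Longrightarrow> i \<ge> N x \<Longrightarrow> j \<ge> N x \<Longrightarrow> dist (g (s (r i)) x) (g (s (r j)) x) < e"
      by metis
    define M where "M = (\<Sum>x\<in>S. N x)"
    have M: "N x \<le> M" if "x \<in> S" for x unfolding M_def by (rule member_le_sum[OF that _ S(2)]) simp
    have "norm (g (s (r (i + M))) x - g (s (r (j + M))) x) < inverse (real (Suc n))"
      if x: "x \<in> carrier G" for i j x
    proof -
      obtain c where c: "c \<in> S" "x \<in> U c" using F(3) S(3) x by auto
      have cG: "c \<in> carrier G" using c S by blast
      have 1: "norm (g k x - g k c) \<le> e" for k using U(3)[OF cG c(2)] .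
      have 2: "norm (g (s (r (i + M))) c - g (s (r (j + M))) c) < e"
        using N[OF c(1), of "i + M" "j + M"] M[OF c(1)] by (simp add: dist_norm)
      have "g (s (r (i + M))) x - g (s (r (j + M))) x =
         (g (s (r (i + M))) x - g (s (r (i + M))) c) + ((g (s (r (i + M))) c - g (s (r (j + M))) c)
          - (g (s (r (j + M))) x - g (s (r (j + M))) c))" by simp
      also have "norm \<dots> \<le> e + (e + e)"
        by (rule norm_triangle_mono[OF 1 order_trans[OF norm_triangle_ineq4 add_mono[OF less_imp_le[OF 2]
          1]]])
      finally show ?thesis using e unfolding e_def by linarith
    qed
    then have "P n (s \<circ> (\<lambda>i. r (i + M)))" unfolding P_def by simp
    moreover have "strict_mono (\<lambda>i. r (i + M))" using r(1) unfolding strict_mono_def by simp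
    ultimately show "\<exists>r'. strict_mono r' \<and> P n (s \<circ> r')" by blast
  qed
  have "P k (diagseq \<circ> ((+) (Suc k)))" for k
    by (rule diagseq_holds) (auto simp: P_def)
  then have diag: "norm (g (diagseq (Suc n + i)) x - g (diagseq (Suc n + j)) x) < inverse (real (Suc n))"
    if "x \<in> carrier G" for n i j x
    using that unfolding P_def by auto
  have cauchy: "\<exists>N. \<forall>i\<ge>N. \<forall>j\<ge>N. \<forall>x\<in>carrier G. norm (g (diagseq i) x - g (diagseq j) x) < e" if e: "e > 0"
    for e
  proof -
    obtain n where n: "inverse (real (Suc n)) < e" using reals_Archimedean[OF e] by blast
    have "norm (g (diagseq i) x - g (diagseq j) x) < e"
      if "i \<ge> Suc n" "j \<ge> Suc n" "x \<in> carrier G" for i j x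
      using diag[OF that(3), of n "i - Suc n" "j - Suc n"] that n by simp
    then show ?thesis by blast
  qed
  define w where "w x = lim (\<lambda>k. g (diagseq k) x)" for x
  have lim: "(\<lambda>k. g (diagseq k) x) \<longlonglongrightarrow> w x" if "x \<in> carrier G" for x
  proof -
    have "Cauchy (\<lambda>k. g (diagseq k) x)"
      unfolding Cauchy_def dist_norm using cauchy that by meson
    then show ?thesis unfolding w_def Cauchy_convergent_iff by (simp add: convergent_LIMSEQ_iff)
  qed
  have unif: "\<exists>N. \<forall>k\<ge>N. \<forall>x\<in>carrier G. norm (g (diagseq k) x - w x) < e" if e: "e > 0" for e
  proof -
    obtain N where N: "\<And>i j x. i \<ge> N \<Longrightarrow> j \<ge> N \<Longrightarrow> x \<in> carrier G
      \<Longrightarrow> norm (g (diagseq i) x - g (diagseq j) x) < e / 2"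
      using cauchy[of "e/2"] e by auto
    have "norm (g (diagseq k) x - w x) \<le> e / 2" if "k \<ge> N" "x \<in> carrier G" for k x
    proof (rule LIMSEQ_le_const2)
      show "(\<lambda>j. norm (g (diagseq k) x - g (diagseq j) x)) \<longlonglongrightarrow> norm (g (diagseq k) x - w x)"
        by (intro tendsto_intros lim that)
      show "\<exists>M. \<forall>j\<ge>M. norm (g (diagseq k) x - g (diagseq j) x) \<le> e / 2"
        using N[OF that(1) _ that(2)] by (meson less_imp_le)
    qed
    then show ?thesis using e by (intro exI[of _ N]) force
  qed
  have "cont w"
    unfolding continuous_map_euclidean_tendsto topspace_eq_carrier
  proof (intro ballI tendstoI)
    fix x0 and e :: real assume x0: "x0 \<in> carrier G" and e: "e > 0"
    obtain U where U: "openin T U" "x0 \<in> U" "\<And>x k. x \<in> U \<Longrightarrow> norm (g k x - g k x0) \<le> e / 2"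
      using eq[OF x0, of "e/2"] e by auto
    have "dist (w x) (w x0) < e" if x: "x \<in> U" for x
    proof -
      have xG: "x \<in> carrier G" using x U(1) openin_subset topspace_eq_carrier by auto
      have "norm (w x - w x0) \<le> e / 2"
      proof (rule LIMSEQ_le_const2)
        show "(\<lambda>j. norm (g (diagseq j) x - g (diagseq j) x0)) \<longlonglongrightarrow> norm (w x - w x0)"
          by (intro tendsto_intros lim xG x0)
      qed (use U(3)[OF x] in auto)
      then show ?thesis using e by (simp add: dist_norm)
    qed
    then show "\<forall>\<^sub>F x in atin T x0. dist (w x) (w x0) < e"
      using U(1,2) unfolding eventually_atin by blast
  qed
  then show thesis using subseq_diagseq unif by (intro that[of diagseq w])
qed

section \<open>The inner product given by the mean\<close>

definition ip :: "('a \<Rightarrow> complex) \<Rightarrow> ('a \<Rightarrow> complex) \<Rightarrow> complex" where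
  "ip u v = mean (\<lambda>x. u x * cnj (v x))"

definition nrm2 :: "('a \<Rightarrow> complex) \<Rightarrow> real" where
  "nrm2 u = Re (ip u u)"

lemma cont_ip: "cont u \<Longrightarrow> cont v \<Longrightarrow> cont (\<lambda>x. u x * cnj (v x))"
  by (intro continuous_map_mult_algebra continuous_map_cnj)

lemma ip_cong:
  assumes "cont u" "cont v" "\<And>x. x \<in> carrier G \<Longrightarrow> u x = u' x" "\<And>x. x \<in> carrier G \<Longrightarrow> v x = v' x"
  shows "ip u' v' = ip u v"
  unfolding ip_def by (rule mean_cong[OF cont_ip[OF assms(1,2)]]) (simp add: assms)

lemma ip_add_left: "cont u \<Longrightarrow> cont v \<Longrightarrow> cont w \<Longrightarrow> ip (\<lambda>x. u x + v x) w = ip u w + ip v w"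
  unfolding ip_def by (simp add: distrib_right mean_add cont_ip)

lemma ip_cmult_left: "cont u \<Longrightarrow> cont w \<Longrightarrow> ip (\<lambda>x. c * u x) w = c * ip u w"
  unfolding ip_def by (simp add: mult.assoc mean_cmult cont_ip)

lemma ip_cnj: "cont u \<Longrightarrow> cont v \<Longrightarrow> cnj (ip u v) = ip v u"
  unfolding ip_def mean_cnj[OF cont_ip, symmetric] by (simp add: mult.commute)

lemma ip_diff_left: "cont u \<Longrightarrow> cont v \<Longrightarrow> cont w \<Longrightarrow> ip (\<lambda>x. u x - v x) w = ip u w - ip v w"
  unfolding ip_def by (simp add: left_diff_distrib mean_diff cont_ip)

lemma ip_sum_left:
  assumes "finite I" "\<And>i. i \<in> I \<Longrightarrow> cont (u i)" "cont w"
  shows "ip (\<lambda>x. \<Sum>i\<in>I. c i * u i x) w = (\<Sum>i\<in>I. c i * ip (u i) w)"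
  unfolding ip_def using assms
  by (simp add: sum_distrib_right mult.assoc mean_sum mean_cmult cont_ip continuous_map_cmult)

lemma ip_diff_right: "cont u \<Longrightarrow> cont v \<Longrightarrow> cont w \<Longrightarrow> ip w (\<lambda>x. u x - v x) = ip w u - ip w v"
  by (subst (1 2 3) ip_cnj[symmetric]) (auto simp: ip_diff_left intro: continuous_map_diff)

lemma ip_cmult_right: "cont u \<Longrightarrow> cont w \<Longrightarrow> ip w (\<lambda>x. c * u x) = cnj c * ip w u"
  by (subst (1 2) ip_cnj[symmetric]) (auto simp: ip_cmult_left intro: continuous_map_cmult)

lemma ip_sum_right:
  assumes "finite I" "\<And>i. i \<in> I \<Longrightarrow> cont (u i)" "cont w"
  shows "ip w (\<lambda>x. \<Sum>i\<in>I. c i * u i x) = (\<Sum>i\<in>I. cnj (c i) * ip w (u i))"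
proof -
  have c: "cont (\<lambda>x. \<Sum>i\<in>I. c i * u i x)"
    by (intro continuous_map_sum continuous_map_cmult assms)
  have "ip w (\<lambda>x. \<Sum>i\<in>I. c i * u i x) = cnj (\<Sum>i\<in>I. c i * ip (u i) w)"
    using ip_cnj[OF c assms(3)] ip_sum_left[OF assms] by simp
  then show ?thesis using assms by (simp add: ip_cnj)
qed

lemma ip_translate:
  assumes "cont u" "cont v" "h \<in> carrier G"
  shows "ip (\<lambda>x. u (h \<otimes> x)) (\<lambda>x. v (h \<otimes> x)) = ip u v"
  unfolding ip_def by (rule mean_translate[OF cont_ip[OF assms(1,2)] assms(3)])

lemma nrm2_nonneg: "cont u \<Longrightarrow> nrm2 u \<ge> 0"
  unfolding nrm2_def ip_def by (rule Re_mean_ge[OF cont_ip]) (auto simp: complex_mult_cnj)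

lemma ip_self: "cont u \<Longrightarrow> ip u u = of_real (nrm2 u)"
  unfolding nrm2_def using ip_cnj[of u u] by (simp add: complex_eq_iff)

lemma nrm2_eq_0:
  assumes "cont u" "nrm2 u = 0" "x \<in> carrier G"
  shows "u x = 0"
proof (rule ccontr)
  assume "u x \<noteq> 0"
  then have "0 < Re (mean (\<lambda>x. u x * cnj (u x)))"
    by (intro mean_pos[OF cont_ip[OF assms(1,1)] _ assms(3)])
      (auto simp: complex_mult_cnj sum_power2_gt_zero_iff complex_eq_iff)
  then show False using assms(2) unfolding nrm2_def ip_def by simp
qed

lemma nrm2_cmult: "cont u \<Longrightarrow> nrm2 (\<lambda>x. c * u x) = (norm c)\<^sup>2 * nrm2 u"
proof -
  assume u: "cont u"
  have "ip (\<lambda>x. c * u x) (\<lambda>x. c * u x) = (c * cnj c) * ip u u"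
    by (simp add: ip_cmult_left ip_cmult_right continuous_map_cmult u)
  also have "c * cnj c = of_real ((norm c)\<^sup>2)" using complex_norm_square[of c] by simp
  finally show ?thesis unfolding nrm2_def by (simp add: ip_self[OF u] del: of_real_power)
qed

lemma nrm2_cong:
  assumes "cont u" "\<And>x. x \<in> carrier G \<Longrightarrow> u x = u' x"
  shows "nrm2 u' = nrm2 u"
  unfolding nrm2_def by (simp add: ip_cong[OF assms(1,1,2,2)])

lemma nrm2_diff:
  assumes u: "cont u" and v: "cont v"
  shows "nrm2 (\<lambda>x. u x - v x) = nrm2 u - 2 * Re (ip u v) + nrm2 v"
proof -
  have "Re (ip v u) = Re (ip u v)" using ip_cnj[OF u v] by (metis cnj.simps(1))
  then show ?thesis
    unfolding nrm2_def by (simp add: ip_diff_left ip_diff_right u v continuous_map_diff)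
qed

lemma nrm2_le:
  assumes u: "cont u" and B: "\<And>x. x \<in> carrier G \<Longrightarrow> norm (u x) \<le> B"
  shows "nrm2 u \<le> B\<^sup>2"
proof -
  have "norm (mean (\<lambda>x. u x * cnj (u x)) - 0) \<le> B\<^sup>2"
  proof (rule mean_close[OF cont_ip[OF u u]])
    fix x assume "x \<in> carrier G"
    then have "norm (u x) * norm (u x) \<le> B * B" using B[of x]
      by (intro mult_mono) (auto intro: order_trans[OF norm_ge_zero])
    then show "norm (u x * cnj (u x) - 0) \<le> B\<^sup>2" by (simp add: norm_mult power2_eq_square)
  qed
  then show ?thesis unfolding nrm2_def ip_def using complex_Re_le_cmod order_trans by fastforce
qed

lemma Cauchy_Schwarz:
  assumes u: "cont u" and v: "cont v"
  shows "norm (ip u v) \<le> sqrt (nrm2 u) * sqrt (nrm2 v)"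
proof (cases "nrm2 v = 0")
  case True
  have "ip u v = ip u (\<lambda>x. 0 * v x)"
    using nrm2_eq_0[OF v True] by (intro ip_cong u continuous_map_cmult v) auto
  also have "\<dots> = 0" by (subst ip_cmult_right[OF v u]) simp
  finally show ?thesis using True by simp
next
  case False
  then have pos: "nrm2 v > 0" using nrm2_nonneg[OF v] by simp
  define c where "c = ip u v / of_real (nrm2 v)"
  have "0 \<le> nrm2 (\<lambda>x. u x - c * v x)"
    by (intro nrm2_nonneg continuous_map_diff u continuous_map_cmult v)
  also have "\<dots> = nrm2 u - 2 * Re (cnj c * ip u v) + (norm c)\<^sup>2 * nrm2 v"
    by (simp add: nrm2_diff u v continuous_map_cmult ip_cmult_right nrm2_cmult)
  also have "cnj c * ip u v = of_real ((norm (ip u v))\<^sup>2 / nrm2 v)"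
    unfolding c_def by (simp add: complex_norm_square mult.commute del: of_real_power)
  also have "(norm c)\<^sup>2 * nrm2 v = (norm (ip u v))\<^sup>2 / nrm2 v"
    unfolding c_def using pos by (simp add: norm_divide power_divide power2_eq_square)
  finally have "(norm (ip u v))\<^sup>2 \<le> nrm2 u * nrm2 v"
    using pos by (simp add: field_simps)
  then have "norm (ip u v) \<le> sqrt (nrm2 u * nrm2 v)" by (rule real_le_rsqrt)
  then show ?thesis by (simp add: real_sqrt_mult)
qed

end

section \<open>Orthonormal systems in spaces of continuous functions\<close>

locale fun_subspace = compact_group +
  fixes E :: "('a \<Rightarrow> complex) set"
  assumes cont_E: "u \<in> E \<Longrightarrow> continuous_map T euclidean u"
    and zero_E: "(\<lambda>x. 0) \<in> E"
    and add_E: "u \<in> E \<Longrightarrow> v \<in> E \<Longrightarrow> (\<lambda>x. u x + v x) \<in> E"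
    and cmult_E: "u \<in> E \<Longrightarrow> (\<lambda>x. c * u x) \<in> E"
begin

lemma sum_E: "finite I \<Longrightarrow> (\<And>i. i \<in> I \<Longrightarrow> u i \<in> E) \<Longrightarrow> (\<lambda>x. \<Sum>i\<in>I. c i * u i x) \<in> E"
proof (induction I rule: finite_induct)
  case (insert i I)
  then have "(\<lambda>x. c i * u i x) \<in> E" "(\<lambda>x. \<Sum>i\<in>I. c i * u i x) \<in> E"
    by (auto intro: cmult_E)
  from add_E[OF this] show ?case using insert.hyps by simp
qed (simp add: zero_E)

lemma diff_E: "u \<in> E \<Longrightarrow> v \<in> E \<Longrightarrow> (\<lambda>x. u x - v x) \<in> E"
  using add_E[of u "\<lambda>x. -1 * v x"] cmult_E[of v "-1"] by simp

end

context compact_group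
begin

definition orthonormal :: "nat \<Rightarrow> (nat \<Rightarrow> 'a \<Rightarrow> complex) \<Rightarrow> bool" where
  "orthonormal d e \<longleftrightarrow> (\<forall>i<d. cont (e i)) \<and> (\<forall>i<d. \<forall>j<d. ip (e i) (e j) = (if i = j then 1 else 0))"

lemma orthonormal_ip_sum:
  assumes "orthonormal d e" "i < d"
  shows "ip (\<lambda>x. \<Sum>j<d. c j * e j x) (e i) = c i"
proof -
  have "ip (\<lambda>x. \<Sum>j<d. c j * e j x) (e i) = (\<Sum>j<d. c j * ip (e j) (e i))"
    by (rule ip_sum_left) (use assms in \<open>auto simp: orthonormal_def\<close>)
  also have "\<dots> = (\<Sum>j<d. if j = i then c j else 0)"
    using assms unfolding orthonormal_def by (intro sum.cong) auto
  finally show ?thesis using assms(2) by simp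
qed

lemma orthonormal_nrm2_sum:
  assumes "orthonormal d e"
  shows "nrm2 (\<lambda>x. \<Sum>j<d. c j * e j x) = (\<Sum>j<d. (norm (c j))\<^sup>2)"
proof -
  let ?w = "\<lambda>x. \<Sum>j<d. c j * e j x"
  have e: "cont (e j)" if "j < d" for j using assms that unfolding orthonormal_def by simp
  have w: "cont ?w" by (intro continuous_map_sum continuous_map_cmult e) auto
  have "ip ?w ?w = (\<Sum>j<d. cnj (c j) * ip ?w (e j))"
    by (rule ip_sum_right[OF _ e w]) auto
  also have "\<dots> = (\<Sum>j<d. of_real ((norm (c j))\<^sup>2))"
  proof (rule sum.cong[OF refl])
    fix j assume "j \<in> {..<d}"
    then show "cnj (c j) * ip ?w (e j) = of_real ((norm (c j))\<^sup>2)"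
      using complex_norm_square[of "c j"] by (simp add: orthonormal_ip_sum[OF assms] mult.commute)
  qed
  finally show ?thesis unfolding nrm2_def by (simp del: of_real_power)
qed

end

context fun_subspace
begin

text \<open>A nonzero remainder of \<open>w\<close> after orthogonal projection could be normalized
  and appended to \<open>e\<close>, giving an orthonormal system of size \<open>Suc d\<close> inside
  \<open>E\<close>. Definiteness of \<open>nrm2\<close> turns a nonzero value of the remainder into
  a nonzero norm.\<close>

lemma orthonormal_maximal_basis:
  assumes e: "orthonormal d e" "\<And>i. i < d \<Longrightarrow> e i \<in> E"
    and max: "\<And>e'. orthonormal (Suc d) e' \<Longrightarrow> \<exists>i<Suc d. e' i \<notin> E"
    and w: "w \<in> E" and x: "x \<in> carrier G"
  shows "w x = (\<Sum>i<d. ip w (e i) * e i x)"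
proof (rule ccontr)
  assume neq: "w x \<noteq> (\<Sum>i<d. ip w (e i) * e i x)"
  define p where "p = (\<lambda>x. \<Sum>i<d. ip w (e i) * e i x)"
  define r where "r = (\<lambda>x. w x - p x)"
  have pE: "p \<in> E" unfolding p_def by (rule sum_E) (use e in auto)
  have rE: "r \<in> E" unfolding r_def by (rule diff_E[OF w pE])
  note cw = cont_E[OF w] and cp = cont_E[OF pE] and cr = cont_E[OF rE]
  have ce: "cont (e i)" if "i < d" for i using cont_E e(2) that by blast
  have r_orth: "ip r (e i) = 0" if "i < d" for i
    unfolding r_def using orthonormal_ip_sum[OF e(1) that] that
    by (simp add: ip_diff_left cw cp ce) (simp add: p_def)
  have n: "nrm2 r > 0"
  proof -
    have "r x \<noteq> 0" using neq unfolding r_def p_def by simp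
    then have "nrm2 r \<noteq> 0" using nrm2_eq_0[OF cr _ x] by blast
    then show ?thesis using nrm2_nonneg[OF cr] by simp
  qed
  define c :: complex where "c = of_real (1 / sqrt (nrm2 r))"
  define f where "f = (\<lambda>x. c * r x)"
  have fE: "f \<in> E" unfolding f_def by (rule cmult_E[OF rE])
  have ff: "ip f f = 1"
  proof -
    have "(norm c)\<^sup>2 * nrm2 r = 1" unfolding c_def using n by (simp add: norm_divide power_divide)
    then show ?thesis unfolding ip_self[OF cont_E[OF fE]] by (simp add: f_def nrm2_cmult[OF cr])
  qed
  have fe: "ip f (e i) = 0" if "i < d" for i
    unfolding f_def using r_orth[OF that] by (simp add: ip_cmult_left cr ce that)
  have ef: "ip (e i) f = 0" if "i < d" for i
    using ip_cnj[OF cont_E[OF fE] ce[OF that]] fe[OF that] by simp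
  have "orthonormal (Suc d) (e(d := f))"
    using e ff fe ef cont_E[OF fE] ce unfolding orthonormal_def by (auto simp: less_Suc_eq)
  from max[OF this] show False using fE e(2) by (auto simp: less_Suc_eq)
qed

end

context compact_group
begin

text \<open>The kernel depends on \<open>inv x \<otimes> y\<close> only, so the operator commutes
  with left translations of \<open>u\<close>, and its eigenspaces are translation-invariant.\<close>

definition convolution :: "('a \<Rightarrow> complex) \<Rightarrow> ('a \<Rightarrow> complex) \<Rightarrow> 'a \<Rightarrow> complex" where
  "convolution F u x = mean (\<lambda>y. F (inv x \<otimes> y) * u y)"

lemma continuous_map_kernel:
  assumes F: "cont F"
  shows "continuous_map (prod_topology T T) euclidean (\<lambda>(x, y). F (inv x \<otimes> y))"
proof -
  have "continuous_map (prod_topology T T) T (\<lambda>p. inv (fst p) \<otimes> snd p)"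
    by (intro continuous_map_mult continuous_map_inverse continuous_map_fst continuous_map_snd)
  from continuous_map_compose[OF this F] show ?thesis by (simp add: o_def case_prod_unfold)
qed

lemma continuous_map_kernel_mult:
  assumes F: "cont F" and u: "cont u"
  shows "continuous_map (prod_topology T T) euclidean (\<lambda>(x, y). F (inv x \<otimes> y) * u y)"
    "cont v \<Longrightarrow> continuous_map (prod_topology T T) euclidean (\<lambda>(x, y). F (inv x \<otimes> y) * u y * v x)"
proof -
  have K: "continuous_map (prod_topology T T) euclidean (\<lambda>p. F (inv (fst p) \<otimes> snd p))"
    using continuous_map_kernel[OF F] by (simp add: case_prod_unfold)
  have U: "continuous_map (prod_topology T T) euclidean (\<lambda>p. u (snd p))"
    using continuous_map_compose[OF continuous_map_snd u] by (simp add: o_def)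
  show "continuous_map (prod_topology T T) euclidean (\<lambda>(x, y). F (inv x \<otimes> y) * u y)"
    unfolding case_prod_unfold by (rule continuous_map_mult_algebra[OF K U])
  show "continuous_map (prod_topology T T) euclidean (\<lambda>(x, y). F (inv x \<otimes> y) * u y * v x)" if "cont v"
  proof -
    have V: "continuous_map (prod_topology T T) euclidean (\<lambda>p. v (fst p))"
      using continuous_map_compose[OF continuous_map_fst that] by (simp add: o_def)
    show ?thesis
      unfolding case_prod_unfold by (intro continuous_map_mult_algebra K U V)
  qed
qed

end

locale hermitian_kernel = compact_group +
  fixes F :: "'a \<Rightarrow> complex"
  assumes cont_F: "continuous_map T euclidean F"
    and hermitian: "x \<in> carrier G \<Longrightarrow> F (inv x) = cnj (F x)"
begin

abbreviation C :: "('a \<Rightarrow> complex) \<Rightarrow> 'a \<Rightarrow> complex" where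
  "C \<equiv> convolution F"

lemma cont_slice: "x \<in> carrier G \<Longrightarrow> cont (\<lambda>y. F (inv x \<otimes> y))"
  by (rule continuous_map_translate(1)[OF cont_F]) auto

lemma cont_slice_mult: "x \<in> carrier G \<Longrightarrow> cont u \<Longrightarrow> cont (\<lambda>y. F (inv x \<otimes> y) * u y)"
  by (intro continuous_map_mult_algebra cont_slice)

lemma cont_C: "cont u \<Longrightarrow> cont (C u)"
  using mean_swap(1)[OF continuous_map_kernel_mult(1)[OF cont_F]]
  unfolding convolution_def[abs_def] by blast

lemma C_cong: "x \<in> carrier G \<Longrightarrow> cont u \<Longrightarrow> (\<And>y. y \<in> carrier G \<Longrightarrow> u y = v y) \<Longrightarrow> C v x = C u x"
  unfolding convolution_def by (rule mean_cong) (auto intro: cont_slice_mult)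

lemma C_add: "x \<in> carrier G \<Longrightarrow> cont u \<Longrightarrow> cont v \<Longrightarrow> C (\<lambda>y. u y + v y) x = C u x + C v x"
  unfolding convolution_def by (simp add: distrib_left mean_add cont_slice_mult)

lemma C_cmult: "x \<in> carrier G \<Longrightarrow> cont u \<Longrightarrow> C (\<lambda>y. c * u y) x = c * C u x"
  unfolding convolution_def by (simp add: mult.left_commute mean_cmult cont_slice_mult)

lemma C_diff: "x \<in> carrier G \<Longrightarrow> cont u \<Longrightarrow> cont v \<Longrightarrow> C (\<lambda>y. u y - v y) x = C u x - C v x"
  unfolding convolution_def by (simp add: right_diff_distrib mean_diff cont_slice_mult)

lemma C_translate:
  assumes x: "x \<in> carrier G" and h: "h \<in> carrier G" and u: "cont u"
  shows "C (\<lambda>y. u (h \<otimes> y)) x = C u (h \<otimes> x)"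
proof -
  have "mean (\<lambda>y. F (inv (h \<otimes> x) \<otimes> (h \<otimes> y)) * u (h \<otimes> y)) = C u (h \<otimes> x)"
    unfolding convolution_def using x h
    by (intro mean_translate[of "\<lambda>y. F (inv (h \<otimes> x) \<otimes> y) * u y"] cont_slice_mult u) auto
  moreover have "mean (\<lambda>y. F (inv x \<otimes> y) * u (h \<otimes> y)) = mean (\<lambda>y. F (inv (h \<otimes> x) \<otimes> (h \<otimes> y)) * u (h \<otimes> y))"
  proof (rule mean_cong)
    show "cont (\<lambda>y. F (inv (h \<otimes> x) \<otimes> (h \<otimes> y)) * u (h \<otimes> y))"
      by (rule continuous_map_translate(1)[OF cont_slice_mult[OF _ u]]) (use x h in auto)
    fix y assume y: "y \<in> carrier G"
    have "inv (h \<otimes> x) \<otimes> (h \<otimes> y) = inv x \<otimes> ((inv h \<otimes> h) \<otimes> y)"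
      using x h y by (simp only: inv_mult_group m_assoc inv_closed m_closed)
    then show "F (inv (h \<otimes> x) \<otimes> (h \<otimes> y)) * u (h \<otimes> y) = F (inv x \<otimes> y) * u (h \<otimes> y)"
      using h y by simp
  qed
  ultimately show ?thesis unfolding convolution_def by simp
qed

lemma C_self_adjoint:
  assumes u: "cont u" and v: "cont v"
  shows "ip (C u) v = ip u (C v)"
proof -
  let ?k = "\<lambda>x y. F (inv x \<otimes> y) * u y * cnj (v x)"
  have k: "continuous_map (prod_topology T T) euclidean (\<lambda>(x, y). ?k x y)"
    by (rule continuous_map_kernel_mult(2)[OF cont_F u continuous_map_cnj[OF v]])
  have "mean (\<lambda>x. mean (?k x)) = mean (\<lambda>y. mean (\<lambda>x. ?k x y))" by (rule mean_swap(2)[OF k])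
  moreover have "ip (C u) v = mean (\<lambda>x. mean (?k x))"
    unfolding ip_def
  proof (rule mean_cong[OF mean_swap(1)[OF k]])
    fix x assume x: "x \<in> carrier G"
    have "mean (\<lambda>y. cnj (v x) * (F (inv x \<otimes> y) * u y)) = cnj (v x) * C u x"
      unfolding convolution_def by (rule mean_cmult[OF cont_slice_mult[OF x u]])
    then show "mean (?k x) = C u x * cnj (v x)" by (simp add: mult.commute)
  qed
  moreover have "ip u (C v) = mean (\<lambda>y. mean (\<lambda>x. ?k x y))"
    unfolding ip_def
  proof (rule mean_cong[symmetric])
    show "cont (\<lambda>y. u y * cnj (C v y))" by (rule cont_ip[OF u cont_C[OF v]])
    fix y assume y: "y \<in> carrier G"
    have c1: "cont (\<lambda>x. F (inv y \<otimes> x) * v x)" by (rule cont_slice_mult[OF y v])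
    have c2: "cont (\<lambda>x. u y * cnj (F (inv y \<otimes> x) * v x))"
      by (rule continuous_map_cmult[OF continuous_map_cnj[OF c1]])
    have "mean (\<lambda>x. ?k x y) = mean (\<lambda>x. u y * cnj (F (inv y \<otimes> x) * v x))"
    proof (rule mean_cong[OF c2])
      fix x assume x: "x \<in> carrier G"
      have "inv x \<otimes> y = inv (inv y \<otimes> x)" using x y by (simp add: inv_mult_group)
      then have "F (inv x \<otimes> y) = cnj (F (inv y \<otimes> x))" using hermitian[of "inv y \<otimes> x"] x y by simp
      then show "u y * cnj (F (inv y \<otimes> x) * v x) = ?k x y" by simp
    qed
    also have "\<dots> = u y * cnj (C v y)"
      unfolding convolution_def by (simp only: mean_cmult[OF continuous_map_cnj[OF c1]] mean_cnj[OF c1])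
    finally show "u y * cnj (C v y) = mean (\<lambda>x. ?k x y)" by (rule sym)
  qed
  ultimately show ?thesis by simp
qed

lemma C_eq_ip: "C u x = ip u (\<lambda>y. cnj (F (inv x \<otimes> y)))"
  unfolding convolution_def ip_def by (simp add: mult.commute)

lemma ex_bound: obtains B where "B > 0" "\<And>x. x \<in> carrier G \<Longrightarrow> norm (F x) \<le> B"
  using bounded_continuous[OF cont_F] by blast

text \<open>Cauchy-Schwarz against a kernel slice. The operator turns bounds in mean square into
  uniform bounds; on eigenfunctions with nonzero eigenvalue this becomes the estimate that forces
  finite dimension.\<close>

lemma norm_C_le:
  assumes B: "\<And>x. x \<in> carrier G \<Longrightarrow> norm (F x) \<le> B" and x: "x \<in> carrier G" and u: "cont u"
  shows "norm (C u x) \<le> B * sqrt (nrm2 u)"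
proof -
  have c: "cont (\<lambda>y. cnj (F (inv x \<otimes> y)))" by (rule continuous_map_cnj[OF cont_slice[OF x]])
  have B0: "B \<ge> 0" using B[OF one_closed] norm_ge_zero order_trans by blast
  have "nrm2 (\<lambda>y. cnj (F (inv x \<otimes> y))) \<le> B\<^sup>2"
    by (rule nrm2_le[OF c]) (use B x in simp)
  then have "sqrt (nrm2 (\<lambda>y. cnj (F (inv x \<otimes> y)))) \<le> B"
    using B0 by (simp add: real_le_lsqrt nrm2_nonneg[OF c])
  then show ?thesis
    using Cauchy_Schwarz[OF u c] mult_left_mono[of _ B "sqrt (nrm2 u)"] nrm2_nonneg[OF u]
    unfolding C_eq_ip by (smt (verit) mult.commute real_sqrt_ge_zero)
qed

text \<open>By Cauchy-Schwarz the difference is controlled by the uniform distance of two kernel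
  slices, so a single neighbourhood works for the whole unit ball. This is the compactness of the
  operator.\<close>

lemma C_equicontinuous:
  assumes x0: "x0 \<in> carrier G" and e: "e > 0"
  shows "\<exists>U. openin T U \<and> x0 \<in> U \<and> (\<forall>x\<in>U. \<forall>u. cont u \<longrightarrow> nrm2 u \<le> 1 \<longrightarrow> norm (C u x - C u x0) \<le> e)"
proof -
  obtain U where U: "openin T U" "x0 \<in> U"
    "\<And>x y. x \<in> U \<Longrightarrow> y \<in> topspace T \<Longrightarrow> norm (F (inv x \<otimes> y) - F (inv x0 \<otimes> y)) < e"
    using equicontinuous_slices[OF continuous_map_kernel[OF cont_F] compact _ e, of x0] x0
    by (auto simp: topspace_eq_carrier)
  have "norm (C u x - C u x0) \<le> e" if x: "x \<in> U" and u: "cont u" "nrm2 u \<le> 1" for x u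
  proof -
    have xG: "x \<in> carrier G" using x U(1) openin_subset topspace_eq_carrier by auto
    let ?g = "\<lambda>y. cnj (F (inv x \<otimes> y)) - cnj (F (inv x0 \<otimes> y))"
    have c: "cont (\<lambda>y. cnj (F (inv x \<otimes> y)))" "cont (\<lambda>y. cnj (F (inv x0 \<otimes> y)))"
      by (intro continuous_map_cnj cont_slice xG x0)+
    then have cg: "cont ?g" by (rule continuous_map_diff)
    have "C u x - C u x0 = ip u ?g" unfolding C_eq_ip by (simp add: ip_diff_right c u)
    moreover have "nrm2 ?g \<le> e\<^sup>2"
    proof (rule nrm2_le[OF cg])
      fix y assume "y \<in> carrier G"
      then show "norm (?g y) \<le> e"
        using U(3)[OF x, of y] unfolding complex_cnj_diff[symmetric] complex_mod_cnj
        by (simp add: topspace_eq_carrier less_imp_le)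
    qed
    then have "sqrt (nrm2 ?g) \<le> e" using e by (simp add: real_le_lsqrt nrm2_nonneg[OF cg])
    then have "sqrt (nrm2 u) * sqrt (nrm2 ?g) \<le> 1 * e"
      using u nrm2_nonneg[OF u(1)] nrm2_nonneg[OF cg] by (intro mult_mono) auto
    ultimately show ?thesis using Cauchy_Schwarz[OF u(1) cg] by simp
  qed
  then show ?thesis using U(1,2) by blast
qed

end

section \<open>A compact self-adjoint operator on a subspace closed under uniform limits\<close>

locale kernel_subspace = hermitian_kernel G T F + fun_subspace G T E
  for G (structure) and T F E +
  assumes C_E: "u \<in> E \<Longrightarrow> convolution F u \<in> E"
    and limit_E: "(\<And>k. g k \<in> E) \<Longrightarrow> continuous_map T euclidean w \<Longrightarrow>
      (\<And>e. e > 0 \<Longrightarrow> \<exists>N. \<forall>k\<ge>N. \<forall>x\<in>carrier G. norm (g (k :: nat) x - w x) < e) \<Longrightarrow> w \<in> E"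
begin

text \<open>The restriction of the squared operator to \<open>E\<close> attains its norm: a maximizing sequence is an
  approximate eigenvector sequence, and its image under the operator is equicontinuous.\<close>

lemma ex_eigenvector:
  assumes u0: "u0 \<in> E" "x0 \<in> carrier G" "C u0 x0 \<noteq> 0"
  obtains S w where "S > 0" "w \<in> E" "\<exists>x\<in>carrier G. w x \<noteq> 0"
    "\<And>x. x \<in> carrier G \<Longrightarrow> C (C w) x = of_real S * w x"
proof -
  obtain B where B: "B > 0" "\<And>x. x \<in> carrier G \<Longrightarrow> norm (F x) \<le> B" using ex_bound by blast
  note cE = cont_E
  have cCE: "cont (C u)" if "u \<in> E" for u by (rule cE[OF C_E[OF that]])
  \<comment> \<open>\<open>S\<close> is the squared norm of the operator on \<open>E\<close>, the
    candidate for the largest eigenvalue of its square.\<close>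
  define R where "R = {nrm2 (C u) | u. u \<in> E \<and> nrm2 u \<le> 1}"
  define S where "S = Sup R"
  have bound1: "norm (C u x) \<le> B" if "cont u" "nrm2 u \<le> 1" "x \<in> carrier G" for u x
  proof -
    have "norm (C u x) \<le> B * sqrt (nrm2 u)" by (rule norm_C_le[OF B(2) that(3,1)])
    also have "\<dots> \<le> B * 1" using that B by (intro mult_left_mono) auto
    finally show ?thesis by simp
  qed
  have bdd: "bdd_above R"
  proof (rule bdd_aboveI)
    fix s assume "s \<in> R"
    then obtain u where u: "s = nrm2 (C u)" "u \<in> E" "nrm2 u \<le> 1" unfolding R_def by blast
    show "s \<le> B\<^sup>2" unfolding u(1) by (rule nrm2_le[OF cCE[OF u(2)] bound1[OF cE[OF u(2)] u(3)]])
  qed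
  have scale: "nrm2 (C (\<lambda>x. c * u x)) = (norm c)\<^sup>2 * nrm2 (C u)" if "u \<in> E" for c u
  proof -
    have "nrm2 (C (\<lambda>x. c * u x)) = nrm2 (\<lambda>x. c * C u x)"
      by (rule nrm2_cong) (auto simp: C_cmult cE that continuous_map_cmult cCE)
    then show ?thesis by (simp add: nrm2_cmult cCE that)
  qed
  have unit: "\<exists>c. c \<noteq> 0 \<and> nrm2 (\<lambda>x. c * u x) = 1 \<and> (norm c)\<^sup>2 = 1 / nrm2 u" if u: "u \<in> E" "nrm2 u > 0" for u
  proof (intro exI conjI)
    let ?c = "complex_of_real (1 / sqrt (nrm2 u))"
    show "?c \<noteq> 0" using u by simp
    show c: "(norm ?c)\<^sup>2 = 1 / nrm2 u" using u by (simp add: norm_divide power_divide)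
    show "nrm2 (\<lambda>x. ?c * u x) = 1" unfolding nrm2_cmult[OF cE[OF u(1)]] c using u(2) by simp
  qed
  have S_upper: "nrm2 (C u) \<le> S * nrm2 u" if u: "u \<in> E" for u
  proof (cases "nrm2 u = 0")
    case True
    have "norm (C u x) \<le> 0" if "x \<in> carrier G" for x
      using norm_C_le[OF B(2) that cE[OF u]] True by simp
    then have "nrm2 (C u) \<le> 0\<^sup>2" by (rule nrm2_le[OF cCE[OF u]])
    then show ?thesis using True by simp
  next
    case False
    then have pos: "nrm2 u > 0" using nrm2_nonneg[OF cE[OF u]] by simp
    then obtain c where c: "nrm2 (\<lambda>x. c * u x) = 1" "(norm c)\<^sup>2 = 1 / nrm2 u" using unit[OF u] by blast
    have "nrm2 (C (\<lambda>x. c * u x)) \<in> R" unfolding R_def using cmult_E[OF u] c(1) by fastforce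
    then have "nrm2 (C (\<lambda>x. c * u x)) \<le> S" unfolding S_def by (rule cSup_upper[OF _ bdd])
    then show ?thesis unfolding scale[OF u] c(2) using pos by (simp add: field_simps)
  qed
  have S: "S > 0"
  proof -
    have "nrm2 (C u0) \<noteq> 0" using nrm2_eq_0[OF cCE[OF u0(1)] _ u0(2)] u0(3) by blast
    then have p: "nrm2 (C u0) > 0" using nrm2_nonneg[OF cCE[OF u0(1)]] by simp
    show ?thesis
    proof (rule ccontr)
      assume "\<not> S > 0"
      then have "S * nrm2 u0 \<le> 0" using nrm2_nonneg[OF cE[OF u0(1)]] by (simp add: mult_nonpos_nonneg)
      then show False using S_upper[OF u0(1)] p by linarith
    qed
  qed
  have ne: "R \<noteq> {}" unfolding R_def using zero_E by (force simp: nrm2_def ip_def mean_const)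
  have "\<exists>v. v \<in> E \<and> nrm2 v \<le> 1 \<and> S - inverse (real (Suc k)) < nrm2 (C v)" for k
  proof -
    have "S - inverse (real (Suc k)) < Sup R" unfolding S_def by simp
    from less_cSupD[OF ne this] show ?thesis unfolding R_def by blast
  qed
  then obtain v where v: "\<And>k. v k \<in> E" "\<And>k. nrm2 (v k) \<le> 1"
    "\<And>k. S - inverse (real (Suc k)) < nrm2 (C (v k))" by metis
  obtain r :: "nat \<Rightarrow> nat" and w where r: "strict_mono r" and cw: "cont w"
    and unif: "\<And>e. e > 0 \<Longrightarrow> \<exists>N. \<forall>k\<ge>N. \<forall>x\<in>carrier G. norm (C (v (r k)) x - w x) < e"
  proof (rule equicontinuous_uniform_subseq[of "\<lambda>k. C (v k)" B])
    show "norm (C (v k) x) \<le> B" if "x \<in> carrier G" for k x by (rule bound1[OF cE[OF v(1)] v(2) that])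
    show "\<exists>U. openin T U \<and> x0 \<in> U \<and> (\<forall>x\<in>U. \<forall>k. norm (C (v k) x - C (v k) x0) \<le> e)"
      if "x0 \<in> carrier G" "e > 0" for x0 e
      using C_equicontinuous[OF that] cE[OF v(1)] v(2) by blast
  qed blast
  have wE: "w \<in> E" by (rule limit_E[of "\<lambda>k. C (v (r k))", OF C_E[OF v(1)] cw unif])
  have near: "\<exists>k. inverse (real (Suc (r k))) < e \<and> (\<forall>x\<in>carrier G. norm (C (v (r k)) x - w x) < e)" if e:
    "e > 0" for e
  proof -
    obtain N where N: "\<forall>k\<ge>N. \<forall>x\<in>carrier G. norm (C (v (r k)) x - w x) < e" using unif[OF e] by blast
    obtain n where n: "inverse (real (Suc n)) < e" using reals_Archimedean[OF e] by blast
    let ?k = "max N n"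
    have "n \<le> r ?k" using seq_suble[OF r, of ?k] by simp
    then have "inverse (real (Suc (r ?k))) \<le> inverse (real (Suc n))" by (intro le_imp_inverse_le) auto
    then have "inverse (real (Suc (r ?k))) < e" using n by (rule le_less_trans)
    then show ?thesis using N by (intro exI[of _ ?k]) auto
  qed
  have nz: "\<exists>x\<in>carrier G. w x \<noteq> 0"
  proof (rule ccontr)
    assume "\<not> ?thesis"
    then have w0: "w x = 0" if "x \<in> carrier G" for x using that by blast
    \<comment> \<open>If \<open>w\<close> vanished, \<open>nrm2 (C (v (r k)))\<close> would be at
      most \<open>e\<^sup>2\<close>, hence at most \<open>S / 2\<close>, for some large
      \<open>k\<close>; but it exceeds \<open>S - e\<close>, hence \<open>S / 2\<close>.\<close>
    define e where "e = min 1 (S / 2)"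
    have e: "e > 0" "e \<le> 1" "e \<le> S / 2" unfolding e_def using S by auto
    obtain k where k: "inverse (real (Suc (r k))) < e" "\<forall>x\<in>carrier G. norm (C (v (r k)) x - w x) < e"
      using near[OF e(1)] by blast
    have "nrm2 (C (v (r k))) \<le> e\<^sup>2"
      by (rule nrm2_le[OF cCE[OF v(1)]]) (use k(2) w0 in force)
    moreover have "e\<^sup>2 \<le> e" using e by (simp add: power2_eq_square mult_left_le)
    ultimately show False using v(3)[of "r k"] k(1) e(3) by linarith
  qed
  have eig: "C (C w) x = of_real S * w x" if x: "x \<in> carrier G" for x
  proof -
    let ?d = "norm (C (C w) x - of_real S * w x)"
    \<comment> \<open>The functions \<open>u\<close> need not converge, only \<open>C u\<close>
      does. Applying \<open>C\<close> once more to the approximate equation between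
      \<open>C (C u)\<close> and \<open>S * u\<close> expresses it through \<open>C u\<close>, which
      is close to \<open>w\<close>; every error term vanishes with \<open>e\<close>.\<close>
    have est: "?d \<le> B * (B * e) + B * sqrt (S * e) + S * e" if e: "e > 0" for e
    proof -
      obtain k where k: "inverse (real (Suc (r k))) < e" "\<forall>x\<in>carrier G. norm (C (v (r k)) x - w x) < e"
        using near[OF e] by blast
      define u where "u = v (r k)"
      have uE: "u \<in> E" and nu: "nrm2 u \<le> 1" unfolding u_def using v by auto
      note [simp] = cE[OF uE] cE[OF wE] cCE[OF uE] cCE[OF wE] cCE[OF C_E[OF uE]] cCE[OF C_E[OF wE]]
        cCE[OF C_E[OF C_E[OF uE]]]
      have n: "nrm2 (C u) \<ge> S - e" using v(3)[of "r k"] k(1) unfolding u_def by linarith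
      let ?f = "\<lambda>x. C (C u) x - of_real S * u x"
      have cf: "cont ?f" by (intro continuous_map_diff continuous_map_cmult) simp_all
      \<comment> \<open>Self-adjointness turns the cross term into \<open>nrm2 (C u)\<close>, and
        \<open>S_upper\<close> bounds \<open>nrm2 (C (C u))\<close> by
        \<open>S * nrm2 (C u)\<close>. What remains is \<open>S * (S - nrm2 (C u))\<close>, small
        because \<open>u\<close> almost attains the supremum.\<close>
      have "nrm2 ?f = nrm2 (C (C u)) - 2 * Re (ip (C (C u)) (\<lambda>x. of_real S * u x)) + S\<^sup>2 * nrm2 u"
        by (simp add: nrm2_diff continuous_map_cmult nrm2_cmult)
      also have "ip (C (C u)) (\<lambda>x. of_real S * u x) = of_real S * ip (C (C u)) u"
        by (simp add: ip_cmult_right)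
      also have "ip (C (C u)) u = ip (C u) (C u)" by (rule C_self_adjoint) simp_all
      also have "Re (of_real S * ip (C u) (C u)) = S * nrm2 (C u)" unfolding nrm2_def by simp
      finally have "nrm2 ?f \<le> S * nrm2 (C u) - 2 * (S * nrm2 (C u)) + S\<^sup>2 * 1"
        using S_upper[OF C_E[OF uE]] nu mult_left_mono[OF nu, of "S\<^sup>2"] by simp
      also have "\<dots> = S * (S - nrm2 (C u))" by (simp add: algebra_simps power2_eq_square)
      also have "\<dots> \<le> S * e" using n S by (intro mult_left_mono) auto
      finally have nf: "sqrt (nrm2 ?f) \<le> sqrt (S * e)" by simp
      have "norm (C ?f x) \<le> B * sqrt (nrm2 ?f)" by (rule norm_C_le[OF B(2) x cf])
      also have "\<dots> \<le> B * sqrt (S * e)" using nf B by (intro mult_left_mono) auto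
      finally have t2: "norm (C (C (C u)) x - of_real S * C u x) \<le> B * sqrt (S * e)"
        by (simp add: C_diff C_cmult x continuous_map_cmult)
      let ?g = "\<lambda>x. C u x - w x"
      have gE: "?g \<in> E" by (rule diff_E[OF C_E[OF uE] wE])
      have g: "norm (?g y) \<le> e" if "y \<in> carrier G" for y using k(2) that unfolding u_def
        by (simp add: less_imp_le)
      have "nrm2 ?g \<le> e\<^sup>2" by (rule nrm2_le[OF cE[OF gE] g])
      then have ng: "sqrt (nrm2 ?g) \<le> e" using e by (simp add: real_le_lsqrt nrm2_nonneg[OF cE[OF gE]])
      have "norm (C ?g y) \<le> B * e" if "y \<in> carrier G" for y
        using norm_C_le[OF B(2) that cE[OF gE]] mult_left_mono[OF ng, of B] B(1) by linarith
      then have "nrm2 (C ?g) \<le> (B * e)\<^sup>2" by (rule nrm2_le[OF cCE[OF gE]])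
      then have "sqrt (nrm2 (C ?g)) \<le> B * e" using e B by (simp add: real_le_lsqrt nrm2_nonneg[OF cCE[OF gE]])
      then have "norm (C (C ?g) x) \<le> B * (B * e)"
        using norm_C_le[OF B(2) x cCE[OF gE]] mult_left_mono[of "sqrt (nrm2 (C ?g))" "B * e" B] B(1)
          by linarith
      moreover have "C (C ?g) x = C (C (C u)) x - C (C w) x"
      proof -
        have "C (C ?g) x = C (\<lambda>y. C (C u) y - C w y) x"
          by (rule C_cong[OF x]) (auto simp: C_diff intro: continuous_map_diff)
        then show ?thesis by (simp add: C_diff x)
      qed
      ultimately have t1: "norm (C (C (C u)) x - C (C w) x) \<le> B * (B * e)" by simp
      have "norm (of_real S * (C u x - w x)) \<le> S * e"
        using g[OF x] S by (simp add: norm_mult)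
      then have t3: "norm (of_real S * C u x - of_real S * w x) \<le> S * e" by (simp add: algebra_simps)
      have "C (C w) x - of_real S * w x = - (C (C (C u)) x - C (C w) x) + ((C (C (C u)) x - of_real S * C u x)
          + (of_real S * C u x - of_real S * w x))" by simp
      also have "norm \<dots> \<le> B * (B * e) + (B * sqrt (S * e) + S * e)"
        using t1 t2 t3 by (intro norm_triangle_mono) (simp_all only: norm_minus_cancel)
      finally show ?thesis by simp
    qed
    have "((\<lambda>e. B * (B * e) + B * sqrt (S * e) + S * e) \<longlongrightarrow> B * (B * 0) + B * sqrt (S * 0) + S * 0) (at_right 0)"
      by (intro tendsto_intros)
    moreover have "eventually (\<lambda>e. ?d \<le> B * (B * e) + B * sqrt (S * e) + S * e) (at_right 0)"
      unfolding eventually_at_right_field using est by (intro exI[of _ 1]) auto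
    ultimately have "?d \<le> B * (B * 0) + B * sqrt (S * 0) + S * 0"
      by (rule tendsto_lowerbound) simp
    then show ?thesis by simp
  qed
  show thesis by (rule that[OF S wE nz eig])
qed

end

context fun_subspace
begin

text \<open>For fixed \<open>x\<close> the combination with coefficients \<open>cnj (e i x)\<close>
  has value \<open>Q x\<close> at \<open>x\<close> and squared norm \<open>Q x\<close>, so
  \<open>Q\<close> is bounded by \<open>K\<^sup>2\<close>. The mean of \<open>Q\<close> counts the
  members of the system.\<close>

lemma orthonormal_size_bound:
  assumes K: "\<And>w x. w \<in> E \<Longrightarrow> x \<in> carrier G \<Longrightarrow> norm (w x) \<le> K * sqrt (nrm2 w)"
    and e: "orthonormal d e" "\<And>i. i < d \<Longrightarrow> e i \<in> E"
  shows "real d \<le> K\<^sup>2"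
proof -
  define Q where "Q x = (\<Sum>i<d. (norm (e i x))\<^sup>2)" for x
  have Q: "Q x \<le> K\<^sup>2" if x: "x \<in> carrier G" for x
  proof (cases "Q x = 0")
    case False
    have "Q x \<ge> 0" unfolding Q_def by (intro sum_nonneg) auto
    with False have pos: "Q x > 0" by simp
    let ?w = "\<lambda>y. \<Sum>i<d. cnj (e i x) * e i y"
    have "?w \<in> E" by (rule sum_E) (use e in auto)
    from K[OF this x] have "norm (?w x) \<le> K * sqrt (nrm2 ?w)" .
    moreover have "nrm2 ?w = Q x" unfolding orthonormal_nrm2_sum[OF e(1)] Q_def by simp
    moreover have "?w x = of_real (Q x)"
      unfolding Q_def of_real_sum using complex_norm_square by (intro sum.cong) (auto simp: mult.commute)
    ultimately have "Q x \<le> K * sqrt (Q x)" using pos by simp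
    then have "sqrt (Q x) * sqrt (Q x) \<le> K * sqrt (Q x)" using pos by simp
    then have "sqrt (Q x) \<le> K" by (rule mult_right_le_imp_le) (use pos in simp)
    then have "(sqrt (Q x))\<^sup>2 \<le> K\<^sup>2" using pos by (intro power_mono) auto
    then show ?thesis using pos by simp
  qed simp
  have ce: "cont (\<lambda>x. e i x * cnj (e i x))" if "i < d" for i by (intro cont_ip cont_E e that)
  have "Re (mean (\<lambda>x. \<Sum>i<d. e i x * cnj (e i x))) \<le> Re (mean (\<lambda>x. of_real (K\<^sup>2)))"
  proof (rule Re_mean_mono)
    show "cont (\<lambda>x. \<Sum>i<d. e i x * cnj (e i x))" by (intro continuous_map_sum ce) auto
    fix x assume x: "x \<in> carrier G"
    have "(\<Sum>i<d. e i x * cnj (e i x)) = of_real (Q x)"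
      unfolding Q_def of_real_sum using complex_norm_square by (intro sum.cong) auto
    then show "Re (\<Sum>i<d. e i x * cnj (e i x)) \<le> Re (of_real (K\<^sup>2))" using Q[OF x] by simp
  qed simp
  also have "mean (\<lambda>x. \<Sum>i<d. e i x * cnj (e i x)) = (\<Sum>i<d. ip (e i) (e i))"
    unfolding ip_def by (rule mean_sum) (auto intro: ce)
  also have "\<dots> = of_nat d" using e(1) unfolding orthonormal_def by simp
  finally show ?thesis by (simp add: mean_const)
qed

end

section \<open>Invariant spaces on which a conjugation-invariant set acts nontrivially\<close>

context compact_group
begin

lemma bump_function:
  assumes U: "openin T U" "\<one> \<in> U"
  obtains f where "continuous_map T euclideanreal f" "f \<one> = 1" "\<And>x. x \<in> carrier G \<Longrightarrow> x \<notin> U \<Longrightarrow> f x = 0"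
proof -
  have "normal_space T" using compact Hausdorff compact_Hausdorff_or_regular_imp_normal_space by blast
  moreover have "closedin T (carrier G - U)"
    using U(1) topspace_eq_carrier by (metis openin_closedin_eq closedin_diff closedin_topspace)
  moreover have "closedin T {\<one>}"
    using Hausdorff topspace_eq_carrier by (simp add: closedin_Hausdorff_singleton)
  moreover have "disjnt (carrier G - U) {\<one>}" using U by (simp add: disjnt_def)
  ultimately obtain f where "continuous_map T euclideanreal f" "f ` (carrier G - U) \<subseteq> {0}" "f ` {\<one>} \<subseteq> {1}"
    unfolding normal_space_iff_Urysohn_alt by blast
  then show thesis by (intro that[of f]) auto
qed

text \<open>The \<open>N\<close>-invariant continuous functions \<open>I\<close> are stable under
  convolution, and under translations because \<open>N\<close> is closed under conjugation; hence so
  is their orthogonal complement \<open>E\<close>. An eigenspace \<open>W\<close> of the squared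
  operator inside \<open>E\<close> meets \<open>I\<close> only in functions that vanish on the
  group, which is the last clause. Finite dimension is recorded as a bound of values by
  \<open>sqrt (nrm2 w)\<close>.\<close>

theorem ex_finite_dimensional_invariant:
  assumes N: "N \<subseteq> carrier G" "\<And>g n. g \<in> carrier G \<Longrightarrow> n \<in> N \<Longrightarrow> inv g \<otimes> n \<otimes> g \<in> N"
    and n: "n \<in> N" "n \<noteq> \<one>"
  obtains W K where "fun_subspace G T W"
    "\<And>w h. w \<in> W \<Longrightarrow> h \<in> carrier G \<Longrightarrow> (\<lambda>x. w (h \<otimes> x)) \<in> W"
    "\<And>w x. w \<in> W \<Longrightarrow> x \<in> carrier G \<Longrightarrow> norm (w x) \<le> K * sqrt (nrm2 w)"
    "\<exists>w\<in>W. \<exists>x\<in>carrier G. w x \<noteq> 0"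
    "\<And>w x. w \<in> W \<Longrightarrow> (\<And>m x. m \<in> N \<Longrightarrow> x \<in> carrier G \<Longrightarrow> w (m \<otimes> x) = w x) \<Longrightarrow> x \<in> carrier G \<Longrightarrow> w x = 0"
proof -
  have nG: "n \<in> carrier G" using n N by blast
  obtain O1 O2 where O: "openin T O1" "openin T O2" "\<one> \<in> O1" "n \<in> O2" "disjnt O1 O2"
    using Hausdorff n(2) nG one_closed unfolding Hausdorff_space_def topspace_eq_carrier by metis
  \<comment> \<open>A neighbourhood of the identity disjoint from its translate: \<open>x\<close>
    and \<open>n \<otimes> x\<close> never lie in \<open>U\<close> together.\<close>
  define U where "U = O1 \<inter> {x \<in> carrier G. n \<otimes> x \<in> O2}"
  have "openin T U" "\<one> \<in> U"
    unfolding U_def using O nG by (auto intro!: openin_Int openin_left_translate)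
  then obtain f where f: "continuous_map T euclideanreal f" "f \<one> = 1" "\<And>x. x \<in> carrier G \<Longrightarrow> x \<notin> U \<Longrightarrow> f x = 0"
    using bump_function by blast
  \<comment> \<open>Real and symmetric under inversion, hence hermitian; it still vanishes outside
    \<open>U\<close>, and \<open>F \<one> = 1\<close>.\<close>
  define F where "F = (\<lambda>x. complex_of_real (f x * f (inv x)))"
  have cF: "cont F"
    unfolding F_def using continuous_map_compose[OF continuous_inv f(1)]
    by (intro continuous_map_of_real continuous_map_real_mult f) (simp add: o_def)
  interpret F: hermitian_kernel G T F
    by unfold_locales (use cF in \<open>auto simp: F_def\<close>)
  have disj: "F x * F (n \<otimes> x) = 0" if x: "x \<in> carrier G" for x
  proof (cases "x \<in> U")
    case True
    then have "n \<otimes> x \<notin> U" using O(5) unfolding U_def disjnt_def by blast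
    then show ?thesis using f(3)[of "n \<otimes> x"] x nG by (simp add: F_def)
  qed (use f(3) x in \<open>simp add: F_def\<close>)
  define I where "I = {w. cont w \<and> (\<forall>m\<in>N. \<forall>x\<in>carrier G. w (m \<otimes> x) = w x)}"
  define E where "E = {u. cont u \<and> (\<forall>w\<in>I. ip u w = 0)}"
  have cI: "cont w" if "w \<in> I" for w using that unfolding I_def by simp
  interpret E: fun_subspace G T E
    by unfold_locales
      (auto simp: E_def cI ip_add_left ip_cmult_left intro!: continuous_map_add continuous_map_cmult,
       simp add: ip_def mean_const)
  have E_translate: "(\<lambda>x. u (h \<otimes> x)) \<in> E" if u: "u \<in> E" and h: "h \<in> carrier G" for u h
  proof -
    have c: "cont (\<lambda>x. u (h \<otimes> x))" by (rule continuous_map_translate(1)[OF E.cont_E[OF u] h h])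
    have "ip (\<lambda>x. u (h \<otimes> x)) w = 0" if w: "w \<in> I" for w
    proof -
      define w' where "w' = (\<lambda>x. w (inv h \<otimes> x))"
      have "cont w'" unfolding w'_def using h by (intro continuous_map_translate(1)[OF cI[OF w]]) auto
      moreover have "w' (m \<otimes> x) = w' x" if m: "m \<in> N" and x: "x \<in> carrier G" for m x
      proof -
        have mG: "m \<in> carrier G" using m N by blast
        have "w ((inv h \<otimes> m \<otimes> h) \<otimes> (inv h \<otimes> x)) = w (inv h \<otimes> x)"
          using w N(2)[OF h m] h x unfolding I_def by simp
        moreover have "(inv h \<otimes> m \<otimes> h) \<otimes> (inv h \<otimes> x) = inv h \<otimes> (m \<otimes> ((h \<otimes> inv h) \<otimes> x))"
          using h x mG by (simp only: m_assoc m_closed inv_closed)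
        ultimately show ?thesis unfolding w'_def using h x mG by simp
      qed
      ultimately have w': "w' \<in> I" unfolding I_def by blast
      have "ip (\<lambda>x. u (h \<otimes> x)) w = ip (\<lambda>x. u (h \<otimes> x)) (\<lambda>x. w' (h \<otimes> x))"
      proof (rule ip_cong[symmetric])
        show "w x = w' (h \<otimes> x)" if "x \<in> carrier G" for x
          using h that unfolding w'_def by (simp add: m_assoc[symmetric])
      qed (use c cI[OF w] in auto)
      also have "\<dots> = ip u w'" by (rule ip_translate[OF E.cont_E[OF u] cI[OF w'] h])
      also have "\<dots> = 0" using u w' unfolding E_def by blast
      finally show ?thesis .
    qed
    then show ?thesis unfolding E_def using c by blast
  qed
  interpret E: kernel_subspace G T F E
  proof unfold_locales
    fix u assume u: "u \<in> E"
    have "ip (F.C u) w = 0" if w: "w \<in> I" for w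
    proof -
      have "F.C w (m \<otimes> x) = F.C w x" if m: "m \<in> N" and x: "x \<in> carrier G" for m x
      proof -
        have mG: "m \<in> carrier G" using m N by blast
        have "F.C w (m \<otimes> x) = F.C (\<lambda>y. w (m \<otimes> y)) x" by (rule F.C_translate[OF x mG cI[OF w], symmetric])
        also have "\<dots> = F.C w x"
          by (rule F.C_cong[OF x cI[OF w]]) (use w m in \<open>simp add: I_def\<close>)
        finally show ?thesis .
      qed
      then have "F.C w \<in> I" unfolding I_def using F.cont_C[OF cI[OF w]] by blast
      then show ?thesis using u F.C_self_adjoint[OF E.cont_E[OF u] cI[OF w]] unfolding E_def by simp
    qed
    then show "F.C u \<in> E" unfolding E_def using F.cont_C[OF E.cont_E[OF u]] by blast
  next
    fix g :: "nat \<Rightarrow> 'a \<Rightarrow> complex" and w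
    assume g: "\<And>k. g k \<in> E" and w: "cont w"
      and lim: "\<And>e. e > 0 \<Longrightarrow> \<exists>N. \<forall>k\<ge>N. \<forall>x\<in>carrier G. norm (g k x - w x) < e"
    have "ip w v = 0" if v: "v \<in> I" for v
    proof -
      have "norm (ip w v) \<le> e * sqrt (nrm2 v)" if e: "e > 0" for e
      proof -
        obtain k where k: "\<forall>x\<in>carrier G. norm (g k x - w x) < e" using lim[OF e] by blast
        have c: "cont (\<lambda>x. g k x - w x)" by (intro continuous_map_diff E.cont_E g w)
        have "ip (g k) v = 0" using g[of k] v unfolding E_def by blast
        then have "ip w v = - ip (\<lambda>x. g k x - w x) v"
          by (simp add: ip_diff_left E.cont_E g w cI v)
        then have "norm (ip w v) \<le> sqrt (nrm2 (\<lambda>x. g k x - w x)) * sqrt (nrm2 v)"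
          using Cauchy_Schwarz[OF c cI[OF v]] by simp
        also have "\<dots> \<le> e * sqrt (nrm2 v)"
        proof (intro mult_right_mono)
          have "nrm2 (\<lambda>x. g k x - w x) \<le> e\<^sup>2" by (rule nrm2_le[OF c]) (use k in \<open>auto intro: less_imp_le\<close>)
          then show "sqrt (nrm2 (\<lambda>x. g k x - w x)) \<le> e" using e by (simp add: real_le_lsqrt nrm2_nonneg[OF c])
          show "0 \<le> sqrt (nrm2 v)" using nrm2_nonneg[OF cI[OF v]] by simp
        qed
        finally show ?thesis .
      qed
      then have "eventually (\<lambda>e. norm (ip w v) \<le> e * sqrt (nrm2 v)) (at_right 0)"
        unfolding eventually_at_right_field by (intro exI[of _ 1]) auto
      moreover have "((\<lambda>e. e * sqrt (nrm2 v)) \<longlongrightarrow> 0 * sqrt (nrm2 v)) (at_right 0)" by (intro tendsto_intros)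
      ultimately have "norm (ip w v) \<le> 0 * sqrt (nrm2 v)" by (intro tendsto_lowerbound) auto
      then show ?thesis by simp
    qed
    then show "w \<in> E" unfolding E_def using w by blast
  qed
  \<comment> \<open>The difference of \<open>F\<close> and its translate by \<open>n\<close> is
    orthogonal to all \<open>N\<close>-invariant functions. As \<open>F\<close> and the translate
    have product zero, the convolution of \<open>u\<close> at the identity is the mean of
    \<open>F\<^sup>2\<close>, so the operator does not vanish on \<open>E\<close>.\<close>
  define u where "u = (\<lambda>x. F x - F (n \<otimes> x))"
  have cFn: "cont (\<lambda>x. F (n \<otimes> x))" by (rule continuous_map_translate(1)[OF cF nG nG])
  have uE: "u \<in> E"
  proof -
    have "ip u w = 0" if w: "w \<in> I" for w
    proof -
      have "ip (\<lambda>x. F (n \<otimes> x)) w = ip (\<lambda>x. F (n \<otimes> x)) (\<lambda>x. w (n \<otimes> x))"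
        by (rule ip_cong[symmetric]) (use cFn cI[OF w] w n in \<open>auto simp: I_def\<close>)
      also have "\<dots> = ip F w" by (rule ip_translate[OF cF cI[OF w] nG])
      finally show ?thesis unfolding u_def by (simp add: ip_diff_left cF cFn cI w)
    qed
    moreover have "cont u" unfolding u_def by (intro continuous_map_diff cF cFn)
    ultimately show ?thesis unfolding E_def by blast
  qed
  have Cu: "F.C u \<one> \<noteq> 0"
  proof -
    have c2: "cont (\<lambda>y. F y * F y)" by (intro continuous_map_mult_algebra cF)
    have "F.C u \<one> = mean (\<lambda>y. F y * F y)"
      unfolding convolution_def
    proof (rule mean_cong[OF c2])
      fix y assume "y \<in> carrier G"
      then show "F y * F y = F (inv \<one> \<otimes> y) * u y"
        using disj[of y] unfolding u_def by (simp add: algebra_simps)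
    qed
    moreover have "0 < Re (mean (\<lambda>y. F y * F y))"
    proof (rule mean_pos[OF c2 _ one_closed])
      show "0 < Re (F \<one> * F \<one>)" by (simp add: F_def f)
    qed (simp add: F_def flip: of_real_mult)
    ultimately show ?thesis by auto
  qed
  obtain S w where S: "S > 0" and w: "w \<in> E" "\<exists>x\<in>carrier G. w x \<noteq> 0"
    and eig: "\<And>x. x \<in> carrier G \<Longrightarrow> F.C (F.C w) x = of_real S * w x"
    using E.ex_eigenvector[OF uE one_closed Cu] by metis
  define W where "W = {w \<in> E. \<forall>x\<in>carrier G. F.C (F.C w) x = of_real S * w x}"
  note cont_E = E.cont_E and cont_CE = E.cont_E[OF E.C_E]
  have WE: "W \<subseteq> E" unfolding W_def by blast
  have fsW: "fun_subspace G T W"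
  proof unfold_locales
    show "(\<lambda>x. 0) \<in> W"
      unfolding W_def using E.zero_E by (simp add: convolution_def mean_const)
  next
    fix u v assume uv: "u \<in> W" "v \<in> W"
    then have uvE: "u \<in> E" "v \<in> E" unfolding W_def by auto
    have "F.C (F.C (\<lambda>x. u x + v x)) x = F.C (\<lambda>x. F.C u x + F.C v x) x" if x: "x \<in> carrier G" for x
      by (rule F.C_cong[OF x continuous_map_add[OF cont_CE cont_CE]])
        (auto simp: F.C_add cont_E uvE)
    then have "F.C (F.C (\<lambda>x. u x + v x)) x = of_real S * (u x + v x)" if x: "x \<in> carrier G" for x
      using uv x unfolding W_def by (simp add: F.C_add cont_CE uvE algebra_simps)
    then show "(\<lambda>x. u x + v x) \<in> W" unfolding W_def using E.add_E[OF uvE] by blast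
  next
    fix u c assume u: "u \<in> W"
    then have uE: "u \<in> E" unfolding W_def by auto
    have "F.C (F.C (\<lambda>x. c * u x)) x = F.C (\<lambda>x. c * F.C u x) x" if x: "x \<in> carrier G" for x
      by (rule F.C_cong[OF x continuous_map_cmult[OF cont_CE]])
        (auto simp: F.C_cmult cont_E uE)
    then have "F.C (F.C (\<lambda>x. c * u x)) x = of_real S * (c * u x)" if x: "x \<in> carrier G" for x
      using u x unfolding W_def by (simp add: F.C_cmult cont_CE uE algebra_simps)
    then show "(\<lambda>x. c * u x) \<in> W" unfolding W_def using E.cmult_E[OF uE] by blast
  qed (use WE cont_E in blast)
  obtain B where B: "B > 0" "\<And>x. x \<in> carrier G \<Longrightarrow> norm (F x) \<le> B" using F.ex_bound by blast
  show thesis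
  proof (rule that[OF fsW])
    fix w h assume w: "w \<in> W" and h: "h \<in> carrier G"
    have wE: "w \<in> E" using w WE by blast
    have "F.C (F.C (\<lambda>x. w (h \<otimes> x))) x = of_real S * w (h \<otimes> x)" if x: "x \<in> carrier G" for x
    proof -
      have "F.C (F.C (\<lambda>x. w (h \<otimes> x))) x = F.C (\<lambda>y. F.C w (h \<otimes> y)) x"
        by (rule F.C_cong[OF x continuous_map_translate(1)[OF cont_CE[OF wE] h h]])
           (rule F.C_translate[OF _ h cont_E[OF wE], symmetric])
      also have "\<dots> = F.C (F.C w) (h \<otimes> x)" by (rule F.C_translate[OF x h cont_CE[OF wE]])
      finally show ?thesis using w h x unfolding W_def by simp
    qed
    then show "(\<lambda>x. w (h \<otimes> x)) \<in> W" unfolding W_def using E_translate[OF wE h] by blast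
  next
    fix w x assume w: "w \<in> W" and x: "x \<in> carrier G"
    have wE: "w \<in> E" using w WE by blast
    have "norm (F.C w y) \<le> B * sqrt (nrm2 w)" if "y \<in> carrier G" for y
      by (rule F.norm_C_le[OF B(2) that cont_E[OF wE]])
    then have "nrm2 (F.C w) \<le> (B * sqrt (nrm2 w))\<^sup>2" by (rule nrm2_le[OF cont_CE[OF wE]])
    then have "sqrt (nrm2 (F.C w)) \<le> B * sqrt (nrm2 w)"
      using B(1) nrm2_nonneg[OF cont_E[OF wE]] by (simp add: real_le_lsqrt nrm2_nonneg[OF cont_CE[OF wE]])
    then have "norm (F.C (F.C w) x) \<le> B * (B * sqrt (nrm2 w))"
      using F.norm_C_le[OF B(2) x cont_CE[OF wE]] mult_left_mono[of "sqrt (nrm2 (F.C w))"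
        "B * sqrt (nrm2 w)" B] B(1)
      by linarith
    moreover have "norm (F.C (F.C w) x) = S * norm (w x)"
      using w x S unfolding W_def by (simp add: norm_mult)
    \<comment> \<open>On \<open>W\<close> the squared operator is multiplication by
      \<open>S\<close>, and each application of the operator contributes one factor
      \<open>B\<close>.\<close>
    ultimately show "norm (w x) \<le> (B * B / S) * sqrt (nrm2 w)"
      using S by (simp add: field_simps)
  next
    show "\<exists>w\<in>W. \<exists>x\<in>carrier G. w x \<noteq> 0" using w eig unfolding W_def by blast
  next
    fix w x assume w: "w \<in> W" and inv: "\<And>m x. m \<in> N \<Longrightarrow> x \<in> carrier G \<Longrightarrow> w (m \<otimes> x) = w x"
      and x: "x \<in> carrier G"
    have wE: "w \<in> E" using w WE by blast
    have "w \<in> I" unfolding I_def using inv cont_E[OF wE] by blast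
    then have "nrm2 w = 0" using wE unfolding E_def nrm2_def by auto
    then show "w x = 0" by (rule nrm2_eq_0[OF cont_E[OF wE] _ x])
  qed
qed

end

section \<open>Torsion groups are residually finite\<close>

lemma trace_mult_commute:
  fixes A B :: "complex Matrix.mat"
  assumes A: "A \<in> carrier_mat d d" and B: "B \<in> carrier_mat d d"
  shows "(\<Sum>i<d. (A * B) $$ (i, i)) = (\<Sum>i<d. (B * A) $$ (i, i))"
proof -
  have "(\<Sum>i<d. (A * B) $$ (i, i)) = (\<Sum>i<d. \<Sum>k<d. A $$ (i, k) * B $$ (k, i))"
    using A B by (intro sum.cong) (auto simp: scalar_prod_def lessThan_atLeast0)
  also have "\<dots> = (\<Sum>k<d. \<Sum>i<d. B $$ (k, i) * A $$ (i, k))"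
    by (subst sum.swap) (simp add: mult.commute)
  also have "\<dots> = (\<Sum>i<d. (B * A) $$ (i, i))"
    using A B by (intro sum.cong) (auto simp: scalar_prod_def lessThan_atLeast0)
  finally show ?thesis .
qed

text \<open>The trace is the sum of the diagonal \<open>es\<close> of a triangular form, and these
  entries are eigenvalues. An eigenvalue \<open>z\<close> of \<open>A\<close> satisfies
  \<open>z ^ m = 1\<close> because the \<open>m\<close>-th power of \<open>A\<close> fixes its
  eigenvector. For a given \<open>m\<close> only finitely many traces are thus possible.\<close>

lemma finite_order_trace:
  fixes A :: "complex Matrix.mat"
  assumes A: "A \<in> carrier_mat d d" and m: "A ^\<^sub>m m = 1\<^sub>m d"
  shows "(\<Sum>i<d. A $$ (i, i)) \<in> sum_list ` {zs. set zs \<subseteq> {z. z ^ m = 1} \<and> length zs = d}"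
proof -
  obtain es where es: "char_poly A = (\<Prod>a\<leftarrow>es. [:- a, 1:])" "length es = d"
    using char_poly_factorized[OF A] by blast
  obtain B P Q where "schur_decomposition A es = (B, P, Q)" by (cases "schur_decomposition A es") auto
  from schur_decomposition[OF A es(1) this]
  have sim: "similar_mat_wit A B P Q" and diag: "diag_mat B = es" by auto
  note w = similar_mat_witD2[OF A sim]
  have "(\<Sum>i<d. A $$ (i, i)) = (\<Sum>i<d. (P * (B * Q)) $$ (i, i))"
    unfolding w(3) using w by (simp add: assoc_mult_mat[OF w(6,5,7)])
  also have "\<dots> = (\<Sum>i<d. (B * Q * P) $$ (i, i))"
    by (rule trace_mult_commute) (use w in auto)
  also have "B * Q * P = B" using assoc_mult_mat[OF w(5,7,6)] w by simp
  also have "(\<Sum>i<d. B $$ (i, i)) = sum_list es"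
    unfolding diag[symmetric] diag_mat_def using w(5)
    by (simp add: interv_sum_list_conv_sum_set_nat lessThan_atLeast0)
  finally have tr: "(\<Sum>i<d. A $$ (i, i)) = sum_list es" .
  have "z ^ m = 1" if z: "z \<in> set es" for z
  proof -
    have "poly (char_poly A) z = 0"
      unfolding es(1) poly_prod_list using z by (auto simp: prod_list_zero_iff)
    then obtain v where v: "eigenvector A v z"
      using eigenvalue_root_char_poly[OF A] unfolding eigenvalue_def by blast
    then have vc: "v \<in> carrier_vec d" "v \<noteq> 0\<^sub>v d" using A unfolding eigenvector_def by auto
    have eq: "z ^ m \<cdot>\<^sub>v v = v" using eigenvector_pow[OF A v, of m] vc unfolding m by simp
    obtain i where i: "i < d" "vec_index v i \<noteq> 0"
      using vc by (metis carrier_vecD eq_vecI index_zero_vec)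
    have "vec_index (z ^ m \<cdot>\<^sub>v v) i = vec_index v i" unfolding eq ..
    then show ?thesis using i vc by simp
  qed
  then show ?thesis using tr es(2) by blast
qed

lemma finite_root_sums:
  assumes "m > 0"
  shows "finite (sum_list ` {zs. set zs \<subseteq> {z::complex. z ^ m = 1} \<and> length zs = d})"
  by (intro finite_imageI finite_lists_length_eq finite_roots_unity) (use assms in simp)

text \<open>The combinations of finitely many functions form a finite-dimensional space on
  \<open>D\<close>, so finitely many evaluations determine them. In the induction one new point
  suffices: the combinations vanishing on \<open>S\<close> are, as functions on \<open>D\<close>,
  multiples of a single one.\<close>

lemma finite_determining_set:
  fixes f :: "'k \<Rightarrow> 'x \<Rightarrow> complex"
  assumes "finite I"
  shows "\<exists>S\<subseteq>D. finite S \<and>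
    (\<forall>c. (\<forall>s\<in>S. (\<Sum>k\<in>I. c k * f k s) = 0) \<longrightarrow> (\<forall>x\<in>D. (\<Sum>k\<in>I. c k * f k x) = 0))"
  using assms
proof (induction I)
  case (insert j I)
  from insert.IH obtain S where S12: "S \<subseteq> D" "finite S"
    and S3: "\<forall>c. (\<forall>s\<in>S. (\<Sum>k\<in>I. c k * f k s) = 0) \<longrightarrow> (\<forall>x\<in>D. (\<Sum>k\<in>I. c k * f k x) = 0)"
    by (elim exE conjE)
  have S: "S \<subseteq> D" "finite S"
    "\<And>c x. (\<forall>s\<in>S. (\<Sum>k\<in>I. c k * f k s) = 0) \<Longrightarrow> x \<in> D \<Longrightarrow> (\<Sum>k\<in>I. c k * f k x) = 0"
    by (fact S12)+ (rule bspec[OF mp[OF spec[OF S3]]])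
  have ins: "(\<Sum>k\<in>insert j I. c k * f k x) = c j * f j x + (\<Sum>k\<in>I. c k * f k x)" for c x
    using insert by simp
  show ?case
  proof (cases "\<forall>c. (\<forall>s\<in>S. (\<Sum>k\<in>insert j I. c k * f k s) = 0) \<longrightarrow> (\<forall>x\<in>D. (\<Sum>k\<in>insert j I. c k * f k x) = 0)")
    case True
    with S(1,2) show ?thesis by (intro exI[of _ S] conjI)
  next
    case False
    then obtain c x where c: "\<And>s. s \<in> S \<Longrightarrow> (\<Sum>k\<in>insert j I. c k * f k s) = 0"
      and x: "x \<in> D" "(\<Sum>k\<in>insert j I. c k * f k x) \<noteq> 0" by blast
    have cj: "c j \<noteq> 0"
    proof
      assume "c j = 0"
      then show False using S(3)[of c x] c x unfolding ins by simp
    qed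
    have "(\<Sum>k\<in>insert j I. c' k * f k y) = 0"
      if c': "\<forall>s\<in>insert x S. (\<Sum>k\<in>insert j I. c' k * f k s) = 0" and y: "y \<in> D" for c' y
    proof -
      \<comment> \<open>Subtracting \<open>t * c k\<close> removes the coefficient of
        \<open>j\<close>, which brings the combination back to \<open>I\<close>.\<close>
      define t where "t = c' j / c j"
      define b where "b k = c' k - t * c k" for k
      have b: "(\<Sum>k\<in>I. b k * f k z) = (\<Sum>k\<in>insert j I. c' k * f k z) - t * (\<Sum>k\<in>insert j I. c k * f k z)" for z
        unfolding ins b_def t_def using cj
        by (simp add: left_diff_distrib sum_subtractf sum_distrib_left algebra_simps)
      have "\<forall>s\<in>S. (\<Sum>k\<in>I. b k * f k s) = 0" unfolding b using c c' by simp
      then have z: "(\<Sum>k\<in>I. b k * f k z) = 0" if "z \<in> D" for z using S(3) that by blast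
      have "t = 0" using z[OF x(1)] x(2) c' unfolding b by simp
      then show ?thesis using z[OF y] unfolding b by simp
    qed
    moreover have "insert x S \<subseteq> D" "finite (insert x S)" using S(1,2) x(1) by simp_all
    ultimately show ?thesis by (intro exI[of _ "insert x S"] conjI allI impI ballI)
  qed
qed auto

section \<open>The representation by translations on an invariant space\<close>

locale invariant_basis = fun_subspace +
  fixes d :: nat and e :: "nat \<Rightarrow> 'a \<Rightarrow> complex"
  assumes translate_E: "u \<in> E \<Longrightarrow> h \<in> carrier G \<Longrightarrow> (\<lambda>x. u (h \<otimes> x)) \<in> E"
    and orthonormal: "orthonormal d e"
    and basis_E: "i < d \<Longrightarrow> e i \<in> E"
    and expand: "w \<in> E \<Longrightarrow> x \<in> carrier G \<Longrightarrow> w x = (\<Sum>i<d. ip w (e i) * e i x)"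
begin

definition \<rho> :: "nat \<Rightarrow> nat \<Rightarrow> 'a \<Rightarrow> complex" where
  "\<rho> i j h = ip (\<lambda>x. e j (h \<otimes> x)) (e i)"

definition rep :: "'a \<Rightarrow> complex Matrix.mat" where
  "rep h = Matrix.mat d d (\<lambda>(i, j). \<rho> i j h)"

lemma cont_e: "i < d \<Longrightarrow> cont (e i)"
  by (rule cont_E[OF basis_E])

lemma rep_carrier: "rep h \<in> carrier_mat d d"
  unfolding rep_def by simp

lemma translate_expand:
  "j < d \<Longrightarrow> h \<in> carrier G \<Longrightarrow> x \<in> carrier G \<Longrightarrow> e j (h \<otimes> x) = (\<Sum>i<d. \<rho> i j h * e i x)"
  using expand[OF translate_E[OF basis_E]] unfolding \<rho>_def by simp

lemma \<rho>_one: "i < d \<Longrightarrow> j < d \<Longrightarrow> \<rho> i j \<one> = (if i = j then 1 else 0)"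
proof -
  assume ij: "i < d" "j < d"
  have "\<rho> i j \<one> = ip (e j) (e i)"
    unfolding \<rho>_def by (rule ip_cong) (use ij cont_e in auto)
  then show ?thesis using orthonormal ij unfolding orthonormal_def by auto
qed

lemma \<rho>_mult:
  assumes "i < d" "j < d" "g \<in> carrier G" "h \<in> carrier G"
  shows "\<rho> i j (g \<otimes> h) = (\<Sum>k<d. \<rho> i k h * \<rho> k j g)"
proof -
  have c: "cont (\<lambda>x. e k (h \<otimes> x))" if "k < d" for k
    by (rule continuous_map_translate(1)[OF cont_e[OF that] assms(4,4)])
  have cs: "cont (\<lambda>x. \<Sum>k<d. \<rho> k j g * e k (h \<otimes> x))"
    by (intro continuous_map_sum continuous_map_cmult c) auto
  have "\<rho> i j (g \<otimes> h) = ip (\<lambda>x. \<Sum>k<d. \<rho> k j g * e k (h \<otimes> x)) (e i)"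
    unfolding \<rho>_def[of i j]
  proof (rule ip_cong[OF cs cont_e[OF assms(1)]])
    fix x assume x: "x \<in> carrier G"
    have "e j (g \<otimes> h \<otimes> x) = e j (g \<otimes> (h \<otimes> x))" using assms x by (simp add: m_assoc)
    also have "\<dots> = (\<Sum>k<d. \<rho> k j g * e k (h \<otimes> x))"
      by (rule translate_expand) (use assms x in auto)
    finally show "(\<Sum>k<d. \<rho> k j g * e k (h \<otimes> x)) = e j (g \<otimes> h \<otimes> x)" by simp
  qed simp
  also have "\<dots> = (\<Sum>k<d. \<rho> k j g * ip (\<lambda>x. e k (h \<otimes> x)) (e i))"
    by (rule ip_sum_left) (use c cont_e assms in auto)
  finally show ?thesis unfolding \<rho>_def by (simp add: mult.commute)
qed

text \<open>The order is reversed because replacing \<open>u\<close> by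
  \<open>\<lambda>x. u (h \<otimes> x)\<close> is an action from the right.\<close>

lemma rep_mult:
  "g \<in> carrier G \<Longrightarrow> h \<in> carrier G \<Longrightarrow> rep (g \<otimes> h) = rep h * rep g"
  by (rule eq_matI) (auto simp: rep_def \<rho>_mult scalar_prod_def lessThan_atLeast0)

lemma rep_pow: "g \<in> carrier G \<Longrightarrow> rep (g [^] (n::nat)) = rep g ^\<^sub>m n"
proof (induction n)
  case 0
  show ?case by (rule eq_matI) (auto simp: rep_def \<rho>_one)
next
  case (Suc n)
  have "g [^] Suc n = g \<otimes> g [^] n" using Suc.prems by (simp only: nat_pow_Suc2)
  then show ?case using Suc by (simp add: rep_mult)
qed

lemma cont_\<rho>:
  assumes "i < d" "j < d"
  shows "cont (\<rho> i j)"
proof -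
  have 1: "continuous_map (prod_topology T T) euclidean (\<lambda>p. e j (fst p \<otimes> snd p))"
    using continuous_map_compose[OF continuous_map_mult[OF continuous_map_fst continuous_map_snd] cont_e[OF
      assms(2)]]
    by (simp add: o_def)
  have 2: "continuous_map (prod_topology T T) euclidean (\<lambda>p. cnj (e i (snd p)))"
    using continuous_map_cnj[OF continuous_map_compose[OF continuous_map_snd cont_e[OF assms(1)]]]
    by (simp add: o_def)
  have "continuous_map (prod_topology T T) euclidean (\<lambda>(h, x). e j (h \<otimes> x) * cnj (e i x))"
    unfolding case_prod_unfold by (rule continuous_map_mult_algebra[OF 1 2])
  from mean_swap(1)[OF this] show ?thesis unfolding \<rho>_def[abs_def] ip_def .
qed

text \<open>The character of the representation, the trace of \<open>rep h\<close>.\<close>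

definition \<Phi> :: "'a \<Rightarrow> complex" where
  "\<Phi> h = (\<Sum>i<d. \<rho> i i h)"

lemma cont_\<Phi>: "cont \<Phi>"
  unfolding \<Phi>_def[abs_def] by (intro continuous_map_sum cont_\<rho>) auto

lemma \<Phi>_finite_order:
  assumes "h \<in> carrier G" "h [^] (m::nat) = \<one>"
  shows "\<Phi> h \<in> sum_list ` {zs. set zs \<subseteq> {z. z ^ m = 1} \<and> length zs = d}"
proof -
  have "rep h ^\<^sub>m m = 1\<^sub>m d"
    using rep_pow[OF assms(1), of m] rep_pow[OF one_closed, of 0] assms(2)
      carrier_matD(1)[OF rep_carrier[of h]] by simp
  from finite_order_trace[OF rep_carrier this] show ?thesis
    unfolding \<Phi>_def rep_def by simp
qed

text \<open>Translations are isometries, so \<open>nrm2 (\<lambda>x. e i (v \<otimes> x) - e i x) =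
  2 - 2 * Re (\<rho> i i v)\<close>. Summed over \<open>i\<close> this gives
  \<open>2 * d - 2 * Re (\<Phi> v)\<close>: maximal trace forces every basis function to be
  fixed.\<close>

lemma \<Phi>_max_imp_trivial:
  assumes v: "v \<in> carrier G" "\<Phi> v = of_nat d" and w: "w \<in> E" and x: "x \<in> carrier G"
  shows "w (v \<otimes> x) = w x"
proof -
  have c: "cont (\<lambda>x. e i (v \<otimes> x))" if "i < d" for i
    by (rule continuous_map_translate(1)[OF cont_e[OF that] v(1,1)])
  have cd: "cont (\<lambda>x. e i (v \<otimes> x) - e i x)" if "i < d" for i
    by (intro continuous_map_diff c cont_e that)
  have n: "nrm2 (\<lambda>x. e i (v \<otimes> x) - e i x) = 2 - 2 * Re (\<rho> i i v)" if i: "i < d" for i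
  proof -
    have "ip (e i) (e i) = 1" using orthonormal i unfolding orthonormal_def by simp
    then have "nrm2 (e i) = 1" "nrm2 (\<lambda>x. e i (v \<otimes> x)) = 1"
      unfolding nrm2_def by (simp_all add: ip_translate cont_e i v)
    then show ?thesis unfolding \<rho>_def by (simp add: nrm2_diff c cont_e i)
  qed
  have "(\<Sum>i<d. nrm2 (\<lambda>x. e i (v \<otimes> x) - e i x)) = (\<Sum>i<d. 2 - 2 * Re (\<rho> i i v))"
    by (rule sum.cong) (auto simp: n)
  also have "\<dots> = 2 * real d - 2 * Re (\<Phi> v)"
    unfolding \<Phi>_def by (simp add: sum_subtractf sum_distrib_left)
  also have "\<dots> = 0" unfolding v(2) by simp
  finally have "\<forall>i\<in>{..<d}. nrm2 (\<lambda>x. e i (v \<otimes> x) - e i x) = 0"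
    by (subst (asm) sum_nonneg_eq_0_iff) (auto intro: nrm2_nonneg cd)
  then have "e i (v \<otimes> y) = e i y" if "i < d" "y \<in> carrier G" for i y
    using nrm2_eq_0[OF cd[OF that(1)] _ that(2)] that(1) by simp
  then show ?thesis using expand[OF w, of "v \<otimes> x"] expand[OF w x] v(1) x by simp
qed

text \<open>On elements of order dividing \<open>m\<close> the trace \<open>\<Phi>\<close> takes finitely many values, so Baire's theorem
  makes \<open>\<Phi>\<close> locally constant on a dense set; finitely many points of that set determine
  all linear combinations of the matrix coefficients.\<close>

definition locally_constant_points :: "'a set" where
  "locally_constant_points =
    {h \<in> carrier G. \<exists>V. openin T V \<and> \<one> \<in> V \<and> (\<forall>v\<in>V. \<Phi> (h \<otimes> v) = \<Phi> h)}"

lemma dense_locally_constant_points: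
  assumes torsion: "\<And>x. x \<in> carrier G \<Longrightarrow> \<exists>m>0. x [^] (m::nat) = \<one>"
    and P: "openin T P" "P \<noteq> {}"
  shows "locally_constant_points \<inter> P \<noteq> {}"
proof -
  define Z where "Z m = {x \<in> carrier G. x [^] (m::nat) = \<one>}" for m
  have powc: "continuous_map T T (\<lambda>x. x [^] (m::nat))" for m
    by (induction m) (auto intro: continuous_map_mult simp: topspace_eq_carrier)
  have Zc: "closedin T (Z m)" for m
  proof -
    have "closedin T {\<one>}" using Hausdorff by (simp add: closedin_Hausdorff_singleton topspace_eq_carrier)
    from closedin_continuous_map_preimage[OF powc this] show ?thesis
      unfolding Z_def by (simp add: topspace_eq_carrier)
  qed
  have "\<exists>m>0. T interior_of (Z m) \<inter> P \<noteq> {}"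
  proof (rule ccontr)
    assume no: "\<not> ?thesis"
    \<comment> \<open>The sets \<open>Z m - T interior_of (Z m)\<close> are closed and nowhere
      dense. If no interior met \<open>P\<close>, they would cover the nonempty open set
      \<open>P\<close>.\<close>
    define \<G> where "\<G> = (\<lambda>m. Z m - T interior_of (Z m)) ` {m. m > 0}"
    have "P \<subseteq> \<Union>\<G>"
    proof
      fix x assume x: "x \<in> P"
      then have "x \<in> carrier G" using openin_subset[OF P(1)] topspace_eq_carrier by auto
      then obtain m where m: "m > 0" "x \<in> Z m" using torsion[of x] unfolding Z_def by auto
      then have "x \<notin> T interior_of (Z m)" using no x by blast
      then have "x \<in> Z m - T interior_of (Z m)" using m by simp
      then show "x \<in> \<Union>\<G>" unfolding \<G>_def using m(1) by (intro UN_I[of m]) simp_all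
    qed
    moreover have "T interior_of \<Union>\<G> = {}"
    proof (rule Baire_category_alt)
      show "completely_metrizable_space T \<or> locally_compact_space T \<and> regular_space T"
        by (intro disjI2 conjI compact_imp_locally_compact_space compact_Hausdorff_imp_regular_space
            compact Hausdorff)
      show "countable \<G>" unfolding \<G>_def by simp
      fix Q assume "Q \<in> \<G>"
      then obtain m where Q: "Q = Z m - T interior_of (Z m)" unfolding \<G>_def by blast
      have "T interior_of Q \<subseteq> T interior_of (Z m)" unfolding Q by (intro interior_of_mono) blast
      moreover have "T interior_of Q \<subseteq> Q" by (rule interior_of_subset)
      ultimately have "T interior_of Q = {}" unfolding Q by blast
      moreover have "closedin T Q" unfolding Q by (intro closedin_diff Zc openin_interior_of)
      ultimately show "closedin T Q \<and> T interior_of Q = {}" by blast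
    qed
    ultimately show False using interior_of_maximal[OF _ P(1), of "\<Union>\<G>"] P(2) by simp
  qed
  then obtain m h where m: "m > 0" and h: "h \<in> T interior_of (Z m)" "h \<in> P" by blast
  have hG: "h \<in> carrier G" using h(2) openin_subset[OF P(1)] topspace_eq_carrier by auto
  define R where "R = sum_list ` {zs. set zs \<subseteq> {z::complex. z ^ m = 1} \<and> length zs = d}"
  have fR: "finite R" unfolding R_def by (rule finite_root_sums[OF m])
  \<comment> \<open>On \<open>Z m\<close> the trace takes values in the finite set \<open>R\<close>.
    Excluding the values other than \<open>\<Phi> h\<close> is an open condition, so the trace is
    constant on a neighbourhood of \<open>h\<close>.\<close>
  define Q where "Q = T interior_of (Z m) \<inter> {x \<in> topspace T. \<Phi> x \<in> - (R - {\<Phi> h})}"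
  have "open (- (R - {\<Phi> h}))" by (intro open_Compl finite_imp_closed finite_Diff fR)
  then have op: "openin euclidean (- (R - {\<Phi> h}))" by simp
  have "openin T {x \<in> topspace T. \<Phi> x \<in> - (R - {\<Phi> h})}"
    by (rule openin_continuous_map_preimage[OF cont_\<Phi> op])
  then have Qo: "openin T Q" unfolding Q_def by (intro openin_Int openin_interior_of)
  have hQ: "h \<in> Q"
  proof -
    have "\<Phi> h \<notin> R - {\<Phi> h}" by (rule notI) (erule DiffE, erule notE, rule singletonI)
    then have "\<Phi> h \<in> - (R - {\<Phi> h})" unfolding Compl_iff .
    moreover have "h \<in> topspace T" unfolding topspace_eq_carrier by (rule hG)
    ultimately have "h \<in> {x \<in> topspace T. \<Phi> x \<in> - (R - {\<Phi> h})}" by (intro CollectI conjI)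
    with h(1) show ?thesis unfolding Q_def by (rule IntI)
  qed
  have Qc: "\<Phi> x = \<Phi> h" if x: "x \<in> Q" for x
  proof -
    have "x \<in> T interior_of (Z m)" using x unfolding Q_def by (rule IntD1)
    then have "x \<in> Z m" by (rule subsetD[OF interior_of_subset])
    then have "x \<in> carrier G" "x [^] m = \<one>" unfolding Z_def by simp_all
    then have "\<Phi> x \<in> R" unfolding R_def by (rule \<Phi>_finite_order)
    moreover have "\<Phi> x \<notin> R - {\<Phi> h}" using IntD2[OF x[unfolded Q_def]] by blast
    ultimately show ?thesis by blast
  qed
  have "h \<in> locally_constant_points"
    unfolding locally_constant_points_def
  proof (intro CollectI conjI exI)
    show "openin T {v \<in> carrier G. h \<otimes> v \<in> Q}" by (rule openin_left_translate[OF Qo hG])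
    show "\<one> \<in> {v \<in> carrier G. h \<otimes> v \<in> Q}" using hG hQ by simp
    show "\<forall>v\<in>{v \<in> carrier G. h \<otimes> v \<in> Q}. \<Phi> (h \<otimes> v) = \<Phi> h" using Qc by simp
  qed (rule hG)
  then show ?thesis using h(2) by blast
qed

text \<open>For fixed \<open>v\<close>, \<open>\<Phi> (h \<otimes> v) - \<Phi> h\<close> is a linear
  combination of matrix coefficients of \<open>h\<close>. The neighbourhoods of \<open>v\<close> for
  which it vanishes vary with \<open>h\<close> in \<open>D\<close>; a finite determining set
  \<open>S\<close> replaces them by one finite intersection. For \<open>v\<close> in it the
  difference vanishes on the dense set \<open>D\<close>, hence at the identity, where it says that
  the trace of \<open>v\<close> is maximal.\<close>

lemma torsion_imp_locally_trivial:
  assumes torsion: "\<And>x. x \<in> carrier G \<Longrightarrow> \<exists>m>0. x [^] (m::nat) = \<one>"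
  shows "\<exists>V. openin T V \<and> \<one> \<in> V \<and> (\<forall>v\<in>V. \<forall>w\<in>E. \<forall>x\<in>carrier G. w (v \<otimes> x) = w x)"
proof -
  define D where "D = locally_constant_points"
  have dense: "D \<inter> P \<noteq> {}" if "openin T P" "P \<noteq> {}" for P
    unfolding D_def by (rule dense_locally_constant_points[OF torsion that])
  note D_def = D_def[unfolded locally_constant_points_def]
  have DG: "D \<subseteq> carrier G" unfolding D_def by blast
  define I where "I = {..<d} \<times> {..<d}"
  have shift: "\<Phi> (h \<otimes> v) - \<Phi> h = (\<Sum>p\<in>I. (\<rho> (fst p) (snd p) v - (if fst p
    = snd p then 1 else 0)) * \<rho> (snd p) (fst p) h)"
    if "h \<in> carrier G" "v \<in> carrier G" for h v
  proof -
    have "\<Phi> h = \<Phi> (h \<otimes> \<one>)" using that by simp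
    also have "\<dots> = (\<Sum>i<d. \<Sum>k<d. \<rho> i k \<one> * \<rho> k i h)"
      unfolding \<Phi>_def by (rule sum.cong) (simp_all add: \<rho>_mult[OF _ _ that(1) one_closed] del: r_one)
    also have "\<dots> = (\<Sum>i<d. \<Sum>k<d. (if i = k then 1 else 0) * \<rho> k i h)"
      by (intro sum.cong) (auto simp: \<rho>_one)
    finally have 1: "\<Phi> h = (\<Sum>i<d. \<Sum>k<d. (if i = k then 1 else 0) * \<rho> k i h)" .
    have 2: "\<Phi> (h \<otimes> v) = (\<Sum>i<d. \<Sum>k<d. \<rho> i k v * \<rho> k i h)"
      unfolding \<Phi>_def by (rule sum.cong) (use that \<rho>_mult in auto)
    have 3: "(\<Sum>p\<in>I. g (fst p) (snd p)) = (\<Sum>i<d. \<Sum>k<d. g i k)" for g :: "nat \<Rightarrow> nat \<Rightarrow> complex"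
      unfolding I_def sum.cartesian_product by (simp only: case_prod_unfold)
    show ?thesis
      unfolding 1 2 3[of "\<lambda>i k. (\<rho> i k v - (if i = k then 1 else 0)) * \<rho> k i h"]
      by (simp only: sum_subtractf[symmetric] left_diff_distrib)
  qed
  obtain S where S: "S \<subseteq> D" "finite S"
    "\<And>c x. (\<forall>s\<in>S. (\<Sum>p\<in>I. c p * \<rho> (snd p) (fst p) s) = 0) \<Longrightarrow> x \<in> D \<Longrightarrow> (\<Sum>p\<in>I. c p * \<rho> (snd p) (fst p) x) = 0"
  proof -
    have "finite I" unfolding I_def by simp
    from finite_determining_set[OF this, of D "\<lambda>p. \<rho> (snd p) (fst p)"]
    obtain S where S: "S \<subseteq> D" "finite S"
      and S3: "\<forall>c. (\<forall>s\<in>S. (\<Sum>p\<in>I. c p * \<rho> (snd p) (fst p) s) = 0) \<longrightarrow> (\<forall>x\<in>D. (\<Sum>p\<in>I. c p * \<rho> (snd p) (fst p) x)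
        = 0)"
      by (elim exE conjE)
    show thesis by (rule that[OF S bspec[OF mp[OF spec[OF S3]]]])
  qed
  have "\<forall>s\<in>S. \<exists>V. openin T V \<and> \<one> \<in> V \<and> (\<forall>v\<in>V. \<Phi> (s \<otimes> v) = \<Phi> s)"
    using S(1) unfolding D_def by blast
  from bchoice[OF this] obtain V where
    V: "\<forall>s\<in>S. openin T (V s) \<and> \<one> \<in> V s \<and> (\<forall>v\<in>V s. \<Phi> (s \<otimes> v) = \<Phi> s)" by (rule exE)
  define V0 where "V0 = carrier G \<inter> \<Inter>(V ` S)"
  show ?thesis
  proof (intro exI conjI ballI)
    have V0: "V0 = \<Inter>(insert (carrier G) (V ` S))" unfolding V0_def by simp
    show "openin T V0"
      unfolding V0
    proof (rule openin_Inter)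
      fix X assume "X \<in> insert (carrier G) (V ` S)"
      then show "openin T X" using V openin_topspace[of T] topspace_eq_carrier by auto
    qed (use S(2) in auto)
    show "\<one> \<in> V0" unfolding V0_def using V by simp
    fix v w x assume v: "v \<in> V0" and wx: "w \<in> E" "x \<in> carrier G"
    have vG: "v \<in> carrier G" using v unfolding V0_def by blast
    have onS: "\<Phi> (s \<otimes> v) - \<Phi> s = 0" if "s \<in> S" for s using bspec[OF V that] v that unfolding V0_def by auto
    have onD: "\<Phi> (h \<otimes> v) - \<Phi> h = 0" if h: "h \<in> D" for h
    proof -
      have hG: "h \<in> carrier G" using h DG by blast
      show ?thesis
        unfolding shift[OF hG vG]
      proof (rule S(3)[OF _ h], intro ballI)
        fix s assume s: "s \<in> S"
        then have "s \<in> carrier G" using S(1) DG by blast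
        from shift[OF this vG] onS[OF s]
        show "(\<Sum>p\<in>I. (\<rho> (fst p) (snd p) v - (if fst p = snd p then 1 else 0)) * \<rho> (snd p) (fst p) s) = 0"
          by simp
      qed
    qed
    have "\<Phi> (\<one> \<otimes> v) - \<Phi> \<one> = 0"
    proof (rule ccontr)
      assume "\<Phi> (\<one> \<otimes> v) - \<Phi> \<one> \<noteq> 0"
      moreover have c: "cont (\<lambda>h. \<Phi> (h \<otimes> v) - \<Phi> h)"
        by (intro continuous_map_diff cont_\<Phi> continuous_map_translate(2)[OF cont_\<Phi> vG vG])
      ultimately have "D \<inter> {h \<in> topspace T. \<Phi> (h \<otimes> v) - \<Phi> h \<in> - {0}} \<noteq> {}"
        by (intro dense openin_continuous_map_preimage[OF c]) (auto simp: topspace_eq_carrier)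
      then obtain h where "h \<in> D" "\<Phi> (h \<otimes> v) - \<Phi> h \<noteq> 0" by auto
      then show False using onD by simp
    qed
    then have "\<Phi> v = of_nat d" using vG by (simp add: \<Phi>_def \<rho>_one)
    then show "w (v \<otimes> x) = w x" by (rule \<Phi>_max_imp_trivial[OF vG _ wx])
  qed
qed

end

context fun_subspace
begin

lemma ex_maximal_orthonormal:
  assumes K: "\<And>w x. w \<in> E \<Longrightarrow> x \<in> carrier G \<Longrightarrow> norm (w x) \<le> K * sqrt (nrm2 w)"
  shows "\<exists>d e. orthonormal d e \<and> (\<forall>i<d. e i \<in> E) \<and>
    (\<forall>d' e'. orthonormal d' e' \<and> (\<forall>i<d'. e' i \<in> E) \<longrightarrow> d' \<le> d)"
proof -
  define P where "P d \<longleftrightarrow> (\<exists>e. orthonormal d e \<and> (\<forall>i<d. e i \<in> E))" for d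
  have P0: "P 0" unfolding P_def orthonormal_def by simp
  have bound: "\<forall>d. P d \<longrightarrow> d \<le> nat \<lfloor>K\<^sup>2\<rfloor>"
    unfolding P_def using orthonormal_size_bound[OF K] by (auto simp: le_nat_floor)
  have "P (Greatest P)" by (rule GreatestI_nat[where P = P, OF P0]) (use bound in blast)
  moreover have "d \<le> Greatest P" if "P d" for d
    by (rule Greatest_le_nat[where P = P, OF that]) (use bound in blast)
  ultimately have "P (Greatest P)" "\<forall>d. P d \<longrightarrow> d \<le> Greatest P" by blast+
  then show ?thesis unfolding P_def[of "Greatest P"] P_def[of "d" for d] by blast
qed

end

section \<open>Open normal subgroups of compact torsion groups\<close>

context compact_group
begin

definition open_normal :: "'a set \<Rightarrow> bool" where
  "open_normal U \<longleftrightarrow> openin T U \<and> subgroup U G \<and> (\<forall>g\<in>carrier G. \<forall>u\<in>U. inv g \<otimes> u \<otimes> g \<in> U)"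

lemma openin_subgroup:
  assumes U: "subgroup U G" and V: "openin T V" "\<one> \<in> V" "V \<subseteq> U"
  shows "openin T U"
proof (subst openin_subopen, intro ballI)
  fix u assume u: "u \<in> U"
  then have uG: "u \<in> carrier G" using subgroup.mem_carrier[OF U] by blast
  have "x \<in> U" if x: "x \<in> carrier G" "inv u \<otimes> x \<in> V" for x
  proof -
    have "u \<otimes> (inv u \<otimes> x) \<in> U" using subgroup.m_closed[OF U u] x V(3) by blast
    then show ?thesis using x uG by (simp add: m_assoc[symmetric])
  qed
  then have "{x \<in> carrier G. inv u \<otimes> x \<in> V} \<subseteq> U" by blast
  moreover have "openin T {x \<in> carrier G. inv u \<otimes> x \<in> V}"
    by (rule openin_left_translate[OF V(1) inv_closed[OF uG]])
  ultimately show "\<exists>W. openin T W \<and> u \<in> W \<and> W \<subseteq> U"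
    using uG V(2) by (intro exI[of _ "{x \<in> carrier G. inv u \<otimes> x \<in> V}"]) auto
qed

text \<open>Apply the invariant space to the intersection \<open>N\<close> of all open normal
  subgroups. The kernel of the action on \<open>W\<close> is open by the torsion argument and
  normal, so it contains \<open>N\<close>; then \<open>N\<close> acts trivially on \<open>W\<close>,
  which the choice of \<open>W\<close> rules out.\<close>

theorem torsion_imp_residually_finite:
  assumes torsion: "\<And>x. x \<in> carrier G \<Longrightarrow> \<exists>m>0. x [^] (m::nat) = \<one>"
    and n: "n \<in> carrier G" "n \<noteq> \<one>"
  obtains U where "open_normal U" "n \<notin> U"
proof (rule ccontr)
  assume "\<not> thesis"
  with that have nU: "n \<in> U" if "open_normal U" for U using that by blast
  define N where "N = {x \<in> carrier G. \<forall>U. open_normal U \<longrightarrow> x \<in> U}"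
  have NG: "N \<subseteq> carrier G" unfolding N_def by blast
  have Nn: "inv g \<otimes> m \<otimes> g \<in> N" if "g \<in> carrier G" "m \<in> N" for g m
    using that unfolding N_def open_normal_def by auto
  have nN: "n \<in> N" unfolding N_def using n(1) nU by blast
  show False
  proof (rule ex_finite_dimensional_invariant[OF NG Nn nN n(2)])
    fix W K
    assume W: "fun_subspace G T W"
      "\<And>w h. w \<in> W \<Longrightarrow> h \<in> carrier G \<Longrightarrow> (\<lambda>x. w (h \<otimes> x)) \<in> W"
      "\<And>w x. w \<in> W \<Longrightarrow> x \<in> carrier G \<Longrightarrow> norm (w x) \<le> K * sqrt (nrm2 w)"
      "\<exists>w\<in>W. \<exists>x\<in>carrier G. w x \<noteq> 0"
      "\<And>w x. w \<in> W \<Longrightarrow> (\<And>m x. m \<in> N \<Longrightarrow> x \<in> carrier G \<Longrightarrow> w (m \<otimes> x) = w x) \<Longrightarrow> x \<in> carrier G \<Longrightarrow> w x = 0"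
    interpret W: fun_subspace G T W by (rule W(1))
    have "\<exists>d e. orthonormal d e \<and> (\<forall>i<d. e i \<in> W) \<and>
        (\<forall>d' e'. orthonormal d' e' \<and> (\<forall>i<d'. e' i \<in> W) \<longrightarrow> d' \<le> d)"
      by (rule W.ex_maximal_orthonormal[OF W(3)])
    then obtain d e where e1: "orthonormal d e" and e2: "\<forall>i<d. e i \<in> W"
      and e3: "\<forall>d' e'. orthonormal d' e' \<and> (\<forall>i<d'. e' i \<in> W) \<longrightarrow> d' \<le> d"
      by (elim exE conjE)
    note e = e1 e2[rule_format] e3[rule_format, OF conjI]
    interpret B: invariant_basis G T W d e
    proof
      show "w x = (\<Sum>i<d. ip w (e i) * e i x)" if "w \<in> W" "x \<in> carrier G" for w x
      proof (rule W.orthonormal_maximal_basis[OF e(1,2) _ that])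
        show "\<exists>i<Suc d. e' i \<notin> W" if "orthonormal (Suc d) e'" for e'
          using e(3)[OF that] Suc_n_not_le_n[of d] by blast
      qed
    qed (fact W(2) e(1,2))+
    have "\<exists>V. openin T V \<and> \<one> \<in> V \<and> (\<forall>v\<in>V. \<forall>w\<in>W. \<forall>x\<in>carrier G. w (v \<otimes> x) = w x)"
      by (rule B.torsion_imp_locally_trivial[OF torsion])
    then obtain V where V: "openin T V" "\<one> \<in> V"
      and V3: "\<forall>v\<in>V. \<forall>w\<in>W. \<forall>x\<in>carrier G. w (v \<otimes> x) = w x"
      by (elim exE conjE)
    define triv where "triv h \<longleftrightarrow> (\<forall>w\<in>W. \<forall>x\<in>carrier G. w (h \<otimes> x) = w x)" for h
    have trivI: "triv h" if "\<And>w x. w \<in> W \<Longrightarrow> x \<in> carrier G \<Longrightarrow> w (h \<otimes> x) = w x" for h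
      unfolding triv_def by (intro ballI that)
    have trivD: "w (h \<otimes> x) = w x" if "triv h" "w \<in> W" "x \<in> carrier G" for h w x
      by (rule bspec[OF bspec[OF that(1)[unfolded triv_def] that(2)] that(3)])
    define U where "U = {h \<in> carrier G. triv h}"
    have UG: "h \<in> carrier G" if "h \<in> U" for h using that unfolding U_def by simp
    have Ut: "triv h" if "h \<in> U" for h using that unfolding U_def by simp
    have sub: "subgroup U G"
    proof
      show "U \<subseteq> carrier G" using UG by blast
      have "triv \<one>" by (rule trivI) simp
      then show "\<one> \<in> U" unfolding U_def by simp
      show "g \<otimes> h \<in> U" if g: "g \<in> U" and h: "h \<in> U" for g h
      proof -
        have "triv (g \<otimes> h)"
        proof (rule trivI)
          fix w x assume wx: "w \<in> W" "x \<in> carrier G"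
          have "w (g \<otimes> h \<otimes> x) = w (g \<otimes> (h \<otimes> x))" using UG[OF g] UG[OF h] wx(2) by (simp add: m_assoc)
          also have "\<dots> = w (h \<otimes> x)" by (rule trivD[OF Ut[OF g] wx(1)]) (use UG[OF h] wx(2) in simp)
          also have "\<dots> = w x" by (rule trivD[OF Ut[OF h] wx])
          finally show "w (g \<otimes> h \<otimes> x) = w x" .
        qed
        then show ?thesis unfolding U_def using UG[OF g] UG[OF h] by simp
      qed
      show "inv h \<in> U" if h: "h \<in> U" for h
      proof -
        have "triv (inv h)"
        proof (rule trivI)
          fix w x assume wx: "w \<in> W" "x \<in> carrier G"
          have "w (inv h \<otimes> x) = w (h \<otimes> (inv h \<otimes> x))"
            by (rule trivD[OF Ut[OF h] wx(1), symmetric]) (use UG[OF h] wx(2) in simp)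
          also have "h \<otimes> (inv h \<otimes> x) = x" using UG[OF h] wx(2) by (simp add: m_assoc[symmetric])
          finally show "w (inv h \<otimes> x) = w x" .
        qed
        then show ?thesis unfolding U_def using UG[OF h] by simp
      qed
    qed
    have "V \<subseteq> carrier G" using openin_subset[OF V(1)] topspace_eq_carrier by simp
    moreover have "triv v" if "v \<in> V" for v unfolding triv_def by (rule bspec[OF V3 that])
    ultimately have "V \<subseteq> U" unfolding U_def by blast
    then have "openin T U" by (rule openin_subgroup[OF sub V(1,2)])
    moreover have "inv g \<otimes> u \<otimes> g \<in> U" if g: "g \<in> carrier G" and u: "u \<in> U" for g u
    proof -
      have "triv (inv g \<otimes> u \<otimes> g)"
      proof (rule trivI)
        fix w x assume w: "w \<in> W" and x: "x \<in> carrier G"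
        have gx: "g \<otimes> x \<in> carrier G" using g x by simp
        have "w (inv g \<otimes> u \<otimes> g \<otimes> x) = w (inv g \<otimes> (u \<otimes> (g \<otimes> x)))"
          using g x UG[OF u] by (simp add: m_assoc)
        \<comment> \<open>The triviality of \<open>u\<close> is applied to the function
          \<open>\<lambda>y. w (inv g \<otimes> y)\<close>, which again lies in
          \<open>W\<close>.\<close>
        also have "\<dots> = w (inv g \<otimes> (g \<otimes> x))"
          by (rule trivD[OF Ut[OF u] W(2)[OF w inv_closed[OF g]] gx])
        also have "inv g \<otimes> (g \<otimes> x) = x" using g x by (simp add: m_assoc[symmetric])
        finally show "w (inv g \<otimes> u \<otimes> g \<otimes> x) = w x" .
      qed
      then show ?thesis unfolding U_def using g UG[OF u] by simp
    qed
    ultimately have "open_normal U" unfolding open_normal_def using sub by blast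
    then have NU: "N \<subseteq> U" unfolding N_def by blast
    obtain w x where w: "w \<in> W" "x \<in> carrier G" "w x \<noteq> 0" using W(4) by blast
    have "w x = 0"
    proof (rule W(5)[OF w(1) _ w(2)])
      show "w (m \<otimes> y) = w y" if "m \<in> N" "y \<in> carrier G" for m y
        by (rule trivD[OF Ut[OF subsetD[OF NU that(1)]] w(1) that(2)])
    qed
    with w(3) show False by simp
  qed
qed

end

section \<open>Residually finite compact groups\<close>

text \<open>The space is covered by \<open>U\<close> and the complements of finitely many members,
  and the smallest of these members already lies in \<open>U\<close>. Chains of closed cosets keep
  nonempty intersections for this reason, and a neighbourhood of the intersection is reached at some
  stage.\<close>

lemma compact_chain_subset_open:
  assumes X: "compact_space X" and C: "\<C> \<noteq> {}" "\<And>A. A \<in> \<C> \<Longrightarrow> closedin X A"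
    and chain: "\<And>A B. A \<in> \<C> \<Longrightarrow> B \<in> \<C> \<Longrightarrow> A \<subseteq> B \<or> B \<subseteq> A"
    and O: "openin X U" "\<Inter>\<C> \<subseteq> U"
  shows "\<exists>A\<in>\<C>. A \<subseteq> U"
proof -
  let ?F = "insert U ((\<lambda>A. topspace X - A) ` \<C>)"
  have "\<exists>\<F>. finite \<F> \<and> \<F> \<subseteq> ?F \<and> topspace X \<subseteq> \<Union>\<F>"
  proof (rule compactinD[OF X[unfolded compact_space_def]])
    show "openin X W" if "W \<in> ?F" for W using that O(1) C(2) by (auto intro: openin_diff)
    show "topspace X \<subseteq> \<Union>?F" using O(2) by blast
  qed
  then obtain \<F> where F: "finite \<F>" "\<F> \<subseteq> ?F" "topspace X \<subseteq> \<Union>\<F>" by (elim exE conjE)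
  have "finite (\<F> - {U})" "\<F> - {U} \<subseteq> (\<lambda>A. topspace X - A) ` \<C>" using F by auto
  from finite_subset_image[OF this] obtain \<A> where A: "\<A> \<subseteq> \<C>" "finite \<A>"
    "\<F> - {U} = (\<lambda>A. topspace X - A) ` \<A>" by (elim exE conjE)
  obtain A0 where A0: "A0 \<in> \<C>" using C(1) by blast
  have "\<exists>M\<in>\<C>. \<forall>A\<in>\<A>. M \<subseteq> A"
    using A(2,1)
  proof (induction \<A>)
    case empty
    then show ?case using A0 by blast
  next
    case (insert A \<A>)
    then obtain M where M: "M \<in> \<C>" "\<forall>A\<in>\<A>. M \<subseteq> A" by blast
    show ?case
    proof (cases "M \<subseteq> A")
      case True
      then show ?thesis using M by blast
    next
      case False
      then have "A \<subseteq> M" using chain[OF M(1), of A] insert.prems by blast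
      then show ?thesis using M insert.prems by (intro bexI[of _ A]) auto
    qed
  qed
  then obtain M where M: "M \<in> \<C>" "\<forall>A\<in>\<A>. M \<subseteq> A" by blast
  have "M \<subseteq> U"
  proof
    fix x assume x: "x \<in> M"
    then have "x \<in> topspace X" using closedin_subset[OF C(2)[OF M(1)]] by blast
    then obtain W where W: "W \<in> \<F>" "x \<in> W" using F(3) by blast
    show "x \<in> U"
    proof (rule ccontr)
      assume "x \<notin> U"
      then have "W \<in> \<F> - {U}" using W by blast
      then obtain A where "A \<in> \<A>" "W = topspace X - A" unfolding A(3) by blast
      then show False using W(2) x M(2) by blast
    qed
  qed
  then show ?thesis using M(1) by blast
qed

lemma countable_image_factor:
  assumes "countable (d ` A)" "\<And>u v. u \<in> A \<Longrightarrow> v \<in> A \<Longrightarrow> d u = d v \<Longrightarrow> f u = f v"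
  shows "countable (f ` A)"
proof -
  have "f ` A \<subseteq> (\<lambda>b. f (inv_into A d b)) ` (d ` A)"
  proof
    fix z assume "z \<in> f ` A"
    then obtain u where u: "u \<in> A" "z = f u" by blast
    then have du: "d u \<in> d ` A" by simp
    have "f (inv_into A d (d u)) = f u"
      by (rule assms(2)[OF inv_into_into[OF du] u(1) f_inv_into_f[OF du]])
    then show "z \<in> (\<lambda>b. f (inv_into A d b)) ` (d ` A)" unfolding u(2) by (rule image_eqI[OF sym du])
  qed
  then show ?thesis by (rule countable_subset[OF _ countable_image[OF assms(1)]])
qed

context group
begin

text \<open>Prepending a letter multiplies on the right, which is the direction in which the coset
  tables below act.\<close>

primrec word :: "(nat \<Rightarrow> 'a) \<Rightarrow> nat list \<Rightarrow> 'a" where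
  "word y [] = \<one>"
| "word y (i # l) = word y l \<otimes> y i"

lemma word_closed: "range y \<subseteq> carrier G \<Longrightarrow> word y l \<in> carrier G"
  by (induction l) auto

lemma word_append: "range y \<subseteq> carrier G \<Longrightarrow> word y (l @ l') = word y l' \<otimes> word y l"
  by (induction l) (auto simp: word_closed m_assoc range_subsetD)

lemma subgroup_words:
  assumes y: "range y \<subseteq> carrier G" and inv: "\<And>i. \<exists>j. inv (y i) = y j"
  shows "subgroup (range (word y)) G"
proof
  show "range (word y) \<subseteq> carrier G" using word_closed[OF y] by blast
  have mult: "a \<otimes> b \<in> range (word y)" if ab: "a \<in> range (word y)" "b \<in> range (word y)" for a b
  proof -
    obtain l l' where "a = word y l" "b = word y l'" using ab by blast
    then have "a \<otimes> b = word y (l' @ l)" using word_append[OF y] by simp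
    then show ?thesis by blast
  qed
  show "a \<otimes> b \<in> range (word y)" if "a \<in> range (word y)" "b \<in> range (word y)" for a b
    by (rule mult[OF that])
  have "word y [] = \<one>" by simp
  then show one: "\<one> \<in> range (word y)" by (metis rangeI)
  show "inv a \<in> range (word y)" if a: "a \<in> range (word y)" for a
  proof -
    obtain l where l: "a = word y l" using a by blast
    have "inv (word y l) \<in> range (word y)"
    proof (induction l)
      case Nil
      then show ?case using one by simp
    next
      case (Cons i l)
      obtain j where j: "inv (y i) = y j" using inv by blast
      have "y j \<in> carrier G" using y by blast
      then have "word y [j] = y j" by simp
      then have "y j \<in> range (word y)" by (metis rangeI)
      moreover have "inv (word y (i # l)) = y j \<otimes> inv (word y l)"
        using word_closed[OF y, of l] y j by (simp add: inv_mult_group range_subsetD)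
      ultimately show ?case using mult[OF _ Cons.IH] by simp
    qed
    then show ?thesis using l by simp
  qed
qed

end

context topological_group
begin

lemma closedin_open_subgroup:
  assumes U: "subgroup U G" "openin T U"
  shows "closedin T U"
  unfolding closedin_def topspace_eq_carrier
proof (intro conjI)
  interpret U: subgroup U G by (rule U(1))
  show "U \<subseteq> carrier G" by (rule U.subset)
  show "openin T (carrier G - U)"
  proof (subst openin_subopen, intro ballI)
    fix x assume x: "x \<in> carrier G - U"
    have disj: False if y: "y \<in> carrier G" "inv x \<otimes> y \<in> U" and yU: "y \<in> U" for y
    proof -
      have "y \<otimes> inv (inv x \<otimes> y) \<in> U" using U.m_closed[OF yU U.m_inv_closed[OF y(2)]] .
      moreover have "y \<otimes> inv (inv x \<otimes> y) = x" using x y(1) by (simp add: inv_mult_group m_assoc[symmetric])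
      ultimately show False using x by simp
    qed
    have "openin T {y \<in> carrier G. inv x \<otimes> y \<in> U}"
      using x by (intro openin_left_translate U(2)) simp
    moreover have "x \<in> {y \<in> carrier G. inv x \<otimes> y \<in> U}" using x by simp
    moreover have "{y \<in> carrier G. inv x \<otimes> y \<in> U} \<subseteq> carrier G - U" using disj by blast
    ultimately show "\<exists>W. openin T W \<and> x \<in> W \<and> W \<subseteq> carrier G - U"
      by (intro exI conjI)
  qed
qed

lemma closedin_left_translate:
  assumes "closedin T U" "a \<in> carrier G"
  shows "closedin T {x \<in> carrier G. a \<otimes> x \<in> U}"
  using closedin_continuous_map_preimage[OF continuous_map_translate(1)[OF continuous_map_id[unfolded
    id_def] assms(2,2)] assms(1)]
  by (simp add: topspace_eq_carrier)

lemma subgroup_closure_of: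
  assumes P: "subgroup P G"
  shows "subgroup (T closure_of P) G"
proof
  interpret P: subgroup P G by (rule P)
  have PT: "P \<subseteq> topspace T" using P.subset topspace_eq_carrier by simp
  show cl: "T closure_of P \<subseteq> carrier G"
    using closure_of_subset_topspace[of T P] topspace_eq_carrier by simp
  show "\<one> \<in> T closure_of P" using closure_of_subset[OF PT] P.one_closed by blast
  have id: "continuous_map T T (\<lambda>x. x)" using continuous_map_id unfolding id_def .
  have left: "p \<otimes> h \<in> T closure_of P" if p: "p \<in> P" and h: "h \<in> T closure_of P" for p h
  proof -
    have pG: "p \<in> carrier G" using p P.subset by blast
    have "(\<lambda>x. p \<otimes> x) ` (T closure_of P) \<subseteq> T closure_of ((\<lambda>x. p \<otimes> x) ` P)"
      by (rule continuous_map_image_closure_subset[OF continuous_map_translate(1)[OF id pG pG]])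
    also have "\<dots> \<subseteq> T closure_of P"
      by (rule closure_of_mono) (use p P.m_closed in auto)
    finally show ?thesis using h by blast
  qed
  show "g \<otimes> h \<in> T closure_of P" if g: "g \<in> T closure_of P" and h: "h \<in> T closure_of P" for g h
  proof -
    have hG: "h \<in> carrier G" using h cl by blast
    have "(\<lambda>x. x \<otimes> h) ` (T closure_of P) \<subseteq> T closure_of ((\<lambda>x. x \<otimes> h) ` P)"
      by (rule continuous_map_image_closure_subset[OF continuous_map_translate(2)[OF id hG hG]])
    also have "\<dots> \<subseteq> T closure_of (T closure_of P)"
      by (rule closure_of_mono) (use left[OF _ h] in auto)
    finally show ?thesis using g by (auto simp: closure_of_closure_of)
  qed
  show "inv h \<in> T closure_of P" if h: "h \<in> T closure_of P" for h
  proof -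
    have "(\<lambda>x. inv x) ` (T closure_of P) \<subseteq> T closure_of ((\<lambda>x. inv x) ` P)"
      by (rule continuous_map_image_closure_subset[OF continuous_inv])
    also have "\<dots> \<subseteq> T closure_of P"
      by (rule closure_of_mono) (use P.m_inv_closed in auto)
    finally show ?thesis using h by blast
  qed
qed

end

context compact_group
begin

lemma compact_group_closed_subgroup:
  assumes H: "subgroup H G" and cl: "closedin T H"
  shows "compact_group (G\<lparr>carrier := H\<rparr>) (subtopology T H)"
proof -
  interpret H: subgroup H G by (rule H)
  let ?G = "G\<lparr>carrier := H\<rparr>" and ?T = "subtopology T H"
  have grp: "group ?G" by (rule subgroup_imp_group[OF H])
  have id: "continuous_map ?T T (\<lambda>x. x)"
    using continuous_map_from_subtopology[OF continuous_map_id, of T H] unfolding id_def .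
  show ?thesis
    unfolding compact_group_def compact_group_axioms_def topological_group_def topological_group_axioms_def
  proof (intro conjI grp)
    show top: "topspace ?T = carrier ?G"
      using H.subset topspace_eq_carrier by (simp add: topspace_subtopology Int_absorb1)
    have "continuous_map (prod_topology ?T ?T) T (\<lambda>p. fst p)"
      "continuous_map (prod_topology ?T ?T) T (\<lambda>p. snd p)"
      using continuous_map_compose[OF continuous_map_fst id] continuous_map_compose[OF continuous_map_snd id]
      by (simp_all add: o_def)
    then have m: "continuous_map (prod_topology ?T ?T) T (\<lambda>p. fst p \<otimes> snd p)"
      by (rule continuous_map_mult)
    have tp: "topspace (prod_topology ?T ?T) = H \<times> H"
      unfolding topspace_prod_topology top by simp
    have "continuous_map (prod_topology ?T ?T) ?T (\<lambda>p. fst p \<otimes> snd p)"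
      unfolding continuous_map_in_subtopology
    proof (intro conjI m Pi_I)
      fix p assume "p \<in> topspace (prod_topology ?T ?T)"
      then have "fst p \<in> H" "snd p \<in> H" unfolding tp by (auto simp: mem_Times_iff)
      then show "fst p \<otimes> snd p \<in> H" by (rule H.m_closed)
    qed
    then show "continuous_map (prod_topology ?T ?T) ?T (\<lambda>(x, y). x \<otimes>\<^bsub>?G\<^esub> y)"
      by (simp add: case_prod_unfold)
    have "continuous_map ?T ?T (\<lambda>x. inv x)"
      unfolding continuous_map_in_subtopology using continuous_map_inverse[OF id] top by auto
    then show "continuous_map ?T ?T (\<lambda>x. inv\<^bsub>?G\<^esub> x)"
    proof (rule continuous_map_eq)
      show "inv x = inv\<^bsub>?G\<^esub> x" if "x \<in> topspace ?T" for x
        using that top m_inv_consistent[OF H, of x] by simp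
    qed
    show "compact_space ?T" by (rule compact_space_subtopology[OF closedin_compact_space[OF compact cl]])
    show "Hausdorff_space ?T" by (rule Hausdorff_space_subtopology[OF Hausdorff])
  qed
qed

lemma metric_compact_group_closed_subgroup:
  assumes "subgroup H G" "closedin T H" "second_countable (subtopology T H)"
  shows "metric_compact_group (G\<lparr>carrier := H\<rparr>) (subtopology T H)"
  unfolding metric_compact_group_def weight_le_natLeq_iff
  using compact_group_closed_subgroup assms by blast

end

section \<open>Sequences of cosets in residually finite compact groups\<close>

locale residually_finite_group = compact_group +
  assumes residual: "n \<in> carrier G \<Longrightarrow> n \<noteq> \<one> \<Longrightarrow> \<exists>U. compact_group.open_normal G T U \<and> n \<notin> U"
begin

lemma open_normalD:
  assumes "open_normal U"
  shows "openin T U" "subgroup U G" "closedin T U" "U \<subseteq> carrier G"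
    "g \<in> carrier G \<Longrightarrow> u \<in> U \<Longrightarrow> inv g \<otimes> u \<otimes> g \<in> U"
  using assms closedin_open_subgroup subgroup.subset unfolding open_normal_def by blast+

lemma open_normal_carrier: "open_normal (carrier G)"
  unfolding open_normal_def using subgroup_self openin_topspace[of T] topspace_eq_carrier by auto

lemma open_normal_Int: "open_normal U \<Longrightarrow> open_normal V \<Longrightarrow> open_normal (U \<inter> V)"
  unfolding open_normal_def by (auto intro: subgroups_Inter_pair)

text \<open>The complement of the neighbourhood is compact and covered by complements of open normal
  subgroups, which are open because open subgroups are closed; the intersection of finitely many of
  these subgroups remains inside.\<close>

lemma ex_open_normal_subset:
  assumes O: "openin T O'" "\<one> \<in> O'"
  shows "\<exists>U. open_normal U \<and> U \<subseteq> O'"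
proof -
  have "\<forall>n\<in>carrier G - O'. \<exists>U. open_normal U \<and> n \<notin> U" using residual O(2) by (metis DiffD1 DiffD2)
  then obtain U where U: "\<And>n. n \<in> carrier G - O' \<Longrightarrow> open_normal (U n)" "\<And>n. n \<in> carrier G - O' \<Longrightarrow> n \<notin> U n"
    by metis
  let ?F = "(\<lambda>n. carrier G - U n) ` (carrier G - O')"
  have K: "compactin T (carrier G - O')"
    using closedin_compact_space[OF compact] O(1) topspace_eq_carrier
    by (metis closedin_diff closedin_topspace)
  have "\<exists>\<F>. finite \<F> \<and> \<F> \<subseteq> ?F \<and> carrier G - O' \<subseteq> \<Union>\<F>"
  proof (rule compactinD[OF K])
    fix W assume "W \<in> ?F"
    then obtain n where n: "n \<in> carrier G - O'" "W = carrier G - U n" by blast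
    show "openin T W"
      unfolding n(2) using open_normalD(3)[OF U(1)[OF n(1)]] unfolding closedin_def topspace_eq_carrier
        by blast
  next
    show "carrier G - O' \<subseteq> \<Union>?F" using U(2) by blast
  qed
  then obtain \<F> where F: "finite \<F>" "\<F> \<subseteq> ?F" "carrier G - O' \<subseteq> \<Union>\<F>" by (elim exE conjE)
  from finite_subset_image[OF F(1,2)] obtain S where S: "S \<subseteq> carrier G - O'" "finite S"
    "\<F> = (\<lambda>n. carrier G - U n) ` S" by (elim exE conjE)
  have "\<exists>V. open_normal V \<and> (\<forall>n\<in>S. V \<subseteq> U n)"
    using S(2,1)
  proof (induction S)
    case empty
    then show ?case using open_normal_carrier by blast
  next
    case (insert n S)
    then obtain V where "open_normal V" "\<forall>n\<in>S. V \<subseteq> U n" by blast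
    then show ?case using open_normal_Int[OF U(1)[of n]] insert.prems by (intro exI[of _ "U n \<inter> V"]) auto
  qed
  then obtain V where V: "open_normal V" "\<forall>n\<in>S. V \<subseteq> U n" by blast
  have "V \<subseteq> O'"
  proof
    fix x assume x: "x \<in> V"
    show "x \<in> O'"
    proof (rule ccontr)
      assume "x \<notin> O'"
      then have "x \<in> \<Union>\<F>" using F(3) x open_normalD(4)[OF V(1)] by blast
      then show False unfolding S(3) using V(2) x by blast
    qed
  qed
  then show ?thesis using V(1) by blast
qed

text \<open>The identity is not isolated in an infinite compact group, since finitely many
  translates of any nonempty open set cover it; so \<open>U\<close> has a further element, which
  some open normal subgroup excludes.\<close>

lemma ex_smaller_open_normal:
  assumes inf: "infinite (carrier G)" and U: "open_normal U"
  shows "\<exists>V. open_normal V \<and> V \<subset> U"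
proof -
  have "\<exists>u\<in>U. u \<noteq> \<one>"
  proof (rule ccontr)
    assume "\<not> ?thesis"
    then have "U \<subseteq> {\<one>}" by blast
    moreover have "\<one> \<in> U" using subgroup.one_closed[OF open_normalD(2)[OF U]] .
    ultimately obtain S where S: "finite S" "S \<subseteq> carrier G" "\<And>x. x \<in> carrier G \<Longrightarrow> \<exists>a\<in>S. a \<otimes> x \<in> {\<one>}"
      using finite_translates_cover[OF open_normalD(1)[OF U]] by (metis subset_singletonD empty_iff)
    have "carrier G \<subseteq> (\<lambda>a. inv a) ` S"
    proof
      fix x assume x: "x \<in> carrier G"
      then obtain a where "a \<in> S" "a \<otimes> x = \<one>" using S(3) by blast
      then have "x = inv a" using S(2) x by (metis inv_equality inv_inv subsetD inv_closed)
      then show "x \<in> (\<lambda>a. inv a) ` S" using \<open>a \<in> S\<close> by blast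
    qed
    then show False using inf S(1) finite_subset by blast
  qed
  then obtain u where u: "u \<in> U" "u \<noteq> \<one>" by blast
  then obtain V where "open_normal V" "u \<notin> V" using residual[of u] open_normalD(4)[OF U] by blast
  then show ?thesis using open_normal_Int[OF U] u(1) by (intro exI[of _ "U \<inter> V"]) blast
qed

text \<open>A pair of a closed subgroup and a sequence of its left cosets is encoded as a single sequence
  of sets: the subgroup is \<open>f 0\<close>, its cosets are \<open>f (Suc n)\<close>. The cosets converge to the identity
  modulo \<open>f 0\<close>.\<close>

definition coset_sequence :: "(nat \<Rightarrow> 'a set) \<Rightarrow> (nat \<Rightarrow> 'a set) \<Rightarrow> bool" where
  "coset_sequence D f \<longleftrightarrow> subgroup (f 0) G \<and> closedin T (f 0) \<and>
    (\<forall>n. f (Suc n) \<noteq> {} \<and> f (Suc n) \<subseteq> D n \<inter> carrier G) \<and>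
    (\<forall>n. \<forall>x\<in>f (Suc n). \<forall>z\<in>carrier G. z \<in> f (Suc n) \<longleftrightarrow> inv x \<otimes> z \<in> f 0) \<and>
    (\<forall>U. open_normal U \<longrightarrow> (\<exists>k. \<forall>n\<ge>k. f (Suc n) \<inter> U \<noteq> {}))"

lemma coset_sequenceD:
  assumes "coset_sequence D f"
  shows "subgroup (f 0) G" "closedin T (f 0)" "f (Suc n) \<noteq> {}" "f (Suc n) \<subseteq> D n" "f (Suc n) \<subseteq> carrier G"
    "x \<in> f (Suc n) \<Longrightarrow> z \<in> carrier G \<Longrightarrow> z \<in> f (Suc n) \<longleftrightarrow> inv x \<otimes> z \<in> f 0"
    "open_normal U \<Longrightarrow> \<exists>k. \<forall>n\<ge>k. f (Suc n) \<inter> U \<noteq> {}"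
proof -
  show "subgroup (f 0) G" "closedin T (f 0)" "f (Suc n) \<noteq> {}" "f (Suc n) \<subseteq> D n" "f (Suc n) \<subseteq> carrier G"
    using assms unfolding coset_sequence_def by auto
  note c = assms[unfolded coset_sequence_def, THEN conjunct2, THEN conjunct2, THEN conjunct2]
  note 6 = c[THEN conjunct1] and 7 = c[THEN conjunct2]
  show "x \<in> f (Suc n) \<Longrightarrow> z \<in> carrier G \<Longrightarrow> z \<in> f (Suc n) \<longleftrightarrow> inv x \<otimes> z \<in> f 0"
    by (rule 6[rule_format])
  show "open_normal U \<Longrightarrow> \<exists>k. \<forall>n\<ge>k. f (Suc n) \<inter> U \<noteq> {}"
    by (rule mp[OF spec[OF 7]])
qed

lemma coset_sequence_closed:
  assumes f: "coset_sequence D f"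
  shows "closedin T (f n)"
proof (cases n)
  case 0
  then show ?thesis using coset_sequenceD(2)[OF f] by simp
next
  case (Suc m)
  obtain x where x: "x \<in> f (Suc m)" using coset_sequenceD(3)[OF f, of m] by blast
  then have xG: "x \<in> carrier G" using coset_sequenceD(5)[OF f, of m] by blast
  have "f (Suc m) = {z \<in> carrier G. inv x \<otimes> z \<in> f 0}"
    using coset_sequenceD(6)[OF f x] coset_sequenceD(5)[OF f, of m] by blast
  then show ?thesis
    unfolding Suc using closedin_left_translate[OF coset_sequenceD(2)[OF f], of "inv x"] xG by simp
qed

text \<open>Compactness keeps the intersected cosets nonempty. For convergence modulo the
  intersection \<open>?M\<close>, enlarge \<open>U\<close> to the open set \<open>W\<close> of
  elements that a right factor from \<open>?M\<close> moves into \<open>U\<close>; some member of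
  the chain has \<open>f 0 \<subseteq> W\<close>, and its index \<open>k\<close> works for the whole
  intersection.\<close>

lemma coset_sequence_Inter:
  assumes C: "\<C> \<noteq> {}" "\<And>f. f \<in> \<C> \<Longrightarrow> coset_sequence D f"
    and chain: "\<And>f g. f \<in> \<C> \<Longrightarrow> g \<in> \<C> \<Longrightarrow> (\<forall>n. f n \<subseteq> g n) \<or> (\<forall>n. g n \<subseteq> f n)"
  shows "coset_sequence D (\<lambda>n. \<Inter>f\<in>\<C>. f n)"
proof -
  obtain f0 where f0: "f0 \<in> \<C>" using C(1) by blast
  have sub: "\<exists>f\<in>\<C>. f n \<subseteq> W" if W: "openin T W" "(\<Inter>f\<in>\<C>. f n) \<subseteq> W" for n W
  proof -
    have "\<exists>A\<in>(\<lambda>f. f n) ` \<C>. A \<subseteq> W"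
    proof (rule compact_chain_subset_open[OF compact _ _ _ W])
      show "(\<lambda>f. f n) ` \<C> \<noteq> {}" using C(1) by blast
      show "closedin T A" if A: "A \<in> (\<lambda>f. f n) ` \<C>" for A
      proof -
        obtain f where "f \<in> \<C>" "A = f n" using A by blast
        then show ?thesis using coset_sequence_closed[OF C(2)] by simp
      qed
      show "A \<subseteq> B \<or> B \<subseteq> A" if AB: "A \<in> (\<lambda>f. f n) ` \<C>" "B \<in> (\<lambda>f. f n) ` \<C>" for A B
      proof -
        obtain f g where "f \<in> \<C>" "A = f n" "g \<in> \<C>" "B = g n" using AB by blast
        then show ?thesis using chain[of f g] by blast
      qed
    qed
    then show ?thesis by blast
  qed
  have ne: "(\<Inter>f\<in>\<C>. f (Suc n)) \<noteq> {}" for n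
  proof
    assume "(\<Inter>f\<in>\<C>. f (Suc n)) = {}"
    then obtain f where "f \<in> \<C>" "f (Suc n) \<subseteq> {}" using sub[of "{}" "Suc n"] by auto
    then show False using coset_sequenceD(3)[OF C(2)] by blast
  qed
  have cos: "z \<in> (\<Inter>f\<in>\<C>. f (Suc n)) \<longleftrightarrow> inv x \<otimes> z \<in> (\<Inter>f\<in>\<C>. f 0)"
    if x: "x \<in> (\<Inter>f\<in>\<C>. f (Suc n))" and z: "z \<in> carrier G" for n x z
  proof -
    have "z \<in> f (Suc n) \<longleftrightarrow> inv x \<otimes> z \<in> f 0" if "f \<in> \<C>" for f
      by (rule coset_sequenceD(6)[OF C(2)[OF that] _ z]) (use x that in blast)
    then show ?thesis by blast
  qed
  have sg: "subgroup (\<Inter>f\<in>\<C>. f 0) G"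
    by (rule subgroups_Inter) (use coset_sequenceD(1)[OF C(2)] C(1) in auto)
  have conv: "\<exists>k. \<forall>n\<ge>k. (\<Inter>f\<in>\<C>. f (Suc n)) \<inter> U \<noteq> {}" if U: "open_normal U" for U
  proof -
    let ?M = "\<Inter>f\<in>\<C>. f 0"
    interpret M: subgroup ?M G by (rule sg)
    interpret U: subgroup U G by (rule open_normalD(2)[OF U])
    define W where "W = {x \<in> carrier G. \<exists>m\<in>?M. x \<otimes> m \<in> U}"
    have "W = (\<Union>m\<in>?M. {x \<in> carrier G. x \<otimes> m \<in> U})" unfolding W_def by blast
    also have "openin T \<dots>"
    proof (rule openin_Union)
      fix S assume "S \<in> (\<lambda>m. {x \<in> carrier G. x \<otimes> m \<in> U}) ` ?M"
      then obtain m where m: "m \<in> ?M" "S = {x \<in> carrier G. x \<otimes> m \<in> U}" by (elim imageE)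
      show "openin T S"
        unfolding m(2) by (rule openin_right_translate[OF open_normalD(1)[OF U] M.mem_carrier[OF m(1)]])
    qed
    finally have "openin T W" .
    moreover have "?M \<subseteq> W"
    proof
      fix m assume m: "m \<in> ?M"
      have mG: "m \<in> carrier G" by (rule M.mem_carrier[OF m])
      have "m \<otimes> inv m \<in> U" using mG U.one_closed by simp
      then show "m \<in> W" unfolding W_def using mG M.m_inv_closed[OF m] by (intro CollectI conjI bexI)
    qed
    ultimately obtain f where f: "f \<in> \<C>" "f 0 \<subseteq> W" using sub[of W 0] by blast
    note fD = coset_sequenceD[OF C(2)[OF f(1)]]
    obtain k where k: "\<And>n. n \<ge> k \<Longrightarrow> f (Suc n) \<inter> U \<noteq> {}" using fD(7)[OF U] by blast
    have "(\<Inter>f\<in>\<C>. f (Suc n)) \<inter> U \<noteq> {}" if n: "n \<ge> k" for n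
    proof -
      obtain x where x: "x \<in> f (Suc n)" "x \<in> U" using k[OF n] by blast
      obtain z where z: "z \<in> (\<Inter>f\<in>\<C>. f (Suc n))" using ne by blast
      have zf: "z \<in> f (Suc n)" using z f(1) by blast
      have xG: "x \<in> carrier G" "z \<in> carrier G" using x zf fD(5)[of n] by auto
      have "inv x \<otimes> z \<in> f 0" using fD(6)[OF x(1) xG(2)] zf by blast
      \<comment> \<open>The representative \<open>z\<close> is corrected by \<open>m\<close>, which
        leaves its coset modulo \<open>?M\<close> unchanged and moves it into
        \<open>U\<close>.\<close>
      then obtain m where m: "m \<in> ?M" "(inv x \<otimes> z) \<otimes> m \<in> U" using f(2) unfolding W_def by blast
      have mG: "m \<in> carrier G" by (rule M.mem_carrier[OF m(1)])
      have "x \<otimes> ((inv x \<otimes> z) \<otimes> m) \<in> U" using U.m_closed[OF x(2) m(2)] .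
      moreover have "x \<otimes> ((inv x \<otimes> z) \<otimes> m) = z \<otimes> m" using xG mG by (simp add: m_assoc[symmetric])
      ultimately have zU: "z \<otimes> m \<in> U" by simp
      have zm: "z \<otimes> m \<in> carrier G" using xG mG by simp
      have "inv z \<otimes> (z \<otimes> m) = m" using xG mG by (simp add: m_assoc[symmetric])
      then have "z \<otimes> m \<in> (\<Inter>f\<in>\<C>. f (Suc n))" using cos[OF z zm] m(1) by simp
      then show ?thesis using zU by blast
    qed
    then show ?thesis by blast
  qed
  show ?thesis
    unfolding coset_sequence_def
  proof (intro conjI allI ballI impI sg ne cos conv)
    show "closedin T (\<Inter>f\<in>\<C>. f 0)"
      by (rule closedin_Inter) (use C(1) coset_sequence_closed[OF C(2)] in auto)
    show "(\<Inter>f\<in>\<C>. f (Suc n)) \<subseteq> D n \<inter> carrier G" for n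
      using coset_sequenceD(4,5)[OF C(2)[OF f0], of n] f0 by blast
  qed
qed

text \<open>If \<open>f 0\<close> contained some \<open>m\<close> other than the identity, an open
  normal \<open>U\<close> without \<open>m\<close> would cut it down to
  \<open>f 0 \<inter> U\<close>. Each coset of \<open>f 0\<close> then splits into finitely many,
  and one of them has to be chosen so that convergence survives.\<close>

lemma coset_sequence_minimal_trivial:
  assumes f: "coset_sequence D f"
    and min: "\<And>g. coset_sequence D g \<Longrightarrow> (\<And>n. g n \<subseteq> f n) \<Longrightarrow> g = f"
  shows "f 0 = {\<one>}"
proof (rule ccontr)
  assume ne: "f 0 \<noteq> {\<one>}"
  note fD = coset_sequenceD[OF f]
  interpret M: subgroup "f 0" G by (rule fD(1))
  obtain m where m: "m \<in> f 0" "m \<noteq> \<one>" using ne M.one_closed by blast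
  obtain U where U: "open_normal U" "m \<notin> U" using residual[OF M.mem_carrier[OF m(1)] m(2)] by blast
  interpret U: subgroup U G by (rule open_normalD(2)[OF U(1)])
  \<comment> \<open>The representative is taken in \<open>U\<close> whenever the coset meets
    \<open>U\<close>, which holds from some index on. A point of
    \<open>f (Suc n) \<inter> V \<inter> U\<close> then differs from it by an element of
    \<open>f 0 \<inter> U\<close> and so lies in the smaller coset.\<close>
  have "\<exists>x. x \<in> f (Suc n) \<and> (f (Suc n) \<inter> U \<noteq> {} \<longrightarrow> x \<in> U)" for n
    using fD(3)[of n] by blast
  then obtain x where x: "\<And>n. x n \<in> f (Suc n)" "\<And>n. f (Suc n) \<inter> U \<noteq> {} \<Longrightarrow> x n \<in> U" by metis
  have xG: "x n \<in> carrier G" for n using x(1)[of n] fD(5)[of n] by blast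
  define g where "g n = (case n of 0 \<Rightarrow> f 0 \<inter> U | Suc n \<Rightarrow> {z \<in> carrier G. inv (x n) \<otimes> z \<in> f 0 \<inter> U})" for n
  have g0: "g 0 = f 0 \<inter> U" and gS: "g (Suc n) = {z \<in> carrier G. inv (x n) \<otimes> z \<in> f 0 \<inter> U}" for n
    unfolding g_def by simp_all
  have sg: "subgroup (f 0 \<inter> U) G" by (rule subgroups_Inter_pair[OF fD(1) open_normalD(2)[OF U(1)]])
  interpret M': subgroup "f 0 \<inter> U" G by (rule sg)
  have gf: "g n \<subseteq> f n" for n
  proof (cases n)
    case 0
    then show ?thesis using g0 by simp
  next
    case (Suc k)
    show ?thesis
      unfolding Suc gS using fD(6)[OF x(1)[of k]] by blast
  qed
  have "coset_sequence D g"
    unfolding coset_sequence_def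
  proof (intro conjI allI ballI impI)
    show "subgroup (g 0) G" unfolding g0 by (rule sg)
    show "closedin T (g 0)" unfolding g0 by (intro closedin_Int fD(2) open_normalD(3) U(1))
    show "g (Suc n) \<noteq> {}" for n
    proof -
      have "x n \<in> g (Suc n)" unfolding gS using xG[of n] M'.one_closed by simp
      then show ?thesis by blast
    qed
    show "g (Suc n) \<subseteq> D n \<inter> carrier G" for n
      using gf[of "Suc n"] fD(4,5)[of n] by blast
    show "z \<in> g (Suc n) \<longleftrightarrow> inv y \<otimes> z \<in> g 0" if y: "y \<in> g (Suc n)" and z: "z \<in> carrier G" for n y z
    proof -
      have yG: "y \<in> carrier G" and yx: "inv (x n) \<otimes> y \<in> f 0 \<inter> U" using y unfolding gS by auto
      have 1: "inv y \<otimes> z = inv (inv (x n) \<otimes> y) \<otimes> (inv (x n) \<otimes> z)"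
        using yG z xG[of n] by (simp add: inv_mult_group m_assoc) (simp add: m_assoc[symmetric])
      have 2: "inv (x n) \<otimes> z = (inv (x n) \<otimes> y) \<otimes> (inv y \<otimes> z)"
        using yG z xG[of n] by (simp add: m_assoc) (simp add: m_assoc[symmetric])
      have "inv (x n) \<otimes> z \<in> f 0 \<inter> U \<longleftrightarrow> inv y \<otimes> z \<in> f 0 \<inter> U"
      proof
        assume "inv (x n) \<otimes> z \<in> f 0 \<inter> U"
        then show "inv y \<otimes> z \<in> f 0 \<inter> U" unfolding 1 by (rule M'.m_closed[OF M'.m_inv_closed[OF yx]])
      next
        assume "inv y \<otimes> z \<in> f 0 \<inter> U"
        then show "inv (x n) \<otimes> z \<in> f 0 \<inter> U" unfolding 2 by (rule M'.m_closed[OF yx])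
      qed
      then show ?thesis unfolding gS g0 using z by simp
    qed
    fix V assume V: "open_normal V"
    obtain k where k: "\<And>n. n \<ge> k \<Longrightarrow> f (Suc n) \<inter> (V \<inter> U) \<noteq> {}"
      using fD(7)[OF open_normal_Int[OF V U(1)]] by blast
    have "g (Suc n) \<inter> V \<noteq> {}" if n: "n \<ge> k" for n
    proof -
      obtain z where z: "z \<in> f (Suc n)" "z \<in> V" "z \<in> U" using k[OF n] by blast
      have zG: "z \<in> carrier G" using z(3) U.mem_carrier by blast
      have "x n \<in> U" by (rule x(2)) (use z in blast)
      then have "inv (x n) \<otimes> z \<in> U" using z(3) by simp
      moreover have "inv (x n) \<otimes> z \<in> f 0" using fD(6)[OF x(1) zG] z(1) by blast
      ultimately have "z \<in> g (Suc n)" unfolding gS using zG by simp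
      then show ?thesis using z(2) by blast
    qed
    then show "\<exists>k. \<forall>n\<ge>k. g (Suc n) \<inter> V \<noteq> {}" by blast
  qed
  then have "g = f" using gf by (rule min)
  then have "m \<in> f 0 \<inter> U" using m(1) g0 by simp
  then show False using U(2) by blast
qed

lemma ex_trivial_coset_sequence:
  assumes f: "coset_sequence D f"
  shows "\<exists>g. coset_sequence D g \<and> g 0 = {\<one>}"
proof -
  define A where "A = {g. coset_sequence D g}"
  \<comment> \<open>The order is reversed inclusion, so the maximal element given by Zorn's lemma is
    a minimal coset sequence.\<close>
  define P where "P g h \<longleftrightarrow> (\<forall>n. h n \<subseteq> g n)" for g h :: "nat \<Rightarrow> 'a set"
  have "\<exists>m\<in>A. \<forall>a\<in>A. P m a \<longrightarrow> a = m"
  proof (rule predicate_Zorn)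
    show "partial_order_on A (relation_of P A)"
      by (rule partial_order_on_relation_ofI) (auto simp: P_def fun_eq_iff)
    fix \<C> assume ch: "\<C> \<in> Chains (relation_of P A)"
    have CA: "\<C> \<subseteq> A" using ch unfolding Chains_def relation_of_def by auto
    show "\<exists>u\<in>A. \<forall>a\<in>\<C>. P a u"
    proof (cases "\<C> = {}")
      case True
      then show ?thesis using f unfolding A_def by blast
    next
      case False
      have "coset_sequence D (\<lambda>n. \<Inter>f\<in>\<C>. f n)"
      proof (rule coset_sequence_Inter[OF False])
        show "coset_sequence D g" if "g \<in> \<C>" for g using that CA unfolding A_def by blast
        show "(\<forall>n. g n \<subseteq> h n) \<or> (\<forall>n. h n \<subseteq> g n)" if "g \<in> \<C>" "h \<in> \<C>" for g h
          using ch that unfolding Chains_def relation_of_def P_def by blast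
      qed
      then show ?thesis unfolding A_def P_def by (intro bexI[of _ "\<lambda>n. \<Inter>f\<in>\<C>. f n"]) auto
    qed
  qed
  then obtain m where m: "coset_sequence D m" and mm: "\<forall>a\<in>A. P m a \<longrightarrow> a = m" unfolding A_def by blast
  have "m 0 = {\<one>}"
  proof (rule coset_sequence_minimal_trivial[OF m])
    show "g = m" if "coset_sequence D g" "\<And>n. g n \<subseteq> m n" for g
    proof -
      have "g \<in> A" unfolding A_def using that(1) by simp
      moreover have "P m g" unfolding P_def using that(2) by simp
      ultimately show ?thesis using mm by blast
    qed
  qed
  then show ?thesis using m by blast
qed

text \<open>Modulo the intersection \<open>N\<close> of a strictly decreasing sequence of open
  normal subgroups \<open>U n\<close>, any choice of \<open>y n\<close> in
  \<open>U n - U (Suc n)\<close> converges to the identity. The cosets of \<open>N\<close> through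
  the \<open>y n\<close> are the starting point; shrinking \<open>N\<close> to the trivial subgroup
  lifts the convergence to the group itself.\<close>

lemma ex_sequence_converging_to_one:
  assumes inf: "infinite (carrier G)"
  shows "\<exists>x :: nat \<Rightarrow> 'a. inj x \<and> range x \<subseteq> carrier G \<and> (\<forall>U. open_normal U \<longrightarrow> (\<exists>k. \<forall>n\<ge>k. x n \<in> U))"
proof -
  have "\<exists>U. \<forall>n. open_normal (U n) \<and> U (Suc n) \<subset> U n"
  proof (rule dependent_nat_choice)
    show "\<exists>U. open_normal U" using open_normal_carrier by blast
    show "\<exists>V. open_normal V \<and> V \<subset> U" if "open_normal U" for U n
      by (rule ex_smaller_open_normal[OF inf that])
  qed
  then obtain U where UU: "\<forall>n. open_normal (U n) \<and> U (Suc n) \<subset> U n" by (rule exE)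
  have U: "open_normal (U n)" "U (Suc n) \<subset> U n" for n using UU by simp_all
  have dec: "U n \<subseteq> U m" if "m \<le> n" for m n
    by (rule lift_Suc_antimono_le[OF _ that]) (use U(2) in \<open>simp add: less_imp_le\<close>)
  have "\<exists>y. y \<in> U n - U (Suc n)" for n using U(2)[of n] by blast
  then obtain y where y: "\<And>n. y n \<in> U n - U (Suc n)" by metis
  have yG: "y n \<in> carrier G" for n using y[of n] open_normalD(4)[OF U(1)] by blast
  define N where "N = (\<Inter>n. U n)"
  have sN: "subgroup N G"
    unfolding N_def by (rule subgroups_Inter) (use open_normalD(2)[OF U(1)] in auto)
  interpret N: subgroup N G by (rule sN)
  define f where "f n = (case n of 0 \<Rightarrow> N | Suc n \<Rightarrow> {z \<in> carrier G. inv (y n) \<otimes> z \<in> N})" for n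
  have f0: "f 0 = N" and fS: "f (Suc n) = {z \<in> carrier G. inv (y n) \<otimes> z \<in> N}" for n
    unfolding f_def by simp_all
  \<comment> \<open>Confining the \<open>n\<close>-th coset to \<open>U n - U (Suc n)\<close> keeps
    the cosets disjoint, so the points finally selected are distinct.\<close>
  have "coset_sequence (\<lambda>n. U n - U (Suc n)) f"
    unfolding coset_sequence_def
  proof (intro conjI allI ballI impI)
    show "subgroup (f 0) G" unfolding f0 by (rule sN)
    show "closedin T (f 0)"
      unfolding f0 N_def by (rule closedin_Inter) (use open_normalD(3)[OF U(1)] in auto)
    show "f (Suc n) \<noteq> {}" for n
    proof -
      have "y n \<in> f (Suc n)" unfolding fS using yG[of n] N.one_closed by simp
      then show ?thesis by blast
    qed
    show "f (Suc n) \<subseteq> (U n - U (Suc n)) \<inter> carrier G" for n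
    proof
      fix z assume "z \<in> f (Suc n)"
      then have zG: "z \<in> carrier G" and zN: "inv (y n) \<otimes> z \<in> N" unfolding fS by auto
      interpret Un: subgroup "U n" G by (rule open_normalD(2)[OF U(1)])
      interpret Us: subgroup "U (Suc n)" G by (rule open_normalD(2)[OF U(1)])
      have zn: "inv (y n) \<otimes> z \<in> U n" "inv (y n) \<otimes> z \<in> U (Suc n)" using zN unfolding N_def by blast+
      have eq: "y n \<otimes> (inv (y n) \<otimes> z) = z" using zG yG[of n] by (simp add: m_assoc[symmetric])
      have "y n \<otimes> (inv (y n) \<otimes> z) \<in> U n" using y[of n] by (intro Un.m_closed[OF _ zn(1)]) blast
      then have "z \<in> U n" unfolding eq .
      moreover have "z \<notin> U (Suc n)"
      proof
        assume z: "z \<in> U (Suc n)"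
        have "z \<otimes> inv (inv (y n) \<otimes> z) \<in> U (Suc n)" by (intro Us.m_closed Us.m_inv_closed z zn(2))
        moreover have "z \<otimes> inv (inv (y n) \<otimes> z) = y n"
          using zG yG[of n] by (simp add: inv_mult_group m_assoc[symmetric])
        ultimately show False using y[of n] by simp
      qed
      ultimately show "z \<in> (U n - U (Suc n)) \<inter> carrier G" using zG by simp
    qed
    show "z \<in> f (Suc n) \<longleftrightarrow> inv x \<otimes> z \<in> f 0" if x: "x \<in> f (Suc n)" and z: "z \<in> carrier G" for n x z
    proof -
      have xG: "x \<in> carrier G" and yx: "inv (y n) \<otimes> x \<in> N" using x unfolding fS by auto
      have 1: "inv x \<otimes> z = inv (inv (y n) \<otimes> x) \<otimes> (inv (y n) \<otimes> z)"
        using xG z yG[of n] by (simp add: inv_mult_group m_assoc) (simp add: m_assoc[symmetric])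
      have 2: "inv (y n) \<otimes> z = (inv (y n) \<otimes> x) \<otimes> (inv x \<otimes> z)"
        using xG z yG[of n] by (simp add: m_assoc) (simp add: m_assoc[symmetric])
      have "inv (y n) \<otimes> z \<in> N \<longleftrightarrow> inv x \<otimes> z \<in> N"
      proof
        assume "inv (y n) \<otimes> z \<in> N"
        then show "inv x \<otimes> z \<in> N" unfolding 1 by (rule N.m_closed[OF N.m_inv_closed[OF yx]])
      next
        assume "inv x \<otimes> z \<in> N"
        then show "inv (y n) \<otimes> z \<in> N" unfolding 2 by (rule N.m_closed[OF yx])
      qed
      then show ?thesis unfolding fS f0 using z by simp
    qed
    fix V assume V: "open_normal V"
    interpret V: subgroup V G by (rule open_normalD(2)[OF V])
    define W where "W = {x \<in> carrier G. \<exists>m\<in>N. x \<otimes> m \<in> V}"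
    have "W = (\<Union>m\<in>N. {x \<in> carrier G. x \<otimes> m \<in> V})" unfolding W_def by blast
    also have "openin T \<dots>"
    proof (rule openin_Union)
      fix S assume "S \<in> (\<lambda>m. {x \<in> carrier G. x \<otimes> m \<in> V}) ` N"
      then obtain m where m: "m \<in> N" "S = {x \<in> carrier G. x \<otimes> m \<in> V}" by (elim imageE)
      show "openin T S"
        unfolding m(2) by (rule openin_right_translate[OF open_normalD(1)[OF V] N.mem_carrier[OF m(1)]])
    qed
    finally have Wo: "openin T W" .
    have NW: "N \<subseteq> W"
    proof
      fix m assume m: "m \<in> N"
      have mG: "m \<in> carrier G" by (rule N.mem_carrier[OF m])
      have "m \<otimes> inv m \<in> V" using mG V.one_closed by simp
      then show "m \<in> W" unfolding W_def using mG N.m_inv_closed[OF m] by (intro CollectI conjI bexI)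
    qed
    have "\<exists>A\<in>range U. A \<subseteq> W"
    proof (rule compact_chain_subset_open[OF compact _ _ _ Wo])
      show "closedin T A" if "A \<in> range U" for A using that open_normalD(3)[OF U(1)] by auto
      show "A \<subseteq> B \<or> B \<subseteq> A" if "A \<in> range U" "B \<in> range U" for A B
      proof -
        obtain i j where "A = U i" "B = U j" using \<open>A \<in> range U\<close> \<open>B \<in> range U\<close> by blast
        then show ?thesis using dec[of i j] dec[of j i] nat_le_linear[of i j] by blast
      qed
      show "\<Inter>(range U) \<subseteq> W" using NW unfolding N_def .
    qed simp
    then obtain k where k: "U k \<subseteq> W" by blast
    have "f (Suc n) \<inter> V \<noteq> {}" if n: "n \<ge> k" for n
    proof -
      have "y n \<in> W" using y[of n] dec[OF n] k by blast
      then obtain m where m: "m \<in> N" "y n \<otimes> m \<in> V" unfolding W_def by blast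
      have mG: "m \<in> carrier G" by (rule N.mem_carrier[OF m(1)])
      have "inv (y n) \<otimes> (y n \<otimes> m) = m" using mG yG[of n] by (simp add: m_assoc[symmetric])
      then have "y n \<otimes> m \<in> f (Suc n)" unfolding fS using m(1) mG yG[of n] by simp
      then show ?thesis using m(2) by blast
    qed
    then show "\<exists>k. \<forall>n\<ge>k. f (Suc n) \<inter> V \<noteq> {}" by blast
  qed
  from ex_trivial_coset_sequence[OF this] obtain g where g: "coset_sequence (\<lambda>n. U n - U (Suc n)) g"
    "g 0 = {\<one>}"
    by blast
  note gD = coset_sequenceD[OF g(1)]
  have "\<exists>x. x \<in> g (Suc n)" for n using gD(3)[of n] by blast
  then obtain x where x: "\<And>n. x n \<in> g (Suc n)" by metis
  have xG: "x n \<in> carrier G" for n using x[of n] gD(5)[of n] by blast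
  have xU: "x n \<in> U n - U (Suc n)" for n using x[of n] gD(4)[of n] by blast
  have "x m \<noteq> x n" if "m < n" for m n
  proof -
    have "x n \<in> U (Suc m)" using xU[of n] dec[of "Suc m" n] that by auto
    then show ?thesis using xU[of m] by auto
  qed
  then have "inj x" by (rule linorder_injI)
  moreover have "\<exists>k. \<forall>n\<ge>k. x n \<in> V" if V: "open_normal V" for V
  proof -
    obtain k where k: "\<And>n. n \<ge> k \<Longrightarrow> g (Suc n) \<inter> V \<noteq> {}" using gD(7)[OF V] by blast
    have "x n \<in> V" if n: "n \<ge> k" for n
    proof -
      obtain z where z: "z \<in> g (Suc n)" "z \<in> V" using k[OF n] by blast
      have zG: "z \<in> carrier G" using z(1) gD(5)[of n] by blast
      have "inv (x n) \<otimes> z = \<one>" using gD(6)[OF x zG] z(1) g(2) by simp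
      moreover have "x n \<otimes> (inv (x n) \<otimes> z) = z" using zG xG[of n] by (simp add: m_assoc[symmetric])
      ultimately have "z = x n" using xG[of n] by simp
      then show ?thesis using z(2) by simp
    qed
    then show ?thesis by blast
  qed
  moreover have "range x \<subseteq> carrier G" using xG by blast
  ultimately show ?thesis by (intro exI[of _ x] conjI allI impI)
qed

text \<open>The trace of an open normal subgroup on the dense subgroup generated by the \<open>y i\<close> is encoded by
  a finite transversal together with a finite multiplication table.\<close>

definition coset_table :: "(nat \<Rightarrow> 'a) \<Rightarrow> 'a set \<Rightarrow> 'a set \<Rightarrow> 'a set \<Rightarrow> nat \<Rightarrow> ('a \<times> nat \<times> 'a) set \<Rightarrow> bool" where
  "coset_table y P U S k D \<longleftrightarrow> finite S \<and> S \<subseteq> P \<and> \<one> \<in> S \<and> S \<inter> U \<subseteq> {\<one>} \<and>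
    (\<forall>p\<in>P. \<exists>s\<in>S. inv s \<otimes> p \<in> U) \<and> (\<forall>i\<ge>k. y i \<in> U) \<and>
    D = {(s, i, t). s \<in> S \<and> i < k \<and> t \<in> S \<and> inv t \<otimes> (s \<otimes> y i) \<in> U}"

text \<open>By induction on the word, some \<open>s\<close> in the transversal represents it modulo
  \<open>U\<close> and modulo \<open>V\<close> at the same time: letters from \<open>k\<close> on
  lie in both groups, and for the others the table prescribes the next representative. For an
  element of \<open>U\<close> this \<open>s\<close> lies in \<open>S \<inter> U\<close>, so it is
  the identity, and the element lies in \<open>V\<close>.\<close>

lemma coset_table_determines:
  assumes y: "range y \<subseteq> carrier G" and P: "P = range (word y)" "subgroup P G"
    and U: "open_normal U" "open_normal V" and c: "coset_table y P U S k D" "coset_table y P V S k D"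
  shows "P \<inter> U \<subseteq> V"
proof
  interpret P: subgroup P G by (rule P(2))
  interpret U: subgroup U G by (rule open_normalD(2)[OF U(1)])
  interpret V: subgroup V G by (rule open_normalD(2)[OF U(2)])
  have S: "S \<subseteq> P" "\<one> \<in> S" using c(1) unfolding coset_table_def by simp_all
  have cov: "\<exists>s\<in>S. inv s \<otimes> p \<in> U" if "p \<in> P" for p
    using c(1) that unfolding coset_table_def by simp
  have SU: "S \<inter> U \<subseteq> {\<one>}" using c(1) unfolding coset_table_def by simp
  have yU: "y i \<in> U" "y i \<in> V" if "i \<ge> k" for i using c that unfolding coset_table_def by simp_all
  have DU: "D = {(s, i, t). s \<in> S \<and> i < k \<and> t \<in> S \<and> inv t \<otimes> (s \<otimes> y i) \<in> U}"
    using c(1) unfolding coset_table_def by (elim conjE)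
  have DV: "D = {(s, i, t). s \<in> S \<and> i < k \<and> t \<in> S \<and> inv t \<otimes> (s \<otimes> y i) \<in> V}"
    using c(2) unfolding coset_table_def by (elim conjE)
  have D: "inv t \<otimes> (s \<otimes> y i) \<in> V" if "s \<in> S" "t \<in> S" "i < k" "inv t \<otimes> (s \<otimes> y i) \<in> U" for s t i
  proof -
    have "(s, i, t) \<in> D" unfolding DU using that by simp
    then show ?thesis unfolding DV by simp
  qed
  have yG: "y i \<in> carrier G" for i using y by blast
  have yP: "y i \<in> P" for i
  proof -
    have "word y [i] = y i" using yG by simp
    then show ?thesis unfolding P(1) by (metis rangeI)
  qed
  have both: "\<exists>s\<in>S. inv s \<otimes> word y l \<in> U \<and> inv s \<otimes> word y l \<in> V" for l
  proof (induction l)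
    case Nil
    then show ?case using S(2) U.one_closed V.one_closed by (intro bexI[of _ \<one>]) auto
  next
    case (Cons i l)
    then obtain s where s: "s \<in> S" "inv s \<otimes> word y l \<in> U" "inv s \<otimes> word y l \<in> V" by blast
    let ?p = "word y l"
    have sP: "s \<in> P" using s(1) S(1) by blast
    have sG: "s \<in> carrier G" by (rule P.mem_carrier[OF sP])
    have pG: "?p \<in> carrier G" by (rule word_closed[OF y])
    show ?case
    proof (cases "i \<ge> k")
      case True
      have eq: "inv s \<otimes> word y (i # l) = (inv s \<otimes> ?p) \<otimes> y i"
        using sG pG yG[of i] by (simp add: m_assoc)
      have "inv s \<otimes> word y (i # l) \<in> U" unfolding eq by (rule U.m_closed[OF s(2) yU(1)[OF True]])
      moreover have "inv s \<otimes> word y (i # l) \<in> V" unfolding eq by (rule V.m_closed[OF s(3) yU(2)[OF True]])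
      ultimately show ?thesis using s(1) by (intro bexI conjI)
    next
      case False
      obtain t where t: "t \<in> S" "inv t \<otimes> (s \<otimes> y i) \<in> U" using cov[OF P.m_closed[OF sP yP[of i]]] by blast
      have tV: "inv t \<otimes> (s \<otimes> y i) \<in> V" using D[OF s(1) t(1) _ t(2)] False by simp
      have tG: "t \<in> carrier G" using t(1) S(1) P.mem_carrier by blast
      \<comment> \<open>Conjugating the error \<open>inv s \<otimes> ?p\<close> by
        \<open>y i\<close> keeps it in \<open>U\<close> and in \<open>V\<close>, as both are
        normal.\<close>
      have "(inv t \<otimes> (s \<otimes> y i)) \<otimes> (inv (y i) \<otimes> (inv s \<otimes> ?p) \<otimes> y i)
          = inv t \<otimes> (s \<otimes> ((y i \<otimes> inv (y i)) \<otimes> (inv s \<otimes> (?p \<otimes> y i))))"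
        using sG tG pG yG[of i] by (simp only: m_assoc m_closed inv_closed)
      also have "(y i \<otimes> inv (y i)) \<otimes> (inv s \<otimes> (?p \<otimes> y i)) = inv s \<otimes> (?p \<otimes> y i)"
        using sG pG yG[of i] by simp
      also have "s \<otimes> (inv s \<otimes> (?p \<otimes> y i)) = (s \<otimes> inv s) \<otimes> (?p \<otimes> y i)"
        using sG pG yG[of i] by (simp only: m_assoc m_closed inv_closed)
      also have "inv t \<otimes> \<dots> = inv t \<otimes> word y (i # l)"
        using sG tG pG yG[of i] by simp
      finally have eq: "inv t \<otimes> word y (i # l) = (inv t \<otimes> (s \<otimes> y i)) \<otimes> (inv (y i) \<otimes> (inv s \<otimes> ?p) \<otimes> y i)" ..
      have "inv t \<otimes> word y (i # l) \<in> U"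
        unfolding eq by (rule U.m_closed[OF t(2) open_normalD(5)[OF U(1) yG s(2)]])
      moreover have "inv t \<otimes> word y (i # l) \<in> V"
        unfolding eq by (rule V.m_closed[OF tV open_normalD(5)[OF U(2) yG s(3)]])
      ultimately show ?thesis using t(1) by (intro bexI conjI)
    qed
  qed
  fix p assume p: "p \<in> P \<inter> U"
  then obtain l where l: "p = word y l" unfolding P(1) by blast
  obtain s where s: "s \<in> S" "inv s \<otimes> p \<in> U" "inv s \<otimes> p \<in> V" using both[of l] unfolding l by blast
  have sG: "s \<in> carrier G" using s(1) S(1) P.mem_carrier by blast
  have pG: "p \<in> carrier G" using p P.mem_carrier by blast
  have "p \<otimes> inv (inv s \<otimes> p) \<in> U" using p U.m_closed[OF _ U.m_inv_closed[OF s(2)]] by blast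
  moreover have "p \<otimes> inv (inv s \<otimes> p) = s" using sG pG by (simp add: inv_mult_group m_assoc[symmetric])
  ultimately have "s \<in> U" by simp
  then have "s = \<one>" using SU s(1) by blast
  then show "p \<in> V" using s(3) pG by simp
qed

lemma ex_coset_table:
  assumes P: "subgroup P G" and U: "open_normal U" and k: "\<exists>k. \<forall>i\<ge>k. y i \<in> U"
  shows "\<exists>S k D. coset_table y P U S k D"
proof -
  interpret P: subgroup P G by (rule P)
  interpret U: subgroup U G by (rule open_normalD(2)[OF U])
  obtain k where k: "\<forall>i\<ge>k. y i \<in> U" using k by blast
  obtain A where A: "finite A" "A \<noteq> {}" "A \<subseteq> carrier G" "\<And>x. x \<in> carrier G \<Longrightarrow> \<exists>a\<in>A. a \<otimes> x \<in> U"
    by (rule finite_translates_cover[OF open_normalD(1)[OF U] U.one_closed]) blast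
  have "\<forall>a. \<exists>q. (\<exists>p\<in>P. a \<otimes> p \<in> U) \<longrightarrow> q \<in> P \<and> a \<otimes> q \<in> U" by blast
  from choice[OF this] obtain q where q: "\<forall>a. (\<exists>p\<in>P. a \<otimes> p \<in> U) \<longrightarrow> q a \<in> P \<and> a \<otimes> q a \<in> U" by (rule exE)
  \<comment> \<open>Representatives lying in \<open>U\<close> are replaced by the identity, so that
    \<open>S \<inter> U\<close> contains nothing else.\<close>
  define S where "S = insert \<one> ((q ` A \<inter> P) - U)"
  have "\<exists>s\<in>S. inv s \<otimes> p \<in> U" if p: "p \<in> P" for p
  proof -
    have pG: "p \<in> carrier G" by (rule P.mem_carrier[OF p])
    obtain a where a: "a \<in> A" "a \<otimes> p \<in> U" using A(4)[OF pG] by blast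
    have aG: "a \<in> carrier G" using a(1) A(3) by blast
    have qa: "q a \<in> P" "a \<otimes> q a \<in> U" using q a(2) p by blast+
    have qG: "q a \<in> carrier G" by (rule P.mem_carrier[OF qa(1)])
    have "inv (a \<otimes> q a) \<otimes> (a \<otimes> p) \<in> U" by (rule U.m_closed[OF U.m_inv_closed[OF qa(2)] a(2)])
    moreover have "inv (a \<otimes> q a) \<otimes> (a \<otimes> p) = inv (q a) \<otimes> ((inv a \<otimes> a) \<otimes> p)"
      using aG qG pG by (simp only: inv_mult_group m_assoc m_closed inv_closed)
    ultimately have qp: "inv (q a) \<otimes> p \<in> U" using aG pG by simp
    show ?thesis
    proof (cases "q a \<in> U")
      case True
      have "q a \<otimes> (inv (q a) \<otimes> p) \<in> U" by (rule U.m_closed[OF True qp])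
      then have "p \<in> U" using qG pG by (simp add: m_assoc[symmetric])
      then show ?thesis unfolding S_def using pG by (intro bexI[of _ \<one>]) simp_all
    next
      case False
      then have "q a \<in> S" unfolding S_def using a(1) qa(1) by blast
      then show ?thesis using qp by blast
    qed
  qed
  moreover have "finite S" "S \<subseteq> P" "\<one> \<in> S" "S \<inter> U \<subseteq> {\<one>}"
    unfolding S_def using A(1) P.one_closed by auto
  ultimately have "coset_table y P U S k {(s, i, t). s \<in> S \<and> i < k \<and> t \<in> S \<and> inv t \<otimes> (s \<otimes> y i) \<in> U}"
    unfolding coset_table_def using k by (intro conjI ballI) simp_all
  then show ?thesis by (intro exI)
qed

text \<open>A table consists of finite subsets of countable sets and a number, so only countably
  many occur; equal tables give equal traces.\<close>

lemma countable_traces: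
  assumes y: "range y \<subseteq> carrier G" and P: "P = range (word y)" "subgroup P G"
    and conv: "\<And>U. open_normal U \<Longrightarrow> \<exists>k. \<forall>i\<ge>k. y i \<in> U"
  shows "countable ((\<lambda>U. P \<inter> U) ` {U. open_normal U})"
proof -
  have cP: "countable P" unfolding P(1) by simp
  have "\<forall>U\<in>{U. open_normal U}. \<exists>d. case d of (S, k, D) \<Rightarrow> coset_table y P U S k D"
    using ex_coset_table[OF P(2) _ conv] by fastforce
  from bchoice[OF this] obtain d where
    d: "\<forall>U\<in>{U. open_normal U}. case d U of (S, k, D) \<Rightarrow> coset_table y P U S k D" by (rule exE)
  have "d ` {U. open_normal U} \<subseteq> {S. finite S \<and> S \<subseteq> P} \<times> UNIV \<times> {D. finite D \<and> D \<subseteq> P \<times> UNIV \<times> P}"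
  proof
    fix z assume "z \<in> d ` {U. open_normal U}"
    then obtain U where U: "open_normal U" "z = d U" by blast
    obtain S k D where dU: "d U = (S, k, D)" by (cases "d U") auto
    have c: "coset_table y P U S k D" using bspec[OF d, of U] U(1) dU by simp
    then have S: "finite S" "S \<subseteq> P" and D: "D \<subseteq> S \<times> {..<k} \<times> S"
      unfolding coset_table_def by auto
    have "finite D" by (rule finite_subset[OF D]) (use S(1) in simp)
    moreover have "D \<subseteq> P \<times> UNIV \<times> P" using D S(2) by blast
    ultimately show "z \<in> {S. finite S \<and> S \<subseteq> P} \<times> UNIV \<times> {D. finite D \<and> D \<subseteq> P \<times> UNIV \<times> P}"
      unfolding U(2) dU using S by simp
  qed
  moreover have "countable ({S. finite S \<and> S \<subseteq> P} \<times> (UNIV :: nat set) \<times> {D. finite D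
    \<and> D \<subseteq> P \<times> (UNIV :: nat set) \<times> P})"
    using cP by (intro countable_SIGMA countable_Collect_finite_subset) auto
  ultimately have "countable (d ` {U. open_normal U})" by (rule countable_subset)
  then show ?thesis
  proof (rule countable_image_factor)
    fix U V assume U: "U \<in> {U. open_normal U}" and V: "V \<in> {U. open_normal U}" and eq: "d U = d V"
    obtain S k D where dU: "d U = (S, k, D)" by (cases "d U") auto
    have cU: "coset_table y P U S k D" using bspec[OF d U] dU by simp
    have cV: "coset_table y P V S k D" using bspec[OF d V] dU unfolding eq by simp
    have "P \<inter> U \<subseteq> V" using coset_table_determines[OF y P _ _ cU cV] U V by simp
    moreover have "P \<inter> V \<subseteq> U" using coset_table_determines[OF y P _ _ cV cU] U V by simp
    ultimately show "P \<inter> U = P \<inter> V" by blast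
  qed
qed

text \<open>\<open>H\<close> is the closure of the countable group \<open>P\<close> generated by a
  sequence converging to the identity. As each \<open>U\<close> is open and closed,
  \<open>H \<inter> U\<close> is the closure of \<open>P \<inter> U\<close>, so the countably many
  traces leave only countably many sets \<open>H \<inter> U\<close>. Their translates by the dense
  subset \<open>P\<close> form a basis of \<open>H\<close>.\<close>

theorem ex_infinite_metric_subgroup:
  assumes inf: "infinite (carrier G)"
  shows "\<exists>H. subgroup H G \<and> closedin T H \<and> infinite H \<and> second_countable (subtopology T H)"
proof -
  have "\<exists>x :: nat \<Rightarrow> 'a. inj x \<and> range x \<subseteq> carrier G \<and> (\<forall>U. open_normal U \<longrightarrow> (\<exists>k. \<forall>n\<ge>k. x n \<in> U))"
    by (rule ex_sequence_converging_to_one[OF inf])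
  then obtain x :: "nat \<Rightarrow> 'a" where x: "inj x" "range x \<subseteq> carrier G"
    and conv: "\<forall>U. open_normal U \<longrightarrow> (\<exists>k. \<forall>n\<ge>k. x n \<in> U)" by (elim exE conjE)
  have xG: "x n \<in> carrier G" for n using x(2) by blast
  \<comment> \<open>Even indices list the sequence, odd ones its inverses; the family is closed
    under inversion and still converges to the identity.\<close>
  define y where "y i = (if even i then x (i div 2) else inv (x (i div 2)))" for i
  have y: "range y \<subseteq> carrier G" unfolding y_def using xG by auto
  have yinv: "\<exists>j. inv (y i) = y j" for i
  proof (cases "even i")
    case True
    then have "inv (y i) = y (Suc i)" unfolding y_def by simp
    then show ?thesis by blast
  next
    case False
    have "inv (y i) = x (i div 2)" using False unfolding y_def by (simp add: xG)
    moreover have "y (2 * (i div 2)) = x (i div 2)" unfolding y_def by simp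
    ultimately have "inv (y i) = y (2 * (i div 2))" by simp
    then show ?thesis by blast
  qed
  have yconv: "\<exists>k. \<forall>i\<ge>k. y i \<in> U" if U: "open_normal U" for U
  proof -
    interpret U: subgroup U G by (rule open_normalD(2)[OF U])
    obtain k where k: "\<forall>n\<ge>k. x n \<in> U" using conv U by blast
    have "y i \<in> U" if "i \<ge> 2 * k" for i
    proof -
      have "i div 2 \<ge> k" using that by simp
      then have "x (i div 2) \<in> U" using k by blast
      then show ?thesis unfolding y_def by simp
    qed
    then show ?thesis by blast
  qed
  define P where "P = range (word y)"
  have sP: "subgroup P G" unfolding P_def by (rule subgroup_words[OF y yinv])
  interpret P: subgroup P G by (rule sP)
  define H where "H = T closure_of P"
  have sH: "subgroup H G" unfolding H_def by (rule subgroup_closure_of[OF sP])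
  interpret H: subgroup H G by (rule sH)
  have PH: "P \<subseteq> H" unfolding H_def using P.subset topspace_eq_carrier by (intro closure_of_subset) simp
  have cH: "closedin T H" unfolding H_def by simp
  have "range x \<subseteq> P"
  proof
    fix z assume "z \<in> range x"
    then obtain n where "z = x n" by blast
    then have "z = word y [2 * n]" unfolding y_def using xG by simp
    then show "z \<in> P" unfolding P_def by blast
  qed
  then have "range x \<subseteq> H" using PH by blast
  then have infH: "infinite H" using range_inj_infinite[OF x(1)] finite_subset by blast
  have trace: "H \<inter> U = T closure_of (P \<inter> U)" if U: "open_normal U" for U
  proof
    show "T closure_of (P \<inter> U) \<subseteq> H \<inter> U"
      using closure_of_mono[of "P \<inter> U" P T] closure_of_minimal[of "P \<inter> U" U T] open_normalD(3)[OF U]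
      unfolding H_def by blast
    show "H \<inter> U \<subseteq> T closure_of (P \<inter> U)"
      unfolding H_def using openin_Int_closure_of_subset[OF open_normalD(1)[OF U], of P]
        by (simp add: Int_commute)
  qed
  define Q where "Q = (\<lambda>U. H \<inter> U) ` {U. open_normal U}"
  have "Q = (\<lambda>R. T closure_of R) ` ((\<lambda>U. P \<inter> U) ` {U. open_normal U})"
    unfolding Q_def image_image by (rule image_cong[OF refl]) (simp add: trace)
  then have cQ: "countable Q" using countable_traces[OF y P_def sP yconv] by simp
  define V where "V p R = {z \<in> H. inv p \<otimes> z \<in> R}" for p R
  define B where "B = (\<lambda>(p, R). V p R) ` (P \<times> Q)"
  have VU: "V p (H \<inter> U) = {z \<in> carrier G. inv p \<otimes> z \<in> U} \<inter> H" if p: "p \<in> P" for p U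
  proof -
    have pH: "p \<in> H" using p PH by blast
    have "inv p \<otimes> z \<in> H" if "z \<in> H" for z using H.m_closed[OF H.m_inv_closed[OF pH] that] .
    then show ?thesis unfolding V_def using H.subset by blast
  qed
  have "second_countable (subtopology T H)"
    unfolding second_countable_def
  proof (intro exI conjI ballI allI impI)
    have "countable P" unfolding P_def by simp
    then show "countable B" unfolding B_def using cQ by (intro countable_image countable_SIGMA) auto
    fix W assume "W \<in> B"
    then obtain r where r: "r \<in> P \<times> Q" "W = (\<lambda>(p, R). V p R) r" unfolding B_def by (elim imageE)
    then obtain p R where "p \<in> P" "R \<in> Q" "W = V p R" by (cases r) blast
    moreover then obtain U where "open_normal U" "R = H \<inter> U" unfolding Q_def by blast
    ultimately obtain U where W: "p \<in> P" "open_normal U" "W = V p (H \<inter> U)" by simp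
    have "openin T {z \<in> carrier G. inv p \<otimes> z \<in> U}"
      using W(1) P.mem_carrier by (intro openin_left_translate open_normalD(1) W(2)) simp
    then show "openin (subtopology T H) W"
      unfolding W(3) VU[OF W(1)] openin_subtopology by blast
  next
    fix O' h assume "openin (subtopology T H) O' \<and> h \<in> O'"
    then obtain O1 where O1: "openin T O1" "O' = O1 \<inter> H" "h \<in> O1" "h \<in> H" unfolding openin_subtopology
      by blast
    have hG: "h \<in> carrier G" by (rule H.mem_carrier[OF O1(4)])
    have "openin T {g \<in> carrier G. h \<otimes> g \<in> O1}" by (rule openin_left_translate[OF O1(1) hG])
    moreover have "\<one> \<in> {g \<in> carrier G. h \<otimes> g \<in> O1}" using O1(3) hG by simp
    ultimately have "\<exists>U. open_normal U \<and> U \<subseteq> {g \<in> carrier G. h \<otimes> g \<in> O1}"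
      by (rule ex_open_normal_subset)
    then obtain U where U: "open_normal U" "U \<subseteq> {g \<in> carrier G. h \<otimes> g \<in> O1}" by (elim exE conjE)
    interpret U: subgroup U G by (rule open_normalD(2)[OF U(1)])
    have "openin T {z \<in> carrier G. inv h \<otimes> z \<in> U}"
      using hG by (intro openin_left_translate open_normalD(1) U(1)) simp
    moreover have "h \<in> {z \<in> carrier G. inv h \<otimes> z \<in> U}" using hG U.one_closed by simp
    ultimately have "\<exists>p. p \<in> P \<and> p \<in> {z \<in> carrier G. inv h \<otimes> z \<in> U}"
      by (intro O1(4)[unfolded H_def in_closure_of, THEN conjunct2, THEN spec, THEN mp] conjI)
    then obtain p where p: "p \<in> P" "inv h \<otimes> p \<in> U" by blast
    have pG: "p \<in> carrier G" by (rule P.mem_carrier[OF p(1)])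
    have "inv (inv h \<otimes> p) \<in> U" by (rule U.m_inv_closed[OF p(2)])
    then have "inv p \<otimes> h \<in> U" using hG pG by (simp add: inv_mult_group)
    then have "h \<in> V p (H \<inter> U)" unfolding VU[OF p(1)] using hG O1(4) by simp
    moreover have "V p (H \<inter> U) \<subseteq> O'"
    proof
      fix z assume "z \<in> V p (H \<inter> U)"
      then have z: "z \<in> carrier G" "inv p \<otimes> z \<in> U" "z \<in> H" unfolding VU[OF p(1)] by auto
      have "(inv h \<otimes> p) \<otimes> (inv p \<otimes> z) \<in> U" by (rule U.m_closed[OF p(2) z(2)])
      moreover have "(inv h \<otimes> p) \<otimes> (inv p \<otimes> z) = inv h \<otimes> ((p \<otimes> inv p) \<otimes> z)"
        using hG pG z(1) by (simp only: m_assoc m_closed inv_closed)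
      ultimately have "inv h \<otimes> z \<in> U" using hG pG z(1) by simp
      then have "h \<otimes> (inv h \<otimes> z) \<in> O1" using U(2) by blast
      then show "z \<in> O'" unfolding O1(2) using hG z(1,3) by (simp add: m_assoc[symmetric])
    qed
    moreover have "V p (H \<inter> U) \<in> B"
    proof -
      have "H \<inter> U \<in> Q" unfolding Q_def using U(1) by blast
      then have "(p, H \<inter> U) \<in> P \<times> Q" using p(1) by simp
      then show ?thesis unfolding B_def by (rule rev_image_eqI) simp
    qed
    ultimately show "\<exists>V\<in>B. h \<in> V \<and> V \<subseteq> O'" by (intro bexI conjI)
  qed
  then show ?thesis using sH cH infH by (intro exI conjI)
qed

end

theorem (in compact_group) torsion_ex_infinite_metric_subgroup:
  assumes "infinite (carrier G)" "\<And>x. x \<in> carrier G \<Longrightarrow> \<exists>m>0. x [^] (m::nat) = \<one>"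
  shows "\<exists>H. subgroup H G \<and> closedin T H \<and> infinite H \<and> second_countable (subtopology T H)"
proof -
  interpret residually_finite_group G T
  proof
    fix n assume n: "n \<in> carrier G" "n \<noteq> \<one>"
    show "\<exists>U. open_normal U \<and> n \<notin> U"
      by (rule torsion_imp_residually_finite[OF assms(2) n]) blast+
  qed
  show ?thesis by (rule ex_infinite_metric_subgroup[OF assms(1)])
qed

section \<open>Abelian compact groups\<close>

context comm_group
begin

definition countably_many_cosets :: "'a set \<Rightarrow> 'a set \<Rightarrow> bool" where
  "countably_many_cosets C X \<longleftrightarrow> (\<exists>S. countable S \<and> S \<subseteq> carrier G \<and> (\<forall>a\<in>X. \<exists>s\<in>S. a \<otimes> inv s \<in> C))"

text \<open>Modulo \<open>C\<close>, the \<open>k\<close>-th power map sends \<open>X\<close> into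
  countably many classes, and two elements with the same image differ by an element whose
  \<open>k\<close>-th power lies in \<open>C\<close>. One element \<open>r s\<close> per class,
  together with representatives of the torsion classes, reaches every coset that meets
  \<open>X\<close>.\<close>

lemma countably_many_cosets_power:
  fixes k :: int
  assumes C: "subgroup C G" and X: "X \<subseteq> carrier G" "\<And>a. a \<in> X \<Longrightarrow> a [^] k \<in> Y"
    and Y: "countably_many_cosets C Y"
    and tors: "countably_many_cosets C {a \<in> carrier G. a [^] k \<in> C}"
  shows "countably_many_cosets C X"
proof -
  interpret C: subgroup C G by (rule C)
  obtain S where S: "countable S" "S \<subseteq> carrier G" "\<forall>a\<in>Y. \<exists>s\<in>S. a \<otimes> inv s \<in> C"
    using Y unfolding countably_many_cosets_def by (elim exE conjE)
  obtain R where R: "countable R" "R \<subseteq> carrier G" "\<forall>a\<in>{a \<in> carrier G. a [^] k \<in> C}. \<exists>s\<in>R. a \<otimes> inv s \<in> C"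
    using tors unfolding countably_many_cosets_def by (elim exE conjE)
  have "\<forall>s. \<exists>a. (\<exists>a\<in>X. a [^] k \<otimes> inv s \<in> C) \<longrightarrow> a \<in> X \<and> a [^] k \<otimes> inv s \<in> C" by blast
  from choice[OF this] obtain r where
    r: "\<forall>s. (\<exists>a\<in>X. a [^] k \<otimes> inv s \<in> C) \<longrightarrow> r s \<in> X \<and> r s [^] k \<otimes> inv s \<in> C" by (rule exE)
  let ?S = "(\<lambda>(s, t). r s \<otimes> t) ` (S \<times> R) \<inter> carrier G"
  have "\<exists>z\<in>?S. a \<otimes> inv z \<in> C" if a: "a \<in> X" for a
  proof -
    have aG: "a \<in> carrier G" using a X(1) by blast
    obtain s where s: "s \<in> S" "a [^] k \<otimes> inv s \<in> C" using S(3) X(2)[OF a] by blast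
    have sG: "s \<in> carrier G" using s(1) S(2) by blast
    have rs: "r s \<in> X" "r s [^] k \<otimes> inv s \<in> C" using r a s(2) by blast+
    have rG: "r s \<in> carrier G" using rs(1) X(1) by blast
    have rk: "r s [^] k \<in> carrier G" "a [^] k \<in> carrier G" using rG aG by simp_all
    have "(a \<otimes> inv (r s)) [^] k = a [^] k \<otimes> inv (r s [^] k)"
      using aG rG by (simp add: int_pow_distrib int_pow_inv)
    also have "\<dots> = (a [^] k \<otimes> inv s) \<otimes> inv (r s [^] k \<otimes> inv s)"
    proof -
      have "(a [^] k \<otimes> inv s) \<otimes> inv (r s [^] k \<otimes> inv s) = (a [^] k \<otimes> inv s) \<otimes> (inv (r s [^] k) \<otimes> s)"
        using rk sG by (simp add: inv_mult)
      also have "\<dots> = (a [^] k \<otimes> inv (r s [^] k)) \<otimes> (inv s \<otimes> s)"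
        using rk sG by (simp only: m_ac m_closed inv_closed)
      finally show ?thesis using rk sG by simp
    qed
    also have "\<dots> \<in> C" by (rule C.m_closed[OF s(2) C.m_inv_closed[OF rs(2)]])
    finally have "a \<otimes> inv (r s) \<in> {a \<in> carrier G. a [^] k \<in> C}" using aG rG by simp
    then obtain t where t: "t \<in> R" "(a \<otimes> inv (r s)) \<otimes> inv t \<in> C" using R(3) by blast
    have tG: "t \<in> carrier G" using t(1) R(2) by blast
    have "a \<otimes> inv (r s \<otimes> t) = (a \<otimes> inv (r s)) \<otimes> inv t"
      using aG rG tG by (simp add: inv_mult m_assoc)
    then have "a \<otimes> inv (r s \<otimes> t) \<in> C" using t(2) by simp
    moreover have "r s \<otimes> t \<in> ?S"
    proof
      have "(s, t) \<in> S \<times> R" using s(1) t(1) by simp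
      then show "r s \<otimes> t \<in> (\<lambda>(s, t). r s \<otimes> t) ` (S \<times> R)" by (rule rev_image_eqI) simp
      show "r s \<otimes> t \<in> carrier G" using rG tG by simp
    qed
    ultimately show ?thesis by (intro bexI)
  qed
  moreover have "countable ?S" using S(1) R(1) by (intro countable_Int1 countable_image countable_SIGMA) auto
  ultimately show ?thesis
    unfolding countably_many_cosets_def by (intro exI[of _ ?S] conjI ballI) simp_all
qed

lemma ex_countable_infinite_subgroup:
  assumes "infinite (carrier G)"
  shows "\<exists>B. subgroup B G \<and> countable B \<and> infinite B"
proof -
  obtain x :: "nat \<Rightarrow> 'a" where x: "inj x" "range x \<subseteq> carrier G"
    using infinite_countable_subset[OF assms] by blast
  have xG: "x n \<in> carrier G" for n using x(2) by blast
  define y where "y i = (if even i then x (i div 2) else inv (x (i div 2)))" for i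
  have y: "range y \<subseteq> carrier G" unfolding y_def using xG by auto
  have yinv: "\<exists>j. inv (y i) = y j" for i
  proof (cases "even i")
    case True
    then have "inv (y i) = y (Suc i)" unfolding y_def by simp
    then show ?thesis by blast
  next
    case False
    have "inv (y i) = x (i div 2)" using False unfolding y_def by (simp add: xG)
    moreover have "y (2 * (i div 2)) = x (i div 2)" unfolding y_def by simp
    ultimately have "inv (y i) = y (2 * (i div 2))" by simp
    then show ?thesis by blast
  qed
  have "range x \<subseteq> range (word y)"
  proof
    fix z assume "z \<in> range x"
    then obtain n where "z = x n" by blast
    then have "z = word y [2 * n]" unfolding y_def using xG by simp
    then show "z \<in> range (word y)" by blast
  qed
  then have "infinite (range (word y))" using range_inj_infinite[OF x(1)] finite_subset by blast
  moreover have "countable (range (word y))" by simp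
  ultimately show ?thesis using subgroup_words[OF y yinv] by (intro exI conjI)
qed

text \<open>If \<open>C\<close> is maximal among the subgroups meeting \<open>B\<close> trivially, then the quotient by \<open>C\<close> is an
  essential extension of the countable group \<open>B\<close>, hence countable.\<close>

theorem ex_countable_infinite_quotient:
  assumes inf: "infinite (carrier G)"
  shows "\<exists>C B. subgroup C G \<and> countably_many_cosets C (carrier G) \<and>
    B \<subseteq> carrier G \<and> infinite B \<and> (\<forall>a\<in>B. \<forall>b\<in>B. a \<otimes> inv b \<in> C \<longrightarrow> a = b)"
proof -
  obtain B where B: "subgroup B G" "countable B" "infinite B"
    using ex_countable_infinite_subgroup[OF inf] by (elim exE conjE)
  interpret B: subgroup B G by (rule B(1))
  define \<A> where "\<A> = {C. subgroup C G \<and> C \<inter> B = {\<one>}}"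
  have "\<exists>M\<in>\<A>. \<forall>X\<in>\<A>. M \<subseteq> X \<longrightarrow> X = M"
  proof (rule subset_Zorn_nonempty)
    have "{\<one>} \<in> \<A>" unfolding \<A>_def using triv_subgroup B.one_closed by blast
    then show "\<A> \<noteq> {}" by blast
    fix \<C> assume ne: "\<C> \<noteq> {}" and ch: "subset.chain \<A> \<C>"
    have CA: "subgroup C G" "C \<inter> B = {\<one>}" if "C \<in> \<C>" for C
      using ch that unfolding subset.chain_def \<A>_def by auto
    have lin: "C \<subseteq> D \<or> D \<subseteq> C" if "C \<in> \<C>" "D \<in> \<C>" for C D
      using ch that unfolding subset.chain_def by blast
    have "subgroup (\<Union>\<C>) G"
    proof
      show "\<Union>\<C> \<subseteq> carrier G" using subgroup.subset[OF CA(1)] by blast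
      show "\<one> \<in> \<Union>\<C>" using ne subgroup.one_closed[OF CA(1)] by blast
      show "inv x \<in> \<Union>\<C>" if x: "x \<in> \<Union>\<C>" for x
      proof -
        obtain C where C: "C \<in> \<C>" "x \<in> C" using x by blast
        show ?thesis by (rule UnionI[OF C(1) subgroup.m_inv_closed[OF CA(1)[OF C(1)] C(2)]])
      qed
      show "x \<otimes> y \<in> \<Union>\<C>" if xy: "x \<in> \<Union>\<C>" "y \<in> \<Union>\<C>" for x y
      proof -
        obtain C D where C: "C \<in> \<C>" "x \<in> C" and D: "D \<in> \<C>" "y \<in> D" using xy by blast
        obtain E where E: "E \<in> \<C>" "x \<in> E" "y \<in> E" using lin[OF C(1) D(1)] C D by blast
        show ?thesis by (rule UnionI[OF E(1) subgroup.m_closed[OF CA(1)[OF E(1)] E(2,3)]])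
      qed
    qed
    moreover have "\<Union>\<C> \<inter> B = {\<one>}" using CA(2) ne by blast
    ultimately show "\<Union>\<C> \<in> \<A>" unfolding \<A>_def by blast
  qed
  then obtain C where CA: "C \<in> \<A>" and max: "\<forall>X\<in>\<A>. C \<subseteq> X \<longrightarrow> X = C" by blast
  have C: "subgroup C G" "C \<inter> B = {\<one>}" using CA unfolding \<A>_def by auto
  interpret C: subgroup C G by (rule C(1))
  \<comment> \<open>By maximality of \<open>C\<close>, the subgroup generated by \<open>C\<close>
    and \<open>a\<close> meets \<open>B\<close> nontrivially.\<close>
  have ess: "\<exists>k c. c \<in> C \<and> a [^] (k::int) \<otimes> c \<in> B \<and> a [^] k \<otimes> c \<noteq> \<one>" if a: "a \<in> carrier G" "a \<notin> C" for a
  proof -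
    define X where "X = (\<lambda>(k::int, c). a [^] k \<otimes> c) ` (UNIV \<times> C)"
    have XI: "a [^] (k::int) \<otimes> c \<in> X" if "c \<in> C" for k c
      unfolding X_def by (rule image_eqI[of _ _ "(k, c)"]) (use that in simp_all)
    have XE: "\<exists>k c. c \<in> C \<and> x = a [^] (k::int) \<otimes> c" if "x \<in> X" for x
      using that unfolding X_def by auto
    have "subgroup X G"
    proof
      show "X \<subseteq> carrier G"
      proof
        fix x assume "x \<in> X"
        then obtain k c where "c \<in> C" "x = a [^] (k::int) \<otimes> c" using XE by blast
        then show "x \<in> carrier G" using a(1) by simp
      qed
      have "a [^] (0::int) \<otimes> \<one> \<in> X" by (rule XI[OF C.one_closed])
      then show "\<one> \<in> X" by simp
      show "x \<otimes> y \<in> X" if x: "x \<in> X" and y: "y \<in> X" for x y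
      proof -
        obtain k c where k: "c \<in> C" "x = a [^] (k::int) \<otimes> c" using XE[OF x] by blast
        obtain l d where l: "d \<in> C" "y = a [^] (l::int) \<otimes> d" using XE[OF y] by blast
        have cd: "c \<in> carrier G" "d \<in> carrier G" using k(1) l(1) by auto
        have ak: "a [^] k \<in> carrier G" "a [^] l \<in> carrier G" using a(1) by simp_all
        have "x \<otimes> y = a [^] (k + l) \<otimes> (c \<otimes> d)"
          unfolding k(2) l(2) int_pow_mult[OF a(1)] using cd ak by (simp add: m_ac)
        then show ?thesis using XI[OF C.m_closed[OF k(1) l(1)], of "k + l"] by simp
      qed
      show "inv x \<in> X" if x: "x \<in> X" for x
      proof -
        obtain k c where k: "c \<in> C" "x = a [^] (k::int) \<otimes> c" using XE[OF x] by blast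
        have "inv x = a [^] (- k) \<otimes> inv c"
          unfolding k(2) using k(1) a(1) by (simp add: inv_mult int_pow_neg)
        then show ?thesis using XI[OF C.m_inv_closed[OF k(1)], of "- k"] by simp
      qed
    qed
    moreover have CX: "C \<subseteq> X"
    proof
      fix c assume "c \<in> C"
      then show "c \<in> X" using XI[of c 0] by simp
    qed
    moreover have aX: "a \<in> X" using XI[OF C.one_closed, of 1] a(1) by simp
    ultimately have "X \<inter> B \<noteq> {\<one>}" using max a(2) unfolding \<A>_def by blast
    moreover have "\<one> \<in> X \<inter> B" using CX C.one_closed B.one_closed by blast
    ultimately obtain b where b: "b \<in> X" "b \<in> B" "b \<noteq> \<one>" by blast
    obtain k c where "c \<in> C" "b = a [^] (k::int) \<otimes> c" using XE[OF b(1)] by blast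
    then show ?thesis using b(2,3) by blast
  qed
  define BC where "BC = {z \<in> carrier G. \<exists>b\<in>B. z \<otimes> inv b \<in> C}"
  have cBC: "countably_many_cosets C BC"
    unfolding countably_many_cosets_def BC_def by (intro exI[of _ B] conjI B(2) B.subset) blast
  \<comment> \<open>An element \<open>a\<close> with \<open>p\<close>-th power in \<open>C\<close>
    comes from \<open>B\<close> modulo \<open>C\<close>: if \<open>a\<close> is outside
    \<open>C\<close> and \<open>a [^] k \<otimes> c\<close> is a nontrivial element of
    \<open>B\<close>, then \<open>p\<close> does not divide \<open>k\<close>, and Bezout recovers
    \<open>a\<close> from its \<open>k\<close>-th power modulo \<open>C\<close>.\<close>
  have prime: "countably_many_cosets C {a \<in> carrier G. a [^] (int p) \<in> C}" if p: "prime p" for p :: nat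
  proof -
    have "{a \<in> carrier G. a [^] (int p) \<in> C} \<subseteq> BC"
    proof
      fix a assume "a \<in> {a \<in> carrier G. a [^] (int p) \<in> C}"
      then have a: "a \<in> carrier G" "a [^] (int p) \<in> C" by auto
      show "a \<in> BC"
      proof (cases "a \<in> C")
        case True
        then have "a \<otimes> inv \<one> \<in> C" using a(1) by simp
        then show ?thesis unfolding BC_def using a(1) B.one_closed by blast
      next
        case False
        obtain k c where k: "c \<in> C" "a [^] (k::int) \<otimes> c \<in> B" "a [^] k \<otimes> c \<noteq> \<one>" using ess[OF a(1) False]
          by blast
        have cG: "c \<in> carrier G" using k(1) by simp
        have "\<not> int p dvd k"
        proof
          assume "int p dvd k"
          then obtain l where "k = int p * l" by (elim dvdE)
          then have "a [^] k = (a [^] int p) [^] l" using a(1) by (simp add: int_pow_pow)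
          then have "a [^] k \<in> C" using subgroup_int_pow_closed[OF C(1) a(2), of l] by simp
          then have "a [^] k \<otimes> c \<in> C \<inter> B" using C.m_closed[OF _ k(1)] k(2) by blast
          then show False using C(2) k(3) by blast
        qed
        moreover have "Factorial_Ring.prime (int p)" using p by simp
        ultimately have "coprime (int p) k" by (rule prime_imp_coprime[rotated])
        then obtain u v where uv: "u * int p + v * k = 1" using bezout_int[of "int p" k] by auto
        define b where "b = a [^] k \<otimes> c"
        have bB: "b \<in> B" using k(2) unfolding b_def .
        have bG: "b \<in> carrier G" using B.mem_carrier[OF bB] .
        have ak: "a [^] k = b \<otimes> inv c" unfolding b_def using a(1) cG by (simp add: m_assoc)
        have "a = a [^] (u * int p + v * k)" unfolding uv using a(1) by simp
        also have "\<dots> = (a [^] int p) [^] u \<otimes> (a [^] k) [^] v"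
          using a(1) by (simp add: int_pow_mult int_pow_pow mult.commute)
        also have "(a [^] k) [^] v = b [^] v \<otimes> (inv c) [^] v"
          unfolding ak using bG cG by (simp add: int_pow_distrib)
        finally have aeq: "a = (a [^] int p) [^] u \<otimes> (b [^] v \<otimes> (inv c) [^] v)" .
        have c1: "(a [^] int p) [^] u \<in> C" by (rule subgroup_int_pow_closed[OF C(1) a(2)])
        have c2: "(inv c) [^] v \<in> C" by (rule subgroup_int_pow_closed[OF C(1) C.m_inv_closed[OF k(1)]])
        have bv: "b [^] v \<in> B" by (rule subgroup_int_pow_closed[OF B(1) bB])
        have "a \<otimes> inv (b [^] v) = (a [^] int p) [^] u \<otimes> (inv c) [^] v"
        proof -
          have G: "(a [^] int p) [^] u \<in> carrier G" "(inv c) [^] v \<in> carrier G" "b [^] v \<in> carrier G"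
            using C.mem_carrier[OF c1] C.mem_carrier[OF c2] B.mem_carrier[OF bv] by auto
          have "a \<otimes> inv (b [^] v) = ((a [^] int p) [^] u \<otimes> (b [^] v \<otimes> (inv c) [^] v)) \<otimes> inv (b [^] v)"
            using aeq by simp
          also have "\<dots> = (a [^] int p) [^] u \<otimes> ((inv c) [^] v \<otimes> (b [^] v \<otimes> inv (b [^] v)))"
            using G by (simp only: m_ac m_closed inv_closed)
          finally show ?thesis using G by simp
        qed
        then have "a \<otimes> inv (b [^] v) \<in> C" using C.m_closed[OF c1 c2] by simp
        then show ?thesis unfolding BC_def using a(1) bv by blast
      qed
    qed
    then show ?thesis using cBC unfolding countably_many_cosets_def by (meson subsetD)
  qed
  \<comment> \<open>Taking \<open>p\<close>-th powers sends the elements killed by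
    \<open>n = p * m\<close> modulo \<open>C\<close> to those killed by \<open>m\<close>, so the
    torsion is handled one prime factor at a time.\<close>
  have pos: "countably_many_cosets C {a \<in> carrier G. a [^] (int n) \<in> C}" if "n > 0" for n :: nat
    using that
  proof (induction n rule: less_induct)
    case (less n)
    show ?case
    proof (cases "n = 1")
      case True
      have "\<forall>a\<in>{a \<in> carrier G. a [^] (int n) \<in> C}. \<exists>s\<in>{\<one>}. a \<otimes> inv s \<in> C"
      proof
        fix a assume "a \<in> {a \<in> carrier G. a [^] (int n) \<in> C}"
        then have aG: "a \<in> carrier G" and "a [^] (int n) \<in> C" by simp_all
        then have "a \<in> C" using True by simp
        then show "\<exists>s\<in>{\<one>}. a \<otimes> inv s \<in> C" using aG by simp
      qed
      moreover have "countable {\<one>}" "{\<one>} \<subseteq> carrier G" by simp_all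
      ultimately show ?thesis unfolding countably_many_cosets_def by (intro exI[of _ "{\<one>}"] conjI)
    next
      case False
      obtain p where p: "prime p" "p dvd n" using prime_factor_nat[OF False] by (elim exE conjE)
      from p(2) obtain m where m: "n = p * m" by (elim dvdE)
      have "p > 1" by (rule prime_gt_1_nat[OF p(1)])
      then have "m < n" "m > 0" using less.prems unfolding m by simp_all
      show ?thesis
      proof (rule countably_many_cosets_power[OF C(1) _ _ less.IH[OF \<open>m < n\<close> \<open>m > 0\<close>] prime[OF p(1)]])
        show "{a \<in> carrier G. a [^] (int n) \<in> C} \<subseteq> carrier G" by (rule Collect_restrict)
      next
        fix a assume "a \<in> {a \<in> carrier G. a [^] (int n) \<in> C}"
        then have a: "a \<in> carrier G" "a [^] (int n) \<in> C" by auto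
        have "(a [^] int p) [^] int m = a [^] int n" unfolding m using a(1) by (simp add: int_pow_pow)
        then show "a [^] int p \<in> {a \<in> carrier G. a [^] (int m) \<in> C}" using a by simp
      qed
    qed
  qed
  have tors: "countably_many_cosets C {a \<in> carrier G. a [^] k \<in> C}" if "k \<noteq> 0" for k :: int
  proof (cases "k > 0")
    case True
    then show ?thesis using pos[of "nat k"] by simp
  next
    case False
    have "{a \<in> carrier G. a [^] k \<in> C} = {a \<in> carrier G. a [^] (- k) \<in> C}"
    proof (rule Collect_cong, rule conj_cong[OF refl])
      fix a assume a: "a \<in> carrier G"
      have "a [^] k \<in> C \<Longrightarrow> a [^] (- k) \<in> C" using C.m_inv_closed a by (simp add: int_pow_neg)
      moreover have "a [^] (- k) \<in> C \<Longrightarrow> a [^] k \<in> C"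
        using C.m_inv_closed[of "a [^] (- k)"] a by (simp add: int_pow_neg)
      ultimately show "a [^] k \<in> C \<longleftrightarrow> a [^] (- k) \<in> C" by blast
    qed
    then show ?thesis using pos[of "nat (- k)"] False that by simp
  qed
  \<comment> \<open>Every \<open>a\<close> has a power with nonzero exponent in \<open>BC\<close>,
    so the group is the union of the \<open>X k\<close> over the countably many
    \<open>k \<noteq> 0\<close>.\<close>
  define X where "X k = {a \<in> carrier G. a [^] k \<in> BC}" for k :: int
  have cX: "countably_many_cosets C (X k)" if "k \<noteq> 0" for k
  proof (rule countably_many_cosets_power[OF C(1) _ _ cBC tors[OF that]])
    show "X k \<subseteq> carrier G" unfolding X_def by blast
    show "a [^] k \<in> BC" if "a \<in> X k" for a using that unfolding X_def by simp
  qed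
  have cover: "\<exists>k. k \<noteq> 0 \<and> a \<in> X k" if a: "a \<in> carrier G" for a
  proof (cases "a \<in> C")
    case True
    have "a [^] (1::int) \<otimes> inv \<one> \<in> C" using True a by simp
    then have "a [^] (1::int) \<in> BC" unfolding BC_def using a B.one_closed by blast
    then have "a \<in> X 1" unfolding X_def using a by simp
    then show ?thesis by (intro exI[of _ 1]) simp
  next
    case False
    obtain k c where k: "c \<in> C" "a [^] (k::int) \<otimes> c \<in> B" "a [^] k \<otimes> c \<noteq> \<one>" using ess[OF a False] by blast
    have cG: "c \<in> carrier G" using k(1) by simp
    have "k \<noteq> 0"
    proof
      assume "k = 0"
      then have "c \<in> C \<inter> B" "c \<noteq> \<one>" using k cG by auto
      then show False using C(2) by blast
    qed
    moreover have "a [^] k \<otimes> inv (a [^] k \<otimes> c) = inv c"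
      using a cG by (simp add: inv_mult m_assoc[symmetric])
    then have "a [^] k \<otimes> inv (a [^] k \<otimes> c) \<in> C" using C.m_inv_closed[OF k(1)] by simp
    then have "a [^] k \<in> BC" unfolding BC_def using a k(2) by blast
    then have "a \<in> X k" unfolding X_def using a by simp
    ultimately show ?thesis by blast
  qed
  define S where "S k = (SOME S. countable S \<and> S \<subseteq> carrier G \<and> (\<forall>a\<in>X k. \<exists>s\<in>S. a \<otimes> inv s \<in> C))" for k
  have S: "countable (S k) \<and> S k \<subseteq> carrier G \<and> (\<forall>a\<in>X k. \<exists>s\<in>S k. a \<otimes> inv s \<in> C)" if "k \<noteq> 0" for k
    unfolding S_def by (rule someI_ex) (rule cX[OF that, unfolded countably_many_cosets_def])
  have "countably_many_cosets C (carrier G)"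
    unfolding countably_many_cosets_def
  proof (intro exI conjI ballI)
    show "countable (\<Union>k\<in>{k. k \<noteq> 0}. S k)" by (rule countable_UN) (use S in auto)
    show "(\<Union>k\<in>{k. k \<noteq> 0}. S k) \<subseteq> carrier G"
    proof (rule UN_least)
      show "S k \<subseteq> carrier G" if "k \<in> {k. k \<noteq> 0}" for k using S[of k] that by simp
    qed
    fix a assume a: "a \<in> carrier G"
    obtain k where k: "k \<noteq> 0" "a \<in> X k" using cover[OF a] by blast
    have "\<forall>a\<in>X k. \<exists>s\<in>S k. a \<otimes> inv s \<in> C" using S[OF k(1)] by (elim conjE)
    from bspec[OF this k(2)] obtain s where "s \<in> S k" "a \<otimes> inv s \<in> C" by (rule bexE)
    then show "\<exists>s\<in>\<Union>k\<in>{k. k \<noteq> 0}. S k. a \<otimes> inv s \<in> C" using k(1) by blast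
  qed
  moreover have "a = b" if ab: "a \<in> B" "b \<in> B" "a \<otimes> inv b \<in> C" for a b
  proof -
    have "a \<otimes> inv b \<in> B" using B.m_closed[OF ab(1) B.m_inv_closed[OF ab(2)]] .
    then have "a \<otimes> inv b = \<one>" using C(2) ab(3) by blast
    moreover have "a \<in> carrier G" "b \<in> carrier G" using ab by auto
    ultimately show ?thesis using inv_equality[of a "inv b"] by simp
  qed
  then have "\<forall>a\<in>B. \<forall>b\<in>B. a \<otimes> inv b \<in> C \<longrightarrow> a = b" by (intro ballI impI)
  ultimately have "subgroup C G \<and> countably_many_cosets C (carrier G) \<and>
    B \<subseteq> carrier G \<and> infinite B \<and> (\<forall>a\<in>B. \<forall>b\<in>B. a \<otimes> inv b \<in> C \<longrightarrow> a = b)"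
    using C(1) B(3) B.subset by (intro conjI)
  then show ?thesis by (rule exI[where x = B, THEN exI[where x = C]])
qed

end

section \<open>Characters of compact abelian groups\<close>

locale abelian_compact_group = compact_group +
  assumes commute: "x \<in> carrier G \<Longrightarrow> y \<in> carrier G \<Longrightarrow> x \<otimes> y = y \<otimes> x"
begin

text \<open>Characters are normalized to be \<open>1\<close> outside the carrier, so that they form a group under
  pointwise multiplication.\<close>

definition characters :: "('a \<Rightarrow> complex) set" where
  "characters = {\<psi>. cont \<psi> \<and> (\<forall>x\<in>carrier G. \<forall>y\<in>carrier G. \<psi> (x \<otimes> y) = \<psi> x * \<psi> y) \<and>
    (\<forall>x\<in>carrier G. norm (\<psi> x) = 1) \<and> (\<forall>x. x \<notin> carrier G \<longrightarrow> \<psi> x = 1)}"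

lemma charactersD:
  assumes "\<psi> \<in> characters"
  shows "cont \<psi>" "x \<in> carrier G \<Longrightarrow> y \<in> carrier G \<Longrightarrow> \<psi> (x \<otimes> y) = \<psi> x * \<psi> y"
    "norm (\<psi> x) = 1" "x \<notin> carrier G \<Longrightarrow> \<psi> x = 1"
  using assms unfolding characters_def by (cases "x \<in> carrier G"; simp)+

lemma character_nonzero: "\<psi> \<in> characters \<Longrightarrow> \<psi> x \<noteq> 0"
  using charactersD(3)[of \<psi> x] by auto

lemma character_mult_cnj: "\<psi> \<in> characters \<Longrightarrow> \<psi> x * cnj (\<psi> x) = 1"
  using charactersD(3)[of \<psi> x] complex_norm_square[of "\<psi> x"] by simp

lemma character_one: "\<psi> \<in> characters \<Longrightarrow> \<psi> \<one> = 1"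
  using charactersD(2)[of \<psi> \<one> \<one>] character_nonzero[of \<psi> \<one>] by simp

lemma character_inv: "\<psi> \<in> characters \<Longrightarrow> x \<in> carrier G \<Longrightarrow> \<psi> (inv x) = cnj (\<psi> x)"
proof -
  assume c: "\<psi> \<in> characters" and x: "x \<in> carrier G"
  have "\<psi> x * \<psi> (inv x) = 1" using charactersD(2)[OF c x inv_closed[OF x]] character_one[OF c] x by simp
  then have "\<psi> x * \<psi> (inv x) = \<psi> x * cnj (\<psi> x)" using character_mult_cnj[OF c] by simp
  then show ?thesis using character_nonzero[OF c, of x] by simp
qed

definition char_group :: "('a \<Rightarrow> complex) monoid" where
  "char_group = \<lparr>carrier = characters, mult = (\<lambda>f g x. f x * g x), one = (\<lambda>x. 1)\<rparr>"

lemma characters_mult: "f \<in> characters \<Longrightarrow> g \<in> characters \<Longrightarrow> (\<lambda>x. f x * g x) \<in> characters"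
  unfolding characters_def by (auto simp: norm_mult intro: continuous_map_mult_algebra)

lemma characters_cnj: "f \<in> characters \<Longrightarrow> (\<lambda>x. cnj (f x)) \<in> characters"
  unfolding characters_def by (auto intro: continuous_map_cnj)

lemma characters_one: "(\<lambda>x. 1) \<in> characters"
  unfolding characters_def by simp

lemma comm_group_characters: "comm_group char_group"
proof (rule comm_groupI)
  fix f assume f: "f \<in> carrier char_group"
  then have "(\<lambda>x. cnj (f x)) \<in> characters" unfolding char_group_def by (simp add: characters_cnj)
  moreover have "(\<lambda>x. cnj (f x) * f x) = (\<lambda>x. 1)"
    using f character_mult_cnj[of f] unfolding char_group_def by (simp add: mult.commute)
  ultimately show "\<exists>g\<in>carrier char_group. g \<otimes>\<^bsub>char_group\<^esub> f = \<one>\<^bsub>char_group\<^esub>"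
    unfolding char_group_def by (intro bexI[of _ "\<lambda>x. cnj (f x)"]) simp_all
qed (auto simp: char_group_def characters_mult characters_one mult.assoc mult.commute)

lemma char_group_simps:
  "carrier char_group = characters" "f \<otimes>\<^bsub>char_group\<^esub> g = (\<lambda>x. f x * g x)" "\<one>\<^bsub>char_group\<^esub> = (\<lambda>x. 1)"
  unfolding char_group_def by simp_all

lemma char_group_inv:
  assumes f: "f \<in> characters"
  shows "inv\<^bsub>char_group\<^esub> f = (\<lambda>x. cnj (f x))"
proof -
  interpret A: comm_group char_group by (rule comm_group_characters)
  have "(\<lambda>x. cnj (f x)) \<otimes>\<^bsub>char_group\<^esub> f = \<one>\<^bsub>char_group\<^esub>"
    using character_mult_cnj[OF f] unfolding char_group_simps by (simp add: mult.commute)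
  from A.inv_equality[OF this] show ?thesis using f characters_cnj[OF f] unfolding char_group_simps by simp
qed

text \<open>For a subspace \<open>W\<close>, the number \<open>d\<close> is its dimension as a space
  of functions on the group.\<close>

definition max_orthonormal :: "('a \<Rightarrow> complex) set \<Rightarrow> nat \<Rightarrow> bool" where
  "max_orthonormal W d \<longleftrightarrow> (\<exists>e. orthonormal d e \<and> (\<forall>i<d. e i \<in> W)) \<and>
    (\<forall>d' e'. orthonormal d' e' \<and> (\<forall>i<d'. e' i \<in> W) \<longrightarrow> d' \<le> d)"

definition invariant_subspace :: "('a \<Rightarrow> complex) set \<Rightarrow> bool" where
  "invariant_subspace W \<longleftrightarrow> fun_subspace G T W \<and> (\<forall>w\<in>W. \<forall>h\<in>carrier G. (\<lambda>x. w (h \<otimes> x)) \<in> W) \<and>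
    (\<exists>w\<in>W. \<exists>x\<in>carrier G. w x \<noteq> 0)"

lemma invariant_subspaceD:
  assumes "invariant_subspace W"
  shows "fun_subspace G T W" "\<forall>w\<in>W. \<forall>h\<in>carrier G. (\<lambda>x. w (h \<otimes> x)) \<in> W"
    "\<exists>w\<in>W. \<exists>x\<in>carrier G. w x \<noteq> 0"
  by (fact assms[unfolded invariant_subspace_def, THEN conjunct1]
      assms[unfolded invariant_subspace_def, THEN conjunct2, THEN conjunct1]
      assms[unfolded invariant_subspace_def, THEN conjunct2, THEN conjunct2])+

lemma max_orthonormal_expand:
  assumes W: "fun_subspace G T W" and e: "orthonormal d e" "\<forall>i<d. e i \<in> W"
    and max: "max_orthonormal W d" and w: "w \<in> W" and x: "x \<in> carrier G"
  shows "w x = (\<Sum>i<d. ip w (e i) * e i x)"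
proof -
  interpret W: fun_subspace G T W by (rule W)
  show ?thesis
  proof (rule W.orthonormal_maximal_basis[OF e(1) _ _ w x])
    show "e i \<in> W" if "i < d" for i using e(2) that by simp
    show "\<exists>i<Suc d. e' i \<notin> W" if e': "orthonormal (Suc d) e'" for e'
    proof (rule ccontr)
      assume "\<not> ?thesis"
      then have "orthonormal (Suc d) e' \<and> (\<forall>i<Suc d. e' i \<in> W)" using e' by simp
      then have "Suc d \<le> d" using max unfolding max_orthonormal_def by blast
      then show False by simp
    qed
  qed
qed

lemma ex_eigenfunction:
  assumes W: "invariant_subspace W" and d: "max_orthonormal W d" and h: "h \<in> carrier G"
  shows "\<exists>\<mu> f. f \<in> W \<and> (\<exists>x\<in>carrier G. f x \<noteq> 0) \<and> (\<forall>x\<in>carrier G. f (h \<otimes> x) = \<mu> * f x)"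
proof -
  note fs = invariant_subspaceD(1)[OF W] and tr = invariant_subspaceD(2)[OF W]
    and nz = invariant_subspaceD(3)[OF W]
  obtain e where e: "orthonormal d e" "\<forall>i<d. e i \<in> W" using d unfolding max_orthonormal_def
    by (elim conjE exE)
  note exp = max_orthonormal_expand[OF fs e d]
  interpret W: fun_subspace G T W by (rule fs)
  interpret B: invariant_basis G T W d e
  proof
    show "(\<lambda>x. u (h \<otimes> x)) \<in> W" if "u \<in> W" "h \<in> carrier G" for u h
      by (rule bspec[OF bspec[OF tr that(1)] that(2)])
    show "orthonormal d e" by (rule e(1))
    show "e i \<in> W" if "i < d" for i using e(2) that by simp
    show "w x = (\<Sum>i<d. ip w (e i) * e i x)" if "w \<in> W" "x \<in> carrier G" for w x
      by (rule exp[OF that])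
  qed
  have d0: "d > 0"
  proof (rule ccontr)
    assume "\<not> d > 0"
    then have "d = 0" by simp
    obtain w x where "w \<in> W" "x \<in> carrier G" "w x \<noteq> 0" using nz by blast
    then show False using exp[of w x] \<open>d = 0\<close> by simp
  qed
  obtain \<mu> where "\<mu> \<in> spectrum (B.rep h)" using spectrum_non_empty[OF B.rep_carrier d0] by blast
  then obtain v where v: "eigenvector (B.rep h) v \<mu>"
    unfolding spectrum_def eigenvalue_def by blast
  have vc: "v \<in> carrier_vec d" "v \<noteq> 0\<^sub>v d" and ev: "B.rep h *\<^sub>v v = \<mu> \<cdot>\<^sub>v v"
    using v B.rep_carrier[of h] unfolding eigenvector_def by auto
  define c where "c i = vec_index v i" for i
  have evc: "(\<Sum>j<d. B.\<rho> i j h * c j) = \<mu> * c i" if i: "i < d" for i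
  proof -
    have "vec_index (B.rep h *\<^sub>v v) i = (\<Sum>j<d. B.\<rho> i j h * c j)"
      using i vc(1) B.rep_carrier[of h] unfolding c_def B.rep_def
      by (simp add: scalar_prod_def lessThan_atLeast0)
    moreover have "vec_index (\<mu> \<cdot>\<^sub>v v) i = \<mu> * c i" using i vc(1) unfolding c_def by simp
    ultimately show ?thesis unfolding ev by simp
  qed
  define f where "f = (\<lambda>x. \<Sum>j<d. c j * e j x)"
  have fW: "f \<in> W" unfolding f_def by (rule W.sum_E) (use e(2) in simp_all)
  have eig: "f (h \<otimes> x) = \<mu> * f x" if x: "x \<in> carrier G" for x
  proof -
    have "f (h \<otimes> x) = (\<Sum>j<d. c j * (\<Sum>i<d. B.\<rho> i j h * e i x))"
      unfolding f_def by (rule sum.cong) (use B.translate_expand[OF _ h x] in simp_all)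
    also have "\<dots> = (\<Sum>i<d. (\<Sum>j<d. B.\<rho> i j h * c j) * e i x)"
      unfolding sum_distrib_left sum_distrib_right by (subst sum.swap) (simp add: mult_ac)
    also have "\<dots> = (\<Sum>i<d. \<mu> * c i * e i x)" by (rule sum.cong) (use evc in simp_all)
    finally show ?thesis unfolding f_def by (simp add: sum_distrib_left mult.assoc)
  qed
  have "\<exists>x\<in>carrier G. f x \<noteq> 0"
  proof (rule ccontr)
    assume "\<not> ?thesis"
    then have f0: "f x = 0" if "x \<in> carrier G" for x using that by blast
    have "nrm2 (\<lambda>x. 0) = nrm2 f" by (rule nrm2_cong[OF W.cont_E[OF fW]]) (simp add: f0)
    then have "(\<Sum>j<d. (norm (c j))\<^sup>2) = 0"
      using orthonormal_nrm2_sum[OF e(1), of c] unfolding f_def nrm2_def ip_def by (simp add: mean_const)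
    then have "c j = 0" if "j < d" for j using that by (subst (asm) sum_nonneg_eq_0_iff) auto
    then have "v = 0\<^sub>v d" using vc(1) unfolding c_def by (intro eq_vecI) auto
    then show False using vc(2) by simp
  qed
  then show ?thesis using fW eig by blast
qed

text \<open>A nonzero invariant subspace of minimal dimension consists of simultaneous eigenfunctions of
  all translations, because eigenspaces of translations are invariant.\<close>

lemma ex_common_eigenfunction:
  assumes W: "invariant_subspace W"
    and K: "\<And>w x. w \<in> W \<Longrightarrow> x \<in> carrier G \<Longrightarrow> norm (w x) \<le> K * sqrt (nrm2 w)"
  shows "\<exists>w\<in>W. (\<exists>x\<in>carrier G. w x \<noteq> 0) \<and> (\<forall>h\<in>carrier G. \<exists>\<mu>. \<forall>x\<in>carrier G. w (h \<otimes> x) = \<mu> * w x)"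
proof -
  have ex_max: "\<exists>d. max_orthonormal X d" if X: "fun_subspace G T X" "X \<subseteq> W" for X
  proof -
    interpret X: fun_subspace G T X by (rule X(1))
    have "\<exists>d e. orthonormal d e \<and> (\<forall>i<d. e i \<in> X) \<and>
      (\<forall>d' e'. orthonormal d' e' \<and> (\<forall>i<d'. e' i \<in> X) \<longrightarrow> d' \<le> d)"
      by (rule X.ex_maximal_orthonormal[of K]) (rule K[OF subsetD[OF X(2)]])
    then show ?thesis unfolding max_orthonormal_def by (elim exE conjE, intro exI conjI)
  qed
  define P where "P d \<longleftrightarrow> (\<exists>X. invariant_subspace X \<and> X \<subseteq> W \<and> max_orthonormal X d)" for d
  have fsW: "fun_subspace G T W" using W unfolding invariant_subspace_def by simp
  obtain d0 where "max_orthonormal W d0" using ex_max[OF fsW order_refl] by blast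
  then have "P d0" unfolding P_def using W by blast
  then have PL: "P (LEAST d. P d)" by (rule LeastI)
  define d where "d = (LEAST d. P d)"
  have least: "d \<le> d'" if "P d'" for d' unfolding d_def by (rule Least_le[where P = P, OF that])
  obtain X where X: "invariant_subspace X" "X \<subseteq> W" "max_orthonormal X d" using PL unfolding d_def P_def
    by blast
  note fsX = invariant_subspaceD(1)[OF X(1)] and trX = invariant_subspaceD(2)[OF X(1)]
    and nzX = invariant_subspaceD(3)[OF X(1)]
  interpret X: fun_subspace G T X by (rule fsX)
  have scalar: "\<exists>\<mu>. \<forall>w\<in>X. \<forall>x\<in>carrier G. w (h \<otimes> x) = \<mu> * w x" if h: "h \<in> carrier G" for h
  proof -
    obtain \<mu> f where f: "f \<in> X" "\<exists>x\<in>carrier G. f x \<noteq> 0" "\<forall>x\<in>carrier G. f (h \<otimes> x) = \<mu> * f x"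
      using ex_eigenfunction[OF X(1,3) h] by (elim exE conjE)
    define Y where "Y = {w \<in> X. \<forall>x\<in>carrier G. w (h \<otimes> x) = \<mu> * w x}"
    have YX: "Y \<subseteq> X" unfolding Y_def by blast
    have fsY: "fun_subspace G T Y"
    proof unfold_locales
      show "cont u" if "u \<in> Y" for u using X.cont_E YX that by blast
      show "(\<lambda>x. 0) \<in> Y" unfolding Y_def using X.zero_E by simp
      show "(\<lambda>x. u x + v x) \<in> Y" if "u \<in> Y" "v \<in> Y" for u v
        using that X.add_E[of u v] unfolding Y_def by (simp add: distrib_left)
      show "(\<lambda>x. c * u x) \<in> Y" if "u \<in> Y" for c u
        using that X.cmult_E[of u c] unfolding Y_def by (simp add: mult.left_commute)
    qed
    have trY: "(\<lambda>x. w (g \<otimes> x)) \<in> Y" if w: "w \<in> Y" and g: "g \<in> carrier G" for w g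
    proof -
      have "(\<lambda>x. w (g \<otimes> x)) \<in> X" by (rule bspec[OF bspec[OF trX subsetD[OF YX w]] g])
      moreover have "w (g \<otimes> (h \<otimes> x)) = \<mu> * w (g \<otimes> x)" if x: "x \<in> carrier G" for x
      proof -
        have "g \<otimes> (h \<otimes> x) = h \<otimes> (g \<otimes> x)"
          using g h x commute[OF g h] by (simp add: m_assoc[symmetric])
        moreover have "w (h \<otimes> (g \<otimes> x)) = \<mu> * w (g \<otimes> x)"
          using w g x unfolding Y_def by simp
        ultimately show ?thesis by simp
      qed
      ultimately show ?thesis unfolding Y_def by simp
    qed
    have fY: "f \<in> Y" unfolding Y_def using f(1,3) by simp
    have "\<exists>w\<in>Y. \<exists>x\<in>carrier G. w x \<noteq> 0" by (rule bexI[where P = "\<lambda>w. \<exists>x\<in>carrier G. w x \<noteq> 0", OF f(2) fY])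
    then have invY: "invariant_subspace Y"
      unfolding invariant_subspace_def by (intro conjI ballI fsY trY)
    obtain d' where d': "max_orthonormal Y d'" using ex_max[OF fsY] YX X(2) by blast
    have "P d'" unfolding P_def using invY d' YX X(2) by blast
    \<comment> \<open>Minimality gives \<open>d \<le> d'\<close>, and an orthonormal system in
      \<open>Y\<close> is also one in \<open>X\<close>. Hence a basis of \<open>Y\<close> is a basis
      of \<open>X\<close>, and translation by \<open>h\<close> is the scalar \<mu> on all of
      \<open>X\<close>.\<close>
    then have le: "d \<le> d'" by (rule least)
    obtain e where e: "orthonormal d' e" "\<forall>i<d'. e i \<in> Y" using d' unfolding max_orthonormal_def
      by (elim conjE exE)
    have eX: "\<forall>i<d'. e i \<in> X" using e(2) YX by blast
    have "d' \<le> d" using X(3) e(1) eX unfolding max_orthonormal_def by blast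
    then have dd: "d' = d" using le by simp
    have "w (h \<otimes> x) = \<mu> * w x" if w: "w \<in> X" and x: "x \<in> carrier G" for w x
    proof -
      note exp = max_orthonormal_expand[OF fsX e(1)[unfolded dd] eX[unfolded dd] X(3) w]
      have "w (h \<otimes> x) = (\<Sum>i<d. ip w (e i) * e i (h \<otimes> x))" by (rule exp) (use h x in simp)
      also have "\<dots> = (\<Sum>i<d. ip w (e i) * (\<mu> * e i x))"
      proof (rule sum.cong[OF refl])
        fix i assume "i \<in> {..<d}"
        then have "e i \<in> Y" using e(2) unfolding dd by simp
        then show "ip w (e i) * e i (h \<otimes> x) = ip w (e i) * (\<mu> * e i x)" using x unfolding Y_def by simp
      qed
      also have "\<dots> = \<mu> * (\<Sum>i<d. ip w (e i) * e i x)" by (simp add: sum_distrib_left mult.left_commute)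
      also have "\<dots> = \<mu> * w x" using exp[OF x] by simp
      finally show ?thesis .
    qed
    then show ?thesis by (intro exI[of _ \<mu>] ballI)
  qed
  obtain w where w: "w \<in> X" "\<exists>x\<in>carrier G. w x \<noteq> 0" using nzX by blast
  have "\<exists>\<mu>. \<forall>x\<in>carrier G. w (h \<otimes> x) = \<mu> * w x" if h: "h \<in> carrier G" for h
  proof -
    obtain \<mu> where \<mu>: "\<forall>w\<in>X. \<forall>x\<in>carrier G. w (h \<otimes> x) = \<mu> * w x" using scalar[OF h] by (rule exE)
    show ?thesis by (rule exI[where x = \<mu>]) (rule bspec[OF \<mu> w(1)])
  qed
  then have "\<forall>h\<in>carrier G. \<exists>\<mu>. \<forall>x\<in>carrier G. w (h \<otimes> x) = \<mu> * w x" by (intro ballI)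
  then show ?thesis using w X(2) by (intro bexI[of _ w] conjI) auto
qed

text \<open>Evaluating at the identity gives \<open>\<mu> h = w h / w \<one>\<close>, from which
  continuity and multiplicativity follow. The modulus is 1 because translations preserve
  \<open>nrm2\<close>.\<close>

lemma eigenfunction_character:
  assumes w: "cont w" "x0 \<in> carrier G" "w x0 \<noteq> 0"
    and \<mu>: "\<And>h x. h \<in> carrier G \<Longrightarrow> x \<in> carrier G \<Longrightarrow> w (h \<otimes> x) = \<mu> h * w x"
  shows "(\<lambda>h. if h \<in> carrier G then \<mu> h else 1) \<in> characters"
proof -
  have wh: "w h = \<mu> h * w \<one>" if "h \<in> carrier G" for h using \<mu>[OF that one_closed] that by simp
  have w1: "w \<one> \<noteq> 0" using wh[OF w(2)] w(3) by auto
  have muw: "\<mu> h = w h * inverse (w \<one>)" if "h \<in> carrier G" for h using wh[OF that] w1 by simp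
  have "cont (\<lambda>h. inverse (w \<one>) * w h)" by (rule continuous_map_cmult[OF w(1)])
  then have c: "cont (\<lambda>h. if h \<in> carrier G then \<mu> h else 1)"
    by (rule continuous_map_eq) (simp add: topspace_eq_carrier muw mult.commute)
  have mult: "\<mu> (g \<otimes> h) = \<mu> g * \<mu> h" if gh: "g \<in> carrier G" "h \<in> carrier G" for g h
  proof -
    have "w (g \<otimes> h) = \<mu> g * w h" by (rule \<mu>[OF gh])
    then show ?thesis using muw[of "g \<otimes> h"] muw[OF gh(2)] gh by simp
  qed
  have norm: "norm (\<mu> h) = 1" if h: "h \<in> carrier G" for h
  proof -
    have cm: "cont (\<lambda>x. \<mu> h * w x)" by (rule continuous_map_cmult[OF w(1)])
    have "nrm2 (\<lambda>x. w (h \<otimes> x)) = nrm2 w" unfolding nrm2_def by (simp add: ip_translate[OF w(1) w(1) h])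
    moreover have "nrm2 (\<lambda>x. w (h \<otimes> x)) = nrm2 (\<lambda>x. \<mu> h * w x)"
      by (rule nrm2_cong[OF cm]) (rule \<mu>[OF h, symmetric])
    ultimately have "(norm (\<mu> h))\<^sup>2 * nrm2 w = nrm2 w" by (simp add: nrm2_cmult[OF w(1)])
    moreover have "nrm2 w \<noteq> 0" using nrm2_eq_0[OF w(1) _ w(2)] w(3) by blast
    ultimately have "(norm (\<mu> h))\<^sup>2 = 1" by simp
    then show ?thesis using power2_eq_iff_nonneg[of "norm (\<mu> h)" 1] by simp
  qed
  show ?thesis
    unfolding characters_def by (intro CollectI conjI ballI allI impI c) (simp_all add: mult norm)
qed

text \<open>Let \<open>N\<close> be the common kernel of all characters. The invariant space
  attached to a nontrivial \<open>N\<close> contains a common eigenfunction; its eigenvalues form a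
  character, which is trivial on \<open>N\<close>, so the eigenfunction is
  \<open>N\<close>-invariant and must vanish.\<close>

theorem characters_separate:
  assumes n: "n \<in> carrier G" "n \<noteq> \<one>"
  shows "\<exists>\<psi>\<in>characters. \<psi> n \<noteq> 1"
proof (rule ccontr)
  assume no: "\<not> ?thesis"
  define N where "N = {x \<in> carrier G. \<forall>\<psi>\<in>characters. \<psi> x = 1}"
  have NG: "N \<subseteq> carrier G" unfolding N_def by blast
  have nN: "n \<in> N" unfolding N_def using no n(1) by blast
  have Nn: "inv g \<otimes> m \<otimes> g \<in> N" if g: "g \<in> carrier G" and m: "m \<in> N" for g m
  proof -
    have mG: "m \<in> carrier G" using m NG by blast
    have "inv g \<otimes> m \<otimes> g = m" using g mG commute[of "inv g \<otimes> m" g] by (simp add: m_assoc[symmetric])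
    then show ?thesis using m by simp
  qed
  show False
  proof (rule ex_finite_dimensional_invariant[OF NG Nn nN n(2)])
    fix W K
    assume W: "fun_subspace G T W"
      "\<And>w h. w \<in> W \<Longrightarrow> h \<in> carrier G \<Longrightarrow> (\<lambda>x. w (h \<otimes> x)) \<in> W"
      "\<And>w x. w \<in> W \<Longrightarrow> x \<in> carrier G \<Longrightarrow> norm (w x) \<le> K * sqrt (nrm2 w)"
      "\<exists>w\<in>W. \<exists>x\<in>carrier G. w x \<noteq> 0"
      "\<And>w x. w \<in> W \<Longrightarrow> (\<And>m x. m \<in> N \<Longrightarrow> x \<in> carrier G \<Longrightarrow> w (m \<otimes> x) = w x) \<Longrightarrow> x \<in> carrier G \<Longrightarrow> w x = 0"
    have inv: "invariant_subspace W"
      unfolding invariant_subspace_def by (intro conjI ballI W(1,4)) (rule W(2))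
    have "\<exists>w\<in>W. (\<exists>x\<in>carrier G. w x \<noteq> 0) \<and> (\<forall>h\<in>carrier G. \<exists>\<mu>. \<forall>x\<in>carrier G. w (h \<otimes> x) = \<mu> * w x)"
      by (rule ex_common_eigenfunction[OF inv W(3)])
    then obtain w where w1: "w \<in> W" and w23: "(\<exists>x\<in>carrier G. w x \<noteq> 0) \<and>
      (\<forall>h\<in>carrier G. \<exists>\<mu>. \<forall>x\<in>carrier G. w (h \<otimes> x) = \<mu> * w x)" by (rule bexE)
    note w2 = conjunct1[OF w23] and ev = conjunct2[OF w23]
    note w = w1 w2
    obtain x0 where x0: "x0 \<in> carrier G" "w x0 \<noteq> 0" using w(2) by blast
    obtain \<mu> where mu0: "\<forall>h\<in>carrier G. \<forall>x\<in>carrier G. w (h \<otimes> x) = \<mu> h * w x"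
      using bchoice[OF ev] by (rule exE)
    have mu: "w (h \<otimes> x) = \<mu> h * w x" if "h \<in> carrier G" "x \<in> carrier G" for h x
      by (rule bspec[OF bspec[OF mu0 that(1)] that(2)])
    have cw: "cont w" by (rule fun_subspace.cont_E[OF W(1) w(1)])
    have chi: "(\<lambda>h. if h \<in> carrier G then \<mu> h else 1) \<in> characters"
      by (rule eigenfunction_character[OF cw x0 mu])
    have "w x0 = 0"
    proof (rule W(5)[OF w(1) _ x0(1)])
      fix m x assume m: "m \<in> N" and x: "x \<in> carrier G"
      have mG: "m \<in> carrier G" using m NG by blast
      have "\<forall>\<psi>\<in>characters. \<psi> m = 1" using m unfolding N_def by simp
      from bspec[OF this chi] have "\<mu> m = 1" using mG by simp
      then show "w (m \<otimes> x) = w x" using mu[OF mG x] by simp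
    qed
    then show False using x0(2) by simp
  qed
qed

end

text \<open>The functions in \<open>S\<close> combine to an injective continuous map into a
  countable power of the complex plane, and compactness makes it an embedding.\<close>

lemma second_countable_separating:
  fixes S :: "('a \<Rightarrow> complex) set"
  assumes X: "compact_space X" and S: "countable S" "\<And>s. s \<in> S \<Longrightarrow> continuous_map X euclidean s"
    and sep: "\<And>x y. x \<in> topspace X \<Longrightarrow> y \<in> topspace X \<Longrightarrow> x \<noteq> y \<Longrightarrow> \<exists>s\<in>S. s x \<noteq> s y"
  shows "second_countable X"
proof -
  \<comment> \<open>The zero function is added so that there is something to enumerate when
    \<open>S\<close> is empty.\<close>
  define F where "F n = from_nat_into (insert (\<lambda>x. 0) S) n" for n
  have rF: "range F = insert (\<lambda>x. 0) S"
    unfolding F_def using range_from_nat_into[of "insert (\<lambda>x. 0) S"] S(1) by simp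
  have cF: "continuous_map X euclidean (F n)" for n
  proof -
    have "F n \<in> insert (\<lambda>x. 0) S" using rF by blast
    then show ?thesis using S(2) by auto
  qed
  define e where "e x = (\<lambda>n. F n x)" for x
  have "continuous_map X (product_topology (\<lambda>n. euclidean) UNIV) e"
    unfolding continuous_map_componentwise_UNIV e_def using cF by simp
  then have ce: "continuous_map X euclidean e" unfolding euclidean_product_topology .
  have inj: "inj_on e (topspace X)"
  proof (rule inj_onI, rule ccontr)
    fix x y assume xy: "x \<in> topspace X" "y \<in> topspace X" "e x = e y" "x \<noteq> y"
    obtain s where s: "s \<in> S" "s x \<noteq> s y" using sep[OF xy(1,2,4)] by blast
    then obtain n where "s = F n" using rF by blast
    then show False using s(2) fun_cong[OF xy(3), of n] unfolding e_def by simp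
  qed
  have "closed_map X euclidean e"
    by (rule continuous_imp_closed_map[OF ce X Hausdorff_space_euclidean])
  then have "embedding_map X euclidean e"
    using inj ce by (simp add: injective_closed_imp_embedding_map)
  then have "X homeomorphic_space subtopology euclidean (e ` topspace X)"
    by (rule embedding_map_imp_homeomorphic_space)
  moreover have "second_countable (euclidean :: (nat \<Rightarrow> complex) topology)"
  proof -
    obtain \<B> :: "(nat \<Rightarrow> complex) set set"
      where B: "countable \<B>" "\<And>C. C \<in> \<B> \<Longrightarrow> open C" "\<And>S. open S \<Longrightarrow> \<exists>U. U \<subseteq> \<B> \<and> S = \<Union>U"
      using univ_second_countable[where 'a = "nat \<Rightarrow> complex"] by (metis (no_types))
    have "\<exists>V\<in>\<B>. x \<in> V \<and> V \<subseteq> S" if S: "open S" and x: "x \<in> S" for S x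
    proof -
      obtain U where "U \<subseteq> \<B>" "S = \<Union>U" using B(3)[OF S] by (elim exE conjE)
      then show ?thesis using x by blast
    qed
    then show ?thesis unfolding second_countable_def using B(1,2)
      by (intro exI[of _ \<B>] conjI ballI allI impI) auto
  qed
  then have "second_countable (subtopology (euclidean :: (nat \<Rightarrow> complex) topology) (e ` topspace X))"
    by (rule second_countable_subtopology)
  ultimately show ?thesis using homeomorphic_space_second_countability by blast
qed

section \<open>Annihilators of subgroups of characters\<close>

context abelian_compact_group
begin

lemma mean_character:
  assumes c: "\<psi> \<in> characters" and ne: "\<psi> \<noteq> (\<lambda>x. 1)"
  shows "mean \<psi> = 0"
proof -
  obtain h where h: "\<psi> h \<noteq> 1" using ne by auto
  then have hG: "h \<in> carrier G" using charactersD(4)[OF c] by blast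
  note cc = charactersD(1)[OF c]
  have "mean \<psi> = mean (\<lambda>x. \<psi> (h \<otimes> x))" by (rule mean_translate[OF cc hG, symmetric])
  also have "\<dots> = mean (\<lambda>x. \<psi> h * \<psi> x)"
    by (rule mean_cong[OF continuous_map_cmult[OF cc]]) (simp add: charactersD(2)[OF c hG])
  also have "\<dots> = \<psi> h * mean \<psi>" by (rule mean_cmult[OF cc])
  finally have "(1 - \<psi> h) * mean \<psi> = 0" by (simp add: left_diff_distrib)
  then show ?thesis using h by simp
qed

text \<open>The product of the factors \<open>(1 + Re c) / 2\<close> over finitely many \<open>c \<in> C\<close> peaks on the common
  kernel of \<open>C\<close>, and its powers are orthogonal to every character outside \<open>C\<close>.\<close>

theorem annihilator_of_common_kernel:
  assumes C: "subgroup C char_group" and a: "a \<in> characters"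
    and ker: "\<And>x. x \<in> carrier G \<Longrightarrow> (\<And>c. c \<in> C \<Longrightarrow> c x = 1) \<Longrightarrow> a x = 1"
  shows "a \<in> C"
proof (rule ccontr)
  assume aC: "a \<notin> C"
  interpret C: subgroup C char_group by (rule C)
  have CC: "c \<in> characters" if "c \<in> C" for c using C.mem_carrier[OF that] unfolding char_group_simps .
  have Cmult: "(\<lambda>x. c x * d x) \<in> C" if "c \<in> C" "d \<in> C" for c d
    using C.m_closed[OF that] unfolding char_group_simps .
  have Ccnj: "(\<lambda>x. cnj (c x)) \<in> C" if "c \<in> C" for c
    using C.m_inv_closed[OF that] unfolding char_group_inv[OF CC[OF that]] .
  have C1: "(\<lambda>x. 1) \<in> C" using C.one_closed unfolding char_group_simps .
  note ca = charactersD(1)[OF a]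
  have cc: "cont c" if "c \<in> C" for c by (rule charactersD(1)[OF CC[OF that]])
  have orth: "mean (\<lambda>x. c x * a x) = 0" if c: "c \<in> C" for c
  proof (rule mean_character[OF characters_mult[OF CC[OF c] a]], rule notI)
    assume eq: "(\<lambda>x. c x * a x) = (\<lambda>x. 1)"
    have "a = (\<lambda>x. cnj (c x))"
    proof
      fix x
      have "c x * a x = c x * cnj (c x)" using fun_cong[OF eq, of x] character_mult_cnj[OF CC[OF c], of x]
        by simp
      then show "a x = cnj (c x)" using character_nonzero[OF CC[OF c], of x] by simp
    qed
    then show False using aC Ccnj[OF c] by simp
  qed
  \<comment> \<open>The condition includes the products with all members of \<open>C\<close>, so
    that \<open>Q\<close> is preserved by the factors \<open>g d\<close>: each is a combination of
    1, \<open>d\<close> and its conjugate.\<close>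
  define Q where "Q = {f. cont f \<and> (\<forall>c\<in>C. mean (\<lambda>x. f x * (c x * a x)) = 0)}"
  have Q1: "(\<lambda>x. 1) \<in> Q" unfolding Q_def using orth by simp
  define g where "g c = (\<lambda>x. (2 + (c x + cnj (c x))) / 4)" for c :: "'a \<Rightarrow> complex"
  have g_Re: "g c x = of_real ((1 + Re (c x)) / 2)" for c x
    unfolding g_def by (simp add: complex_eq_iff)
  have cg: "cont (g c)" if "c \<in> C" for c
  proof -
    have "cont (\<lambda>x. 2 + (c x + cnj (c x)))"
      by (rule continuous_map_add[OF _ continuous_map_add[OF cc[OF that] continuous_map_cnj[OF cc[OF
        that]]]]) simp
    from continuous_map_cmult[OF this, of "1/4"] show ?thesis unfolding g_def by simp
  qed
  have Qg: "(\<lambda>x. f x * g d x) \<in> Q" if f: "f \<in> Q" and d: "d \<in> C" for f d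
  proof -
    have cf: "cont f" using f unfolding Q_def by simp
    have f0: "mean (\<lambda>x. f x * (c x * a x)) = 0" if "c \<in> C" for c using f that unfolding Q_def by simp
    have "mean (\<lambda>x. f x * g d x * (c x * a x)) = 0" if c: "c \<in> C" for c
    proof -
      have k: "cont (\<lambda>x. f x * (c x * a x))" if "c \<in> C" for c
        by (rule continuous_map_mult_algebra[OF cf continuous_map_mult_algebra[OF cc[OF that] ca]])
      note dc = Cmult[OF d c] and dc' = Cmult[OF Ccnj[OF d] c]
      have eq: "(\<lambda>x. f x * g d x * (c x * a x)) =
        (\<lambda>x. (1/2) * (f x * (c x * a x)) + ((1/4) * (f x * ((d x * c x) * a x)) + (1/4) * (f x * ((cnj (d x)
          * c x) * a x))))"
        unfolding g_def by (auto simp: field_simps)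
      note e1 = mean_cmult[OF k[OF c], of "1/2"] and e2 = mean_cmult[OF k[OF dc], of "1/4"]
        and e3 = mean_cmult[OF k[OF dc'], of "1/4"]
      note k1 = continuous_map_cmult[OF k[OF c], of "1/2"]
        and k2 = continuous_map_cmult[OF k[OF dc], of "1/4"]
        and k3 = continuous_map_cmult[OF k[OF dc'], of "1/4"]
      show ?thesis
        unfolding eq mean_add[OF k1 continuous_map_add[OF k2 k3]] mean_add[OF k2 k3] e1 e2 e3
          f0[OF c] f0[OF dc] f0[OF dc'] by simp
    qed
    then show ?thesis unfolding Q_def using continuous_map_mult_algebra[OF cf cg[OF d]] by simp
  qed
  \<comment> \<open>\<open>Z\<close> collects the points where \<open>a\<close> is far from 1. None
    of them lies in the common kernel of \<open>C\<close>, so by compactness finitely many members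
    of \<open>C\<close> suffice to push the product \<open>r\<close> below 1 on
    \<open>Z\<close>.\<close>
  define Z where "Z = {x \<in> topspace T. norm (a x - 1) \<in> {1..}}"
  have "closedin T Z"
    unfolding Z_def
    by (rule closedin_continuous_map_preimage[OF continuous_map_norm[OF continuous_map_diff[OF ca]]]) simp_all
  then have Zc: "compactin T Z" by (rule closedin_compact_space[OF compact])
  define W where "W c = {x \<in> topspace T. Re (c x) \<in> {..<1}}" for c :: "'a \<Rightarrow> complex"
  have cRe: "continuous_map T euclideanreal (\<lambda>x. Re (f x))" if "cont f" for f
    by (rule continuous_map_euclidean_compose[OF that]) (intro continuous_intros)
  have "\<exists>\<F>. finite \<F> \<and> \<F> \<subseteq> W ` C \<and> Z \<subseteq> \<Union>\<F>"
  proof (rule compactinD[OF Zc])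
    fix V assume "V \<in> W ` C"
    then obtain c where c: "c \<in> C" "V = W c" by blast
    show "openin T V"
      unfolding c(2) W_def by (rule openin_continuous_map_preimage[OF cRe[OF cc[OF c(1)]]]) simp
  next
    show "Z \<subseteq> \<Union>(W ` C)"
    proof
      fix x assume x: "x \<in> Z"
      then have xG: "x \<in> carrier G" unfolding Z_def topspace_eq_carrier by simp
      have "a x \<noteq> 1" using x unfolding Z_def by auto
      then obtain c where c: "c \<in> C" "c x \<noteq> 1" using ker[OF xG] by blast
      have "Re (c x) < 1"
      proof (rule ccontr)
        assume "\<not> Re (c x) < 1"
        moreover have "Re (c x) \<le> 1" using complex_Re_le_cmod[of "c x"] charactersD(3)[OF CC[OF c(1)], of x]
          by simp
        ultimately have "Re (c x) = 1" by simp
        moreover have "(Re (c x))\<^sup>2 + (Im (c x))\<^sup>2 = 1"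
          using cmod_power2[of "c x"] charactersD(3)[OF CC[OF c(1)], of x] by simp
        ultimately have "c x = 1" by (simp add: complex_eq_iff)
        then show False using c(2) by simp
      qed
      then have "x \<in> W c" unfolding W_def using xG topspace_eq_carrier by simp
      then show "x \<in> \<Union>(W ` C)" using c(1) by blast
    qed
  qed
  then obtain \<F> where F: "finite \<F>" "\<F> \<subseteq> W ` C" "Z \<subseteq> \<Union>\<F>" by (elim exE conjE)
  from finite_subset_image[OF F(1,2)] obtain S where S: "S \<subseteq> C" "finite S" "\<F> = W ` S" by (elim exE conjE)
  define r where "r x = (\<Prod>c\<in>S. (1 + Re (c x)) / 2)" for x
  have fac: "0 \<le> (1 + Re (c x)) / 2" "(1 + Re (c x)) / 2 \<le> 1" if "c \<in> S" for c x
    using abs_Re_le_cmod[of "c x"] charactersD(3)[OF CC, of c x] S(1) that by auto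
  have r01: "0 \<le> r x" "r x \<le> 1" for x
    unfolding r_def using fac by (auto intro!: prod_nonneg prod_le_1)
  have QF: "(\<lambda>x. f x * of_real (r x)) \<in> Q" if f: "f \<in> Q" for f
  proof -
    have "finite S' \<Longrightarrow> S' \<subseteq> C \<Longrightarrow> (\<lambda>x. f x * (\<Prod>c\<in>S'. g c x)) \<in> Q" for S'
    proof (induction S' rule: finite_induct)
      case (insert d S')
      then have "(\<lambda>x. f x * (\<Prod>c\<in>S'. g c x)) \<in> Q" "d \<in> C" by simp_all
      from Qg[OF this] have "(\<lambda>x. (f x * (\<Prod>c\<in>S'. g c x)) * g d x) \<in> Q" .
      then show ?case using insert.hyps by (simp add: ac_simps)
    qed (simp add: f)
    from this[OF S(2,1)] show ?thesis unfolding r_def g_Re by simp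
  qed
  have Qpow: "(\<lambda>x. of_real (r x ^ k)) \<in> Q" for k
  proof (induction k)
    case (Suc k)
    from QF[OF Suc] show ?case by (simp add: mult.commute)
  qed (simp add: Q1)
  have cpow: "cont (\<lambda>x. of_real (r x ^ k))" for k using Qpow[of k] unfolding Q_def by simp
  have cr: "continuous_map T euclideanreal r"
    using cRe[OF cpow[of 1]] by simp
  have zero: "mean (\<lambda>x. of_real (r x ^ k) * a x) = 0" for k
  proof -
    have "\<forall>c\<in>C. mean (\<lambda>x. of_real (r x ^ k) * (c x * a x)) = 0" using Qpow[of k] unfolding Q_def by simp
    from bspec[OF this C1] show ?thesis by simp
  qed
  \<comment> \<open>The lower bound \<open>1 / 2\<close> keeps \<theta> positive, so that
    \<open>t / \<theta>\<close> may be formed even if \<open>Z\<close> is empty or \<open>r\<close>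
    vanishes on it.\<close>
  have "\<exists>\<theta>. 1 / 2 \<le> \<theta> \<and> \<theta> < 1 \<and> (\<forall>x\<in>Z. r x \<le> \<theta>)"
  proof (cases "Z = {}")
    case True
    then show ?thesis by (intro exI[of _ "1/2"]) simp
  next
    case False
    have "compactin euclidean (r ` Z)" by (rule image_compactin[OF Zc cr])
    then have "compact (r ` Z)" by simp
    from compact_attains_sup[OF this] False obtain z where z: "z \<in> Z" "\<forall>x\<in>Z. r x \<le> r z" by auto
    have "r z < 1"
    proof -
      obtain c where c: "c \<in> S" "z \<in> W c" using z(1) F(3) S(3) by blast
      have "r z = (1 + Re (c z)) / 2 * (\<Prod>c\<in>S - {c}. (1 + Re (c z)) / 2)"
        unfolding r_def by (rule prod.remove[OF S(2) c(1)])
      also have "\<dots> \<le> (1 + Re (c z)) / 2 * 1"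
        by (rule mult_left_mono) (use fac c(1) in \<open>auto intro!: prod_le_1\<close>)
      also have "\<dots> < 1" using c(2) unfolding W_def by simp
      finally show ?thesis .
    qed
    then show ?thesis using z(2) by (intro exI[of _ "max (1/2) (r z)"]) auto
  qed
  then obtain \<theta> where \<theta>: "1 / 2 \<le> \<theta>" "\<theta> < 1" "\<forall>x\<in>Z. r x \<le> \<theta>" by (elim exE conjE)
  define t where "t = (1 + \<theta>) / 2"
  have t: "\<theta> < t" "t < 1" "0 < t" unfolding t_def using \<theta> by auto
  \<comment> \<open>Off \<open>Z\<close> the real part of \<open>a\<close> is at least
    \<open>1 / 2\<close>; on \<open>Z\<close> it is at least \<open>-1\<close>, and
    \<open>r x ^ k \<le> \<theta> ^ k\<close>. In both cases
    \<open>1 / 2 * r x ^ k - 3 / 2 * \<theta> ^ k\<close> bounds from below the real part of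
    \<open>r x ^ k * a x\<close>, a function of mean 0.\<close>
  have up: "Re (mean (\<lambda>x. of_real (r x ^ k))) \<le> 3 * \<theta> ^ k" for k
  proof -
    have c1: "cont (\<lambda>x. (1/2) * of_real (r x ^ k) - of_real (3 / 2 * \<theta> ^ k))"
      by (intro continuous_map_diff continuous_map_cmult cpow) simp
    have c2: "cont (\<lambda>x. of_real (r x ^ k) * a x)" by (intro continuous_map_mult_algebra cpow ca)
    have "Re (mean (\<lambda>x. (1/2) * of_real (r x ^ k) - of_real (3 / 2 * \<theta> ^ k))) \<le> Re (mean (\<lambda>x. of_real (r x ^ k) * a x))"
    proof (rule Re_mean_mono[OF c1 c2])
      fix x assume x: "x \<in> carrier G"
      have na: "norm (a x) = 1" by (rule charactersD(3)[OF a])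
      have rk: "0 \<le> r x ^ k" using r01(1) by simp
      have lhs: "Re ((1/2) * of_real (r x ^ k) - of_real (3 / 2 * \<theta> ^ k)) = (1/2) * r x ^ k - 3 / 2 * \<theta> ^ k"
        by (simp del: of_real_power)
      have rhs: "Re (of_real (r x ^ k) * a x) = r x ^ k * Re (a x)"
        by (simp del: of_real_power)
      show "Re ((1/2) * of_real (r x ^ k) - of_real (3 / 2 * \<theta> ^ k)) \<le> Re (of_real (r x ^ k) * a x)"
        unfolding lhs rhs
      proof (cases "x \<in> Z")
        case True
        have "r x ^ k \<le> \<theta> ^ k" using \<theta>(3) True r01(1) by (intro power_mono) auto
        moreover have "- 1 \<le> Re (a x)" using abs_Re_le_cmod[of "a x"] na by simp
        then have "r x ^ k * (- 1) \<le> r x ^ k * Re (a x)" by (rule mult_left_mono[OF _ rk])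
        ultimately show "(1/2) * r x ^ k - 3 / 2 * \<theta> ^ k \<le> r x ^ k * Re (a x)" by linarith
      next
        case False
        then have "norm (a x - 1) < 1" using x unfolding Z_def topspace_eq_carrier by simp
        then have "(norm (a x - 1))\<^sup>2 < 1" by (simp add: power_less_one_iff abs_square_less_1)
        moreover have "(norm (a x - 1))\<^sup>2 = 2 - 2 * Re (a x)"
        proof -
          have "(Re (a x))\<^sup>2 + (Im (a x))\<^sup>2 = 1" using cmod_power2[of "a x"] na by simp
          then show ?thesis unfolding cmod_power2 by (simp add: power2_eq_square algebra_simps)
        qed
        ultimately have "1 / 2 \<le> Re (a x)" by linarith
        then have "r x ^ k * (1 / 2) \<le> r x ^ k * Re (a x)" by (rule mult_left_mono[OF _ rk])
        moreover have "0 \<le> \<theta> ^ k" using \<theta>(1) by simp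
        ultimately show "(1/2) * r x ^ k - 3 / 2 * \<theta> ^ k \<le> r x ^ k * Re (a x)" by linarith
      qed
    qed
    also have "mean (\<lambda>x. of_real (r x ^ k) * a x) = 0" by (rule zero)
    also have "mean (\<lambda>x. (1/2) * of_real (r x ^ k) - of_real (3 / 2 * \<theta> ^ k))
        = (1/2) * mean (\<lambda>x. of_real (r x ^ k)) - of_real (3 / 2 * \<theta> ^ k)"
      by (subst mean_diff) (intro continuous_map_cmult cpow, simp, simp only: mean_cmult[OF cpow] mean_const)
    finally show ?thesis by (simp del: of_real_power)
  qed
  \<comment> \<open>A bump where \<open>r\<close> exceeds \<open>t\<close>; it is positive at the
    identity, and \<open>t ^ k * p \<le> r ^ k\<close>. The mean of \<open>r ^ k\<close> is
    therefore at least a fixed multiple of \<open>t ^ k\<close>, which the bound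
    \<open>3 * \<theta> ^ k\<close> contradicts since \<open>t > \<theta>\<close>.\<close>
  define p where "p = (\<lambda>x. complex_of_real (max 0 (r x - t)))"
  have cp: "cont p"
    unfolding p_def
    by (intro continuous_map_of_real continuous_map_real_max continuous_map_diff cr) simp_all
  have "0 < Re (mean p)"
  proof (rule mean_pos[OF cp _ one_closed])
    have "r \<one> = 1" unfolding r_def
    proof (intro prod.neutral ballI)
      fix c assume "c \<in> S"
      then have "c \<in> C" using S(1) by blast
      then show "(1 + Re (c \<one>)) / 2 = 1" using character_one[OF CC[OF \<open>c \<in> C\<close>]] by simp
    qed
    then show "0 < Re (p \<one>)" unfolding p_def using t by simp
  qed (simp add: p_def)
  define \<delta> where "\<delta> = Re (mean p)"
  have \<delta>: "\<delta> > 0" unfolding \<delta>_def by fact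
  have low: "t ^ k * \<delta> \<le> Re (mean (\<lambda>x. of_real (r x ^ k)))" for k
  proof -
    have "Re (mean (\<lambda>x. of_real (t ^ k) * p x)) \<le> Re (mean (\<lambda>x. of_real (r x ^ k)))"
    proof (rule Re_mean_mono[OF continuous_map_cmult[OF cp] cpow])
      fix x
      have "t ^ k * max 0 (r x - t) \<le> r x ^ k"
      proof (cases "r x \<le> t")
        case True
        then show ?thesis using r01(1)[of x] by simp
      next
        case False
        have "t ^ k * (r x - t) \<le> t ^ k * 1" using r01(2)[of x] t by (intro mult_left_mono) auto
        also have "\<dots> \<le> r x ^ k" using False t by (simp add: power_mono)
        finally show ?thesis using False by simp
      qed
      then show "Re (of_real (t ^ k) * p x) \<le> Re (of_real (r x ^ k))"
        unfolding p_def by (simp del: of_real_power)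
    qed
    also have "mean (\<lambda>x. of_real (t ^ k) * p x) = of_real (t ^ k) * mean p" by (rule mean_cmult[OF cp])
    finally show ?thesis unfolding \<delta>_def by (simp del: of_real_power)
  qed
  have "(t / \<theta>) ^ k * \<delta> \<le> 3" for k
  proof -
    have "t ^ k * \<delta> \<le> 3 * \<theta> ^ k" using low[of k] up[of k] by linarith
    moreover have "0 < \<theta> ^ k" using \<theta>(1) by simp
    ultimately show ?thesis by (simp add: power_divide field_simps)
  qed
  moreover have "1 < t / \<theta>" using t(1) \<theta>(1) by simp
  then obtain k where "3 / \<delta> < (t / \<theta>) ^ k" using real_arch_pow by blast
  then have "3 < (t / \<theta>) ^ k * \<delta>" using \<delta> by (simp add: field_simps)
  ultimately show False by (meson not_less)
qed

lemma characters_pow: "\<psi> \<in> characters \<Longrightarrow> (\<lambda>x. \<psi> x ^ k) \<in> characters"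
  by (induction k) (auto simp: characters_one characters_mult)

text \<open>Finitely many characters would all have finite order, since the powers of a character
  repeat, and so take finitely many values. As they separate points, the group would embed into a
  finite product.\<close>

lemma infinite_characters:
  assumes inf: "infinite (carrier G)"
  shows "infinite characters"
proof
  assume fin: "finite characters"
  have "\<exists>m>0. \<forall>x. \<psi> x ^ m = 1" if c: "\<psi> \<in> characters" for \<psi>
  proof -
    have "range (\<lambda>k x. \<psi> x ^ k) \<subseteq> characters" using characters_pow[OF c] by blast
    then have "finite (range (\<lambda>k x. \<psi> x ^ k))" using fin finite_subset by blast
    then have "\<not> inj (\<lambda>k x. \<psi> x ^ k)" using finite_imageD infinite_UNIV_nat by blast
    then obtain i j where ij: "i \<noteq> j" "(\<lambda>x. \<psi> x ^ i) = (\<lambda>x. \<psi> x ^ j)" unfolding inj_on_def by blast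
    have "\<exists>m>0. \<forall>x. \<psi> x ^ m = 1" if "i < j" and eq: "(\<lambda>x. \<psi> x ^ i) = (\<lambda>x. \<psi> x ^ j)" for i j
    proof (intro exI[of _ "j - i"] conjI allI)
      show "j - i > 0" using that by simp
      fix x
      have "\<psi> x ^ i * 1 = \<psi> x ^ i * \<psi> x ^ (j - i)"
        using fun_cong[OF eq, of x] power_add[of "\<psi> x" i "j - i"] that(1) by simp
      moreover have "\<psi> x ^ i \<noteq> 0" using character_nonzero[OF c] by simp
      ultimately show "\<psi> x ^ (j - i) = 1" using mult_left_cancel by metis
    qed
    from this[of i j] this[of j i] show ?thesis using ij by (metis nat_neq_iff)
  qed
  then have "\<forall>\<psi>\<in>characters. \<exists>m. m > 0 \<and> (\<forall>x. \<psi> x ^ m = 1)" by (intro ballI)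
  from bchoice[OF this] obtain m where m: "\<forall>\<psi>\<in>characters. m \<psi> > 0 \<and> (\<forall>x. \<psi> x ^ m \<psi> = 1)" by (rule exE)
  let ?e = "\<lambda>x. \<lambda>\<psi>\<in>characters. \<psi> x"
  have "?e ` carrier G \<subseteq> (\<Pi>\<^sub>E \<psi>\<in>characters. {z. z ^ m \<psi> = 1})"
    using m by auto
  moreover have "finite (\<Pi>\<^sub>E \<psi>\<in>characters. {z::complex. z ^ m \<psi> = 1})"
    by (rule finite_PiE[OF fin]) (use m finite_roots_unity in auto)
  ultimately have "finite (?e ` carrier G)" by (rule finite_subset)
  moreover have "inj_on ?e (carrier G)"
  proof (rule inj_onI, rule ccontr)
    fix x y assume xy: "x \<in> carrier G" "y \<in> carrier G" "?e x = ?e y" "x \<noteq> y"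
    have "x \<otimes> inv y \<noteq> \<one>" using xy(1,2,4) inv_equality[of x "inv y"] by auto
    then obtain \<psi> where p: "\<psi> \<in> characters" "\<psi> (x \<otimes> inv y) \<noteq> 1"
      using characters_separate[of "x \<otimes> inv y"] xy(1,2) by auto
    have "\<psi> x = \<psi> y" using fun_cong[OF xy(3), of \<psi>] p(1) by simp
    then have "\<psi> (x \<otimes> inv y) = 1"
      using charactersD(2)[OF p(1) xy(1) inv_closed[OF xy(2)]] character_inv[OF p(1) xy(2)]
        character_mult_cnj[OF p(1), of y] by simp
    then show False using p(2) by simp
  qed
  ultimately show False using inf finite_imageD by blast
qed

theorem ex_infinite_metric_subgroup:
  assumes inf: "infinite (carrier G)"
  shows "\<exists>H. subgroup H G \<and> closedin T H \<and> infinite H \<and> second_countable (subtopology T H)"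
proof -
  interpret A: comm_group char_group by (rule comm_group_characters)
  have "infinite (carrier char_group)" using infinite_characters[OF inf] unfolding char_group_simps .
  from A.ex_countable_infinite_quotient[OF this] obtain C B where C: "subgroup C char_group"
    and count: "A.countably_many_cosets C (carrier char_group)"
    and B: "B \<subseteq> carrier char_group" "infinite B"
    and BC: "\<forall>a\<in>B. \<forall>b\<in>B. a \<otimes>\<^bsub>char_group\<^esub> inv\<^bsub>char_group\<^esub> b \<in> C \<longrightarrow> a = b" by (elim exE conjE)
  interpret C: subgroup C char_group by (rule C)
  have CC: "c \<in> characters" if "c \<in> C" for c using C.mem_carrier[OF that] unfolding char_group_simps .
  have BCh: "b \<in> characters" if "b \<in> B" for b using that B(1) unfolding char_group_simps by blast
  obtain S where S: "countable S" "S \<subseteq> characters"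
    and cov: "\<forall>a\<in>characters. \<exists>s\<in>S. a \<otimes>\<^bsub>char_group\<^esub> inv\<^bsub>char_group\<^esub> s \<in> C"
    using count unfolding A.countably_many_cosets_def char_group_simps(1) by (elim exE conjE)
  define H where "H = {x \<in> carrier G. \<forall>c\<in>C. c x = 1}"
  have HG: "x \<in> carrier G" if "x \<in> H" for x using that unfolding H_def by simp
  have Hc: "c x = 1" if "x \<in> H" "c \<in> C" for x c using that unfolding H_def by simp
  have sH: "subgroup H G"
  proof
    show "H \<subseteq> carrier G" unfolding H_def by blast
    show "\<one> \<in> H" unfolding H_def using character_one[OF CC] by simp
    show "x \<otimes> y \<in> H" if "x \<in> H" "y \<in> H" for x y
    proof -
      have "c (x \<otimes> y) = 1" if c: "c \<in> C" for c
        using charactersD(2)[OF CC[OF c] HG[OF \<open>x \<in> H\<close>] HG[OF \<open>y \<in> H\<close>]] Hc[OF \<open>x \<in> H\<close> c] Hc[OF \<open>y \<in> H\<close> c]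
          by simp
      then show ?thesis unfolding H_def using HG[OF \<open>x \<in> H\<close>] HG[OF \<open>y \<in> H\<close>] by simp
    qed
    show "inv x \<in> H" if "x \<in> H" for x
    proof -
      have "c (inv x) = 1" if c: "c \<in> C" for c
        using character_inv[OF CC[OF c] HG[OF \<open>x \<in> H\<close>]] Hc[OF \<open>x \<in> H\<close> c] by simp
      then show ?thesis unfolding H_def using HG[OF \<open>x \<in> H\<close>] by simp
    qed
  qed
  interpret H: subgroup H G by (rule sH)
  have clH: "closedin T H"
  proof -
    have "H = \<Inter>(insert (carrier G) ((\<lambda>c. {x \<in> topspace T. c x \<in> {1}}) ` C))"
      unfolding H_def topspace_eq_carrier by auto
    also have "closedin T \<dots>"
    proof (rule closedin_Inter)
      fix K assume "K \<in> insert (carrier G) ((\<lambda>c. {x \<in> topspace T. c x \<in> {1}}) ` C)"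
      then consider "K = carrier G" | c where "c \<in> C" "K = {x \<in> topspace T. c x \<in> {1}}" by blast
      then show "closedin T K"
      proof cases
        case 1
        then show ?thesis using closedin_topspace[of T] topspace_eq_carrier by simp
      next
        case 2
        have "closedin euclidean {1::complex}" by simp
        then show ?thesis unfolding 2(2)
          by (rule closedin_continuous_map_preimage[OF charactersD(1)[OF CC[OF 2(1)]]])
      qed
    qed simp
    finally show ?thesis .
  qed
  \<comment> \<open>Characters in the same coset of \<open>C\<close> agree on \<open>H\<close>, so
    the countable set \<open>S\<close> of representatives separates the points of \<open>H\<close>
    just as the full group of characters does.\<close>
  have onH: "a x = b x" if a: "a \<in> characters" and b: "b \<in> characters"
    and ab: "a \<otimes>\<^bsub>char_group\<^esub> inv\<^bsub>char_group\<^esub> b \<in> C" and x: "x \<in> H" for a b x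
  proof -
    have "(\<lambda>x. a x * cnj (b x)) \<in> C" using ab unfolding char_group_inv[OF b] char_group_simps .
    from Hc[OF x this] have "a x * cnj (b x) = b x * cnj (b x)" using character_mult_cnj[OF b, of x] by simp
    then show ?thesis using character_nonzero[OF b, of x] by simp
  qed
  have "second_countable (subtopology T H)"
  proof (rule second_countable_separating[OF _ S(1)])
    show "compact_space (subtopology T H)"
      by (rule compact_space_subtopology[OF closedin_compact_space[OF compact clH]])
    show "continuous_map (subtopology T H) euclidean s" if "s \<in> S" for s
      using charactersD(1) S(2) that by (intro continuous_map_from_subtopology) blast
    fix x y assume "x \<in> topspace (subtopology T H)" "y \<in> topspace (subtopology T H)" and ne: "x \<noteq> y"
    then have xy: "x \<in> H" "y \<in> H" by simp_all
    have xyG: "x \<in> carrier G" "y \<in> carrier G" using HG xy by auto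
    have "x \<otimes> inv y \<noteq> \<one>" using xyG ne inv_equality[of x "inv y"] by auto
    then obtain \<psi> where p: "\<psi> \<in> characters" "\<psi> (x \<otimes> inv y) \<noteq> 1"
      using characters_separate[of "x \<otimes> inv y"] xyG by auto
    have neq: "\<psi> x \<noteq> \<psi> y"
    proof
      assume "\<psi> x = \<psi> y"
      then have "\<psi> (x \<otimes> inv y) = 1"
        using charactersD(2)[OF p(1) xyG(1) inv_closed[OF xyG(2)]] character_inv[OF p(1) xyG(2)]
          character_mult_cnj[OF p(1), of y] by simp
      then show False using p(2) by simp
    qed
    obtain s where s: "s \<in> S" "\<psi> \<otimes>\<^bsub>char_group\<^esub> inv\<^bsub>char_group\<^esub> s \<in> C" using bspec[OF cov p(1)] by (rule bexE)
    have sc: "s \<in> characters" using s(1) S(2) by blast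
    have "s x \<noteq> s y" using neq onH[OF p(1) sc s(2) xy(1)] onH[OF p(1) sc s(2) xy(2)] by simp
    then show "\<exists>s\<in>S. s x \<noteq> s y" using s(1) by (rule rev_bexI[rotated])
  qed
  moreover have "infinite H"
  proof
    assume fin: "finite H"
    have tors: "\<exists>m>0. x [^] (m::nat) = \<one>" if x: "x \<in> H" for x
    proof -
      have xG: "x \<in> carrier G" by (rule HG[OF x])
      have "x [^] (k::nat) \<in> H" for k by (induction k) (use x in auto)
      then have "range (\<lambda>k::nat. x [^] k) \<subseteq> H" by blast
      then have "finite (range (\<lambda>k::nat. x [^] k))" using fin finite_subset by blast
      then have "\<not> inj (\<lambda>k::nat. x [^] k)" using finite_imageD infinite_UNIV_nat by blast
      then obtain i j :: nat where ij: "i \<noteq> j" "x [^] i = x [^] j" unfolding inj_on_def by blast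
      have "\<exists>m>0. x [^] (m::nat) = \<one>" if lt: "i < j" and eq: "x [^] i = x [^] j" for i j :: nat
      proof (intro exI[of _ "j - i"] conjI)
        show "j - i > 0" using lt by simp
        have "x [^] i \<otimes> x [^] (j - i) = x [^] i"
          using nat_pow_mult[OF xG, of i "j - i"] eq lt by simp
        then show "x [^] (j - i) = \<one>"
          unfolding l_cancel_one[OF nat_pow_closed[OF xG] nat_pow_closed[OF xG]] .
      qed
      from this[of i j] this[of j i] show ?thesis using ij by (metis nat_neq_iff)
    qed
    then have "\<forall>x\<in>H. \<exists>m. m > 0 \<and> x [^] (m::nat) = \<one>" by (intro ballI)
    from bchoice[OF this] obtain m :: "'a \<Rightarrow> nat" where m: "\<forall>x\<in>H. m x > 0 \<and> x [^] m x = \<one>" by (rule exE)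
    have pow: "b (x [^] (k::nat)) = b x ^ k" if "b \<in> characters" "x \<in> carrier G" for b x k
      by (induction k) (use that character_one charactersD(2)[OF that(1)] in auto)
    \<comment> \<open>Restriction to \<open>H\<close>. Its values at \<open>x\<close> are roots of
      unity of order dividing \<open>m x\<close>, so it has finite image; but two members of
      \<open>B\<close> that agree on \<open>H\<close> differ by an element of \<open>C\<close>, by
      the annihilator theorem, and are therefore equal.\<close>
    let ?r = "\<lambda>b. \<lambda>x\<in>H. b x"
    have "?r ` B \<subseteq> (\<Pi>\<^sub>E x\<in>H. {z. z ^ m x = 1})"
    proof
      fix z assume "z \<in> ?r ` B"
      then obtain b where b: "b \<in> B" "z = ?r b" by blast
      have "b x ^ m x = 1" if x: "x \<in> H" for x
      proof -
        have "b x ^ m x = b (x [^] m x)" using pow[OF BCh[OF b(1)] HG[OF x]] by simp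
        then show ?thesis using m x character_one[OF BCh[OF b(1)]] by simp
      qed
      then show "z \<in> (\<Pi>\<^sub>E x\<in>H. {z. z ^ m x = 1})" unfolding b(2) by simp
    qed
    moreover have "finite (\<Pi>\<^sub>E x\<in>H. {z::complex. z ^ m x = 1})"
      by (rule finite_PiE[OF fin]) (use m finite_roots_unity in auto)
    ultimately have "finite (?r ` B)" by (rule finite_subset)
    moreover have "inj_on ?r B"
    proof (rule inj_onI)
      fix a b assume ab: "a \<in> B" "b \<in> B" "?r a = ?r b"
      have "(\<lambda>x. a x * cnj (b x)) \<in> C"
      proof (rule annihilator_of_common_kernel[OF C characters_mult[OF BCh[OF ab(1)] characters_cnj[OF
        BCh[OF ab(2)]]]])
        fix x assume x: "x \<in> carrier G" and one: "\<And>c. c \<in> C \<Longrightarrow> c x = 1"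
        have xH: "x \<in> H" unfolding H_def by (intro CollectI conjI ballI x one)
        have "?r a x = ?r b x" using ab(3) by (rule fun_cong)
        then have "a x = b x" unfolding restrict_apply'[OF xH] .
        then show "a x * cnj (b x) = 1" using character_mult_cnj[OF BCh[OF ab(2)]] by simp
      qed
      then have "a \<otimes>\<^bsub>char_group\<^esub> inv\<^bsub>char_group\<^esub> b \<in> C"
        unfolding char_group_inv[OF BCh[OF ab(2)]] char_group_simps .
      then show "a = b" by (rule mp[OF bspec[OF bspec[OF BC ab(1)] ab(2)]])
    qed
    ultimately show False using B(2) finite_imageD by blast
  qed
  ultimately show ?thesis using sH clH by (intro exI[of _ H] conjI)
qed

end

section \<open>Torsion groups and groups with an element of infinite order\<close>

theorem (in compact_group) ex_infinite_second_countable_subgroup: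
  assumes inf: "infinite (carrier G)"
  shows "\<exists>H. subgroup H G \<and> closedin T H \<and> infinite H \<and> second_countable (subtopology T H)"
proof (cases "\<forall>x\<in>carrier G. \<exists>m>0. x [^] (m::nat) = \<one>")
  case True
  show ?thesis by (rule torsion_ex_infinite_metric_subgroup[OF inf bspec[OF True]])
next
  case False
  then obtain g where g: "g \<in> carrier G" and tf: "\<And>m::nat. m > 0 \<Longrightarrow> g [^] m \<noteq> \<one>" by blast
  define P where "P = range (\<lambda>k::int. g [^] k)"
  have sP: "subgroup P G"
  proof
    show "P \<subseteq> carrier G" unfolding P_def using g by auto
    show "\<one> \<in> P" unfolding P_def by (rule range_eqI[of _ _ 0]) simp
    show "x \<otimes> y \<in> P" if "x \<in> P" "y \<in> P" for x y
    proof -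
      obtain k l :: int where "x = g [^] k" "y = g [^] l" using \<open>x \<in> P\<close> \<open>y \<in> P\<close> unfolding P_def by blast
      then have "x \<otimes> y = g [^] (k + l)" using g by (simp add: int_pow_mult)
      then show ?thesis unfolding P_def by blast
    qed
    show "inv x \<in> P" if "x \<in> P" for x
    proof -
      obtain k :: int where "x = g [^] k" using \<open>x \<in> P\<close> unfolding P_def by blast
      then have "inv x = g [^] (- k)" using g by (simp add: int_pow_neg)
      then show ?thesis unfolding P_def by blast
    qed
  qed
  interpret P: subgroup P G by (rule sP)
  have Pcomm: "x \<otimes> y = y \<otimes> x" if "x \<in> P" "y \<in> P" for x y
  proof -
    obtain k l :: int where "x = g [^] k" "y = g [^] l" using \<open>x \<in> P\<close> \<open>y \<in> P\<close> unfolding P_def by blast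
    then show ?thesis using g by (simp add: int_pow_mult[symmetric] add.commute)
  qed
  define K where "K = T closure_of P"
  have sK: "subgroup K G" unfolding K_def by (rule subgroup_closure_of[OF sP])
  have clK: "closedin T K" unfolding K_def by simp
  interpret K: subgroup K G by (rule sK)
  have PK: "P \<subseteq> K" unfolding K_def using P.subset topspace_eq_carrier by (intro closure_of_subset) simp
  have id: "continuous_map T T (\<lambda>x. x)" using continuous_map_id unfolding id_def .
  have eq_closed: "closedin T {x \<in> topspace T. x \<otimes> y = y \<otimes> x}" if "y \<in> carrier G" for y
    by (rule closedin_continuous_maps_eq[OF Hausdorff continuous_map_translate(2)[OF id that that]
          continuous_map_translate(1)[OF id that that]])
  \<comment> \<open>Commuting with a fixed element is a closed condition. Commutativity thus extends
    from \<open>P\<close> to its closure in one factor here, and in the other factor by the same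
    argument afterwards.\<close>
  have KP: "x \<otimes> y = y \<otimes> x" if x: "x \<in> K" and y: "y \<in> P" for x y
  proof -
    have "P \<subseteq> {x \<in> topspace T. x \<otimes> y = y \<otimes> x}"
      using Pcomm[OF _ y] P.subset topspace_eq_carrier by auto
    then have "K \<subseteq> {x \<in> topspace T. x \<otimes> y = y \<otimes> x}"
      unfolding K_def by (rule closure_of_minimal) (rule eq_closed[OF P.mem_carrier[OF y]])
    then show ?thesis using x by blast
  qed
  have KK: "x \<otimes> y = y \<otimes> x" if x: "x \<in> K" and y: "y \<in> K" for x y
  proof -
    have "P \<subseteq> {x \<in> topspace T. x \<otimes> y = y \<otimes> x}"
      using KP[OF y, symmetric] P.subset topspace_eq_carrier by auto
    then have "K \<subseteq> {x \<in> topspace T. x \<otimes> y = y \<otimes> x}"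
      unfolding K_def by (rule closure_of_minimal) (rule eq_closed[OF K.mem_carrier[OF y]])
    then show ?thesis using x by blast
  qed
  have "inj (\<lambda>n::nat. g [^] n)"
  proof (rule linorder_injI, rule notI)
    fix i j :: nat assume ij: "i < j" "g [^] i = g [^] j"
    have "g [^] i \<otimes> g [^] (j - i) = g [^] i"
      using nat_pow_mult[OF g, of i "j - i"] ij by simp
    then have "g [^] (j - i) = \<one>"
      unfolding l_cancel_one[OF nat_pow_closed[OF g] nat_pow_closed[OF g]] .
    then show False using tf[of "j - i"] ij(1) by simp
  qed
  then have "infinite (range (\<lambda>n::nat. g [^] n))" by (rule range_inj_infinite)
  moreover have "range (\<lambda>n::nat. g [^] n) \<subseteq> K"
  proof
    fix x assume "x \<in> range (\<lambda>n::nat. g [^] n)"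
    then obtain n :: nat where "x = g [^] n" by blast
    then have "x = g [^] (int n)" by (simp add: int_pow_int)
    then show "x \<in> K" using PK unfolding P_def by blast
  qed
  ultimately have infK: "infinite K" using finite_subset by blast
  interpret KG: abelian_compact_group "G\<lparr>carrier := K\<rparr>" "subtopology T K"
    unfolding abelian_compact_group_def abelian_compact_group_axioms_def
    using compact_group_closed_subgroup[OF sK clK] KK by simp
  obtain H where H: "subgroup H (G\<lparr>carrier := K\<rparr>)" "closedin (subtopology T K) H" "infinite H"
    "second_countable (subtopology (subtopology T K) H)"
    using KG.ex_infinite_metric_subgroup infK by auto
  have HK: "H \<subseteq> K" using subgroup.subset[OF H(1)] by simp
  have "subgroup H G" by (rule incl_subgroup[OF sK H(1)])
  moreover have "closedin T H" by (rule closedin_trans_full[OF H(2) clK])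
  moreover have "subtopology (subtopology T K) H = subtopology T H"
    using HK by (simp add: subtopology_subtopology Int_absorb1)
  ultimately show ?thesis using H(3,4) by auto
qed

theorem corollary3p6:
  fixes G :: "('a, 'b) monoid_scheme" and T :: "'a topology"
  assumes "compact_group G T"
    and "infinite (carrier G)"
  shows "\<exists>H. subgroup H G \<and> closedin T H \<and> infinite H \<and>
    metric_compact_group (G\<lparr>carrier := H\<rparr>) (subtopology T H)"
proof -
  interpret compact_group G T by (rule assms(1))
  obtain H where "subgroup H G" "closedin T H" "infinite H" "second_countable (subtopology T H)"
    using ex_infinite_second_countable_subgroup[OF assms(2)] by (elim exE conjE)
  then show ?thesis using metric_compact_group_closed_subgroup by (intro exI conjI)
qed

end
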